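(* (a) Every Fell bundle (over an inverse semigroup) admits a saturated refinement. (b) Every locally regular Fell bundle admits a regular, saturated refinement. (c) If a Fell bundle admits a regular refinement, then it is locally regular.
   Context: For an inverse semigroup $S$, $E(S)$ is its set of idempotents, $s^*$ the inverse of $s$, and $s\le t$ the natural partial order ($s=ts^*s$). **Fell bundle.** A Fell bundle over $S$ is a collection $\mathcal{A}=\{\mathcal{A}_s\}_{s\in S}$ of Banach spaces (also viewed as their disjoint union) with a multiplication, an involution, and isometric linear maps $j_{t,s}:\mathcal{A}_s\to\mathcal{A}_t$ for $s\le t$, such that: (i) $\mathcal{A}_s\cdot\mathcal{A}_t\subseteq\mathcal{A}_{st}$, bilinearly; (ii) multiplication is associative; (iii) $\|ab\|\le\|a\|\|b\|$; (iv) $\mathcal{A}_s^*\subseteq\mathcal{A}_{s^*}$, conjugate-linearly; (v) $(a^* )^*=a$, $\|a^*\|=\|a\|$, $(ab)^*=b^*a^*$; (vi) $\|a^*a\|=\|a\|^2$ and $a^*a$ is a positive element of the $C^*$-algebra $\mathcal{A}_{s^*s}$ for $a\in\mathcal{A}_s$; (vii) $j_{t,r}=j_{t,s}\circ j_{s,r}$ if $r\le s\le t$; (viii) $j_{t,s}(a)j_{v,u}(b)=j_{tv,su}(ab)$ if $s\le t$, $u\le v$, $a\in\mathcal{A}_s$, $b\in\mathcal{A}_u$; (ix) $j_{t,s}(a)^*=j_{t^*,s^*}(a^* )$ if $s\le t$, $a\in\mathcal{A}_s$. It is saturated if $\mathcal{A}_s\cdot\mathcal{A}_t$ spans a dense subspace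 of $\mathcal{A}_{st}$ for all $s,t$. **(Local) regularity.** An imprimitivity Hilbert $A,B$-bimodule $\mathcal{F}$ is regular if there is an adjointable operator $u:B\to\mathcal{F}$ (of right Hilbert $B$-modules) with $u^*u=1$ and $uu^*=1$. It is locally regular if there is a family $\{\mathcal{F}_i\}_{i\in I}$ of (closed) sub-$A,B$-bimodules of $\mathcal{F}$, each regular as an imprimitivity $A_i,B_i$-bimodule, where $A_i$ and $B_i$ are the closed linear spans of the left and right inner products of elements of $\mathcal{F}_i$, such that $\mathcal{F}=\overline{\sum_i\mathcal{F}_i}$. A Fell bundle $\mathcal{A}$ is (locally) regular if each fiber $\mathcal{A}_s$ is (locally) regular as an imprimitivity Hilbert $I_s,J_s$-bimodule, where $I_s$ and $J_s$ are the closed linear spans of $\mathcal{A}_s\mathcal{A}_s^*$ and $\mathcal{A}_s^*\mathcal{A}_s$ (inner products $ab^*$ and $a^*b$). **Refinement.** Let $\mathcal{B}=\{\mathcal{B}_t\}_{t\in T}$ be a Fell bundle over an inverse semigroup $T$. A morphism from $\mathcal{B}$ to $\mathcal{A}=\{\mathcal{A}_s\}_{s\in S}$ is a pair $(\phi,\psi)$ with $\phi:T\to S$ a semigroup homomorphism and $\psi:\mathcal{B}\to\mathcal{A}$ a map such that $\psi(\mathcal{B}_t)\subseteq\mathcal{A}_{\phi(t)}$ with linear restriction $\psi_t:\mathcal{B}_t\to\mathcal{A}_{\phi(t)}$; $\psi(ab)=\psi(a)\psi(b)$ and $\psi(a^* )=\psi(a)^*$; and $\psi_{t'}\circ j^{\mathcal{B}}_{t',t}=j^{\mathcal{A}}_{\phi(t'),\phi(t)}\circ\psi_t$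 for $t\le t'$. $\mathcal{B}$ is a refinement of $\mathcal{A}$ if there is a morphism $(\phi,\psi)$ from $\mathcal{B}$ to $\mathcal{A}$ with $\phi$ surjective and essentially injective ($\phi(t)\in E(S)$ implies $t\in E(T)$), every $\psi_t$ injective, and $\mathcal{A}_s=\overline{\sum_{t\in\phi^{-1}(s)}\psi(\mathcal{B}_t)}$ for all $s\in S$. *)

theory Defs
  imports "HOL-Analysis.Analysis"
begin

section \<open>Inverse semigroups\<close>

record 's sgrp =
  elts :: "'s set"
  smult :: "'s \<Rightarrow> 's \<Rightarrow> 's" (infixl "\<cdot>\<index>" 70)

locale inverse_semigroup =
  fixes G :: "'s sgrp" (structure)
  assumes mult_closed: "s \<in> elts G \<Longrightarrow> t \<in> elts G \<Longrightarrow> s \<cdot> t \<in> elts G"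
    and mult_assoc:
      "r \<in> elts G \<Longrightarrow> s \<in> elts G \<Longrightarrow> t \<in> elts G \<Longrightarrow> (r \<cdot> s) \<cdot> t = r \<cdot> (s \<cdot> t)"
    and ex1_inverse:
      "s \<in> elts G \<Longrightarrow> \<exists>!t. t \<in> elts G \<and> s \<cdot> t \<cdot> s = s \<and> t \<cdot> s \<cdot> t = t"

definition sinv :: "'s sgrp \<Rightarrow> 's \<Rightarrow> 's" where
  "sinv G s = (THE t. t \<in> elts G \<and> smult G (smult G s t) s = s \<and> smult G (smult G t s) t = t)"

definition idempotents :: "'s sgrp \<Rightarrow> 's set" where
  "idempotents G = {e \<in> elts G. smult G e e = e}"

definition nat_le :: "'s sgrp \<Rightarrow> 's \<Rightarrow> 's \<Rightarrow> bool" where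
  "nat_le G s t \<longleftrightarrow> s \<in> elts G \<and> t \<in> elts G \<and> s = smult G t (smult G (sinv G s) s)"


section \<open>Complex Banach spaces with explicit carrier\<close>

record 'a cspace =
  vcarrier :: "'a set"
  vzero :: 'a
  vadd :: "'a \<Rightarrow> 'a \<Rightarrow> 'a"
  vscale :: "complex \<Rightarrow> 'a \<Rightarrow> 'a"
  vnorm :: "'a \<Rightarrow> real"

text \<open>The value outside the carrier is irrelevant; it is fixed to 0 because the library locale
  \<^locale>\<open>Metric_space\<close> wants nonnegativity and symmetry on the whole type.\<close>

definition vdist :: "('a, 'm) cspace_scheme \<Rightarrow> 'a \<Rightarrow> 'a \<Rightarrow> real" where
  "vdist V x y =
    (if x \<in> vcarrier V \<and> y \<in> vcarrier V then vnorm V (vadd V x (vscale V (- 1) y)) else 0)"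

locale complex_banach_space =
  fixes V :: "('a, 'm) cspace_scheme"
  assumes zero_closed: "vzero V \<in> vcarrier V"
    and add_closed: "x \<in> vcarrier V \<Longrightarrow> y \<in> vcarrier V \<Longrightarrow> vadd V x y \<in> vcarrier V"
    and scale_closed: "x \<in> vcarrier V \<Longrightarrow> vscale V c x \<in> vcarrier V"
    and add_assoc: "x \<in> vcarrier V \<Longrightarrow> y \<in> vcarrier V \<Longrightarrow> z \<in> vcarrier V \<Longrightarrow>
      vadd V (vadd V x y) z = vadd V x (vadd V y z)"
    and add_commute: "x \<in> vcarrier V \<Longrightarrow> y \<in> vcarrier V \<Longrightarrow> vadd V x y = vadd V y x"
    and add_zero: "x \<in> vcarrier V \<Longrightarrow> vadd V x (vzero V) = x"
    and add_uminus: "x \<in> vcarrier V \<Longrightarrow> vadd V x (vscale V (- 1) x) = vzero V"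
    and scale_scale: "x \<in> vcarrier V \<Longrightarrow> vscale V c (vscale V d x) = vscale V (c * d) x"
    and scale_one: "x \<in> vcarrier V \<Longrightarrow> vscale V 1 x = x"
    and scale_add_left:
      "x \<in> vcarrier V \<Longrightarrow> vscale V (c + d) x = vadd V (vscale V c x) (vscale V d x)"
    and scale_add_right: "x \<in> vcarrier V \<Longrightarrow> y \<in> vcarrier V \<Longrightarrow>
      vscale V c (vadd V x y) = vadd V (vscale V c x) (vscale V c y)"
    and norm_nonneg: "x \<in> vcarrier V \<Longrightarrow> 0 \<le> vnorm V x"
    and norm_eq_zero: "x \<in> vcarrier V \<Longrightarrow> vnorm V x = 0 \<longleftrightarrow> x = vzero V"
    and norm_scale: "x \<in> vcarrier V \<Longrightarrow> vnorm V (vscale V c x) = cmod c * vnorm V x"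
    and norm_triangle: "x \<in> vcarrier V \<Longrightarrow> y \<in> vcarrier V \<Longrightarrow>
      vnorm V (vadd V x y) \<le> vnorm V x + vnorm V y"
    and complete: "Metric_space.mcomplete (vcarrier V) (vdist V)"

definition lin_subspace :: "('a, 'm) cspace_scheme \<Rightarrow> 'a set \<Rightarrow> bool" where
  "lin_subspace V W \<longleftrightarrow> W \<subseteq> vcarrier V \<and> vzero V \<in> W \<and>
    (\<forall>x\<in>W. \<forall>y\<in>W. vadd V x y \<in> W) \<and> (\<forall>c. \<forall>x\<in>W. vscale V c x \<in> W)"

definition vclosure :: "('a, 'm) cspace_scheme \<Rightarrow> 'a set \<Rightarrow> 'a set" where
  "vclosure V X = Metric_space.mtopology (vcarrier V) (vdist V) closure_of X"

definition lin_span :: "('a, 'm) cspace_scheme \<Rightarrow> 'a set \<Rightarrow> 'a set" where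
  "lin_span V X = \<Inter>{W. lin_subspace V W \<and> X \<subseteq> W}"

definition closed_span :: "('a, 'm) cspace_scheme \<Rightarrow> 'a set \<Rightarrow> 'a set" where
  "closed_span V X = vclosure V (lin_span V X)"

definition lin_map :: "('a, 'm) cspace_scheme \<Rightarrow> ('b, 'n) cspace_scheme \<Rightarrow> ('a \<Rightarrow> 'b) \<Rightarrow> bool" where
  "lin_map V W f \<longleftrightarrow> (\<forall>x\<in>vcarrier V. f x \<in> vcarrier W) \<and>
    (\<forall>x\<in>vcarrier V. \<forall>y\<in>vcarrier V. f (vadd V x y) = vadd W (f x) (f y)) \<and>
    (\<forall>c. \<forall>x\<in>vcarrier V. f (vscale V c x) = vscale W c (f x))"

definition conj_lin_map :: "('a, 'm) cspace_scheme \<Rightarrow> ('b, 'n) cspace_scheme \<Rightarrow> ('a \<Rightarrow> 'b) \<Rightarrow> bool" where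
  "conj_lin_map V W f \<longleftrightarrow> (\<forall>x\<in>vcarrier V. f x \<in> vcarrier W) \<and>
    (\<forall>x\<in>vcarrier V. \<forall>y\<in>vcarrier V. f (vadd V x y) = vadd W (f x) (f y)) \<and>
    (\<forall>c. \<forall>x\<in>vcarrier V. f (vscale V c x) = vscale W (cnj c) (f x))"


section \<open>Positive elements of C*-algebras\<close>

record 'a cstar = "'a cspace" +
  atimes :: "'a \<Rightarrow> 'a \<Rightarrow> 'a"
  astar :: "'a \<Rightarrow> 'a"

text \<open>C*-algebras need not be unital, so the spectrum is computed in the unitization, whose
  elements (z, a) stand for z 1 + a. For unital algebras this differs from the usual spectrum
  at most by the value 0, which does not matter for positivity.\<close>

definition unitization_mult ::
    "('a, 'm) cstar_scheme \<Rightarrow> complex \<times> 'a \<Rightarrow> complex \<times> 'a \<Rightarrow> complex \<times> 'a" where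
  "unitization_mult A x y = (fst x * fst y,
    vadd A (vadd A (vscale A (fst x) (snd y)) (vscale A (fst y) (snd x))) (atimes A (snd x) (snd y)))"

definition spectrum :: "('a, 'm) cstar_scheme \<Rightarrow> 'a \<Rightarrow> complex set" where
  "spectrum A a = {z. \<not> (\<exists>y \<in> UNIV \<times> vcarrier A.
     unitization_mult A (z, vscale A (- 1) a) y = (1, vzero A) \<and>
     unitization_mult A y (z, vscale A (- 1) a) = (1, vzero A))}"

definition positive_elem :: "('a, 'm) cstar_scheme \<Rightarrow> 'a \<Rightarrow> bool" where
  "positive_elem A a \<longleftrightarrow> a \<in> vcarrier A \<and> astar A a = a \<and> spectrum A a \<subseteq> \<real>\<^sub>\<ge>\<^sub>0"


section \<open>Regularity of imprimitivity bimodules\<close>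

text \<open>Only the data of a Hilbert bimodule. The bimodules below are fibers of Fell bundles and
  their closed sub-bimodules, with coefficient algebras cut down to the closed spans of the inner
  products; these satisfy the axioms of imprimitivity bimodules by the axioms of a Fell bundle.\<close>

record ('a, 'b, 'f) bimod =
  lalg :: "'a cstar"
  ralg :: "'b cstar"
  bspace :: "'f cspace"
  lact :: "'a \<Rightarrow> 'f \<Rightarrow> 'f"
  ract :: "'f \<Rightarrow> 'b \<Rightarrow> 'f"
  linner :: "'f \<Rightarrow> 'f \<Rightarrow> 'a"
  rinner :: "'f \<Rightarrow> 'f \<Rightarrow> 'b"

text \<open>\<open>v\<close> is an adjoint of \<open>u\<close> for the algebra-valued inner products \<open>ipE\<close> and \<open>ipF\<close>;
  linearity, module linearity and boundedness of \<open>u\<close> are consequences.\<close>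

definition is_adjoint ::
    "'e set \<Rightarrow> ('e \<Rightarrow> 'e \<Rightarrow> 'b) \<Rightarrow> 'f set \<Rightarrow> ('f \<Rightarrow> 'f \<Rightarrow> 'b) \<Rightarrow> ('e \<Rightarrow> 'f) \<Rightarrow> ('f \<Rightarrow> 'e) \<Rightarrow> bool" where
  "is_adjoint E ipE F ipF u v \<longleftrightarrow> (\<forall>x\<in>E. u x \<in> F) \<and> (\<forall>y\<in>F. v y \<in> E) \<and>
    (\<forall>x\<in>E. \<forall>y\<in>F. ipF (u x) y = ipE x (v y))"

definition regular_bimod :: "('a, 'b, 'f) bimod \<Rightarrow> bool" where
  "regular_bimod F \<longleftrightarrow> (\<exists>u v.
     is_adjoint (vcarrier (ralg F)) (\<lambda>b c. atimes (ralg F) (astar (ralg F) b) c)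
       (vcarrier (bspace F)) (rinner F) u v \<and>
     (\<forall>b\<in>vcarrier (ralg F). v (u b) = b) \<and>
     (\<forall>x\<in>vcarrier (bspace F). u (v x) = x))"

definition closed_sub_bimod :: "('a, 'b, 'f) bimod \<Rightarrow> 'f set \<Rightarrow> bool" where
  "closed_sub_bimod F X \<longleftrightarrow> lin_subspace (bspace F) X \<and> vclosure (bspace F) X = X \<and>
    (\<forall>a\<in>vcarrier (lalg F). \<forall>x\<in>X. lact F a x \<in> X) \<and>
    (\<forall>x\<in>X. \<forall>b\<in>vcarrier (ralg F). ract F x b \<in> X)"

definition sub_bimod :: "('a, 'b, 'f) bimod \<Rightarrow> 'f set \<Rightarrow> ('a, 'b, 'f) bimod" where
  "sub_bimod F X = F\<lparr>
     lalg := (lalg F)\<lparr>vcarrier := closed_span (lalg F) {linner F x y |x y. x \<in> X \<and> y \<in> X}\<rparr>,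
     ralg := (ralg F)\<lparr>vcarrier := closed_span (ralg F) {rinner F x y |x y. x \<in> X \<and> y \<in> X}\<rparr>,
     bspace := (bspace F)\<lparr>vcarrier := X\<rparr>\<rparr>"

definition locally_regular_bimod :: "('a, 'b, 'f) bimod \<Rightarrow> bool" where
  "locally_regular_bimod F \<longleftrightarrow> (\<exists>\<F>.
     (\<forall>X\<in>\<F>. closed_sub_bimod F X \<and> regular_bimod (sub_bimod F X)) \<and>
     vcarrier (bspace F) = closed_span (bspace F) (\<Union>\<F>))"


section \<open>Fell bundles over inverse semigroups\<close>

text \<open>The disjoint union of the fibers is encoded by indexing all operations by the base:
  \<open>fmult A s t\<close> is the multiplication of the fibers at \<open>s\<close> and \<open>t\<close>, \<open>fstar A s\<close> the involution on
  the fiber at \<open>s\<close>, and \<open>fincl A t s\<close> the map from the fiber at \<open>s\<close> to the one at \<open>t\<close>. The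
  carriers of different fibers may overlap as sets; this has no meaning.\<close>

record ('s, 'a) fell =
  base :: "'s sgrp"
  fib :: "'s \<Rightarrow> 'a cspace"
  fmult :: "'s \<Rightarrow> 's \<Rightarrow> 'a \<Rightarrow> 'a \<Rightarrow> 'a"
  fstar :: "'s \<Rightarrow> 'a \<Rightarrow> 'a"
  fincl :: "'s \<Rightarrow> 's \<Rightarrow> 'a \<Rightarrow> 'a"

abbreviation fcarrier :: "('s, 'a) fell \<Rightarrow> 's \<Rightarrow> 'a set" where
  "fcarrier A s \<equiv> vcarrier (fib A s)"

text \<open>The fiber over an idempotent as an algebra.\<close>

definition fib_alg :: "('s, 'a) fell \<Rightarrow> 's \<Rightarrow> 'a cstar" where
  "fib_alg A e = cspace.extend (fib A e) \<lparr>atimes = fmult A e e, astar = fstar A e\<rparr>"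

locale fell_bundle =
  fixes A :: "('s, 'a) fell"
    and S :: "'s set" and mul :: "'s \<Rightarrow> 's \<Rightarrow> 's" (infixl "\<odot>" 70)
    and inv :: "'s \<Rightarrow> 's" and le :: "'s \<Rightarrow> 's \<Rightarrow> bool" (infix "\<preceq>" 50)
  defines "S \<equiv> elts (base A)" and "mul \<equiv> smult (base A)"
    and "inv \<equiv> sinv (base A)" and "le \<equiv> nat_le (base A)"
  assumes base: "inverse_semigroup (base A)"
    and banach: "s \<in> S \<Longrightarrow> complex_banach_space (fib A s)"
    and incl_linear: "s \<preceq> t \<Longrightarrow> lin_map (fib A s) (fib A t) (fincl A t s)"
    and incl_isometric: "s \<preceq> t \<Longrightarrow> a \<in> fcarrier A s \<Longrightarrow>
      vnorm (fib A t) (fincl A t s a) = vnorm (fib A s) a"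
    and mult_linear_right: "s \<in> S \<Longrightarrow> t \<in> S \<Longrightarrow> a \<in> fcarrier A s \<Longrightarrow>
      lin_map (fib A t) (fib A (s \<odot> t)) (\<lambda>b. fmult A s t a b)"
    and mult_linear_left: "s \<in> S \<Longrightarrow> t \<in> S \<Longrightarrow> b \<in> fcarrier A t \<Longrightarrow>
      lin_map (fib A s) (fib A (s \<odot> t)) (\<lambda>a. fmult A s t a b)"
    and mult_assoc: "r \<in> S \<Longrightarrow> s \<in> S \<Longrightarrow> t \<in> S \<Longrightarrow>
      a \<in> fcarrier A r \<Longrightarrow> b \<in> fcarrier A s \<Longrightarrow> c \<in> fcarrier A t \<Longrightarrow>
      fmult A (r \<odot> s) t (fmult A r s a b) c = fmult A r (s \<odot> t) a (fmult A s t b c)"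
    and norm_mult: "s \<in> S \<Longrightarrow> t \<in> S \<Longrightarrow> a \<in> fcarrier A s \<Longrightarrow> b \<in> fcarrier A t \<Longrightarrow>
      vnorm (fib A (s \<odot> t)) (fmult A s t a b) \<le> vnorm (fib A s) a * vnorm (fib A t) b"
    and star_conj_linear: "s \<in> S \<Longrightarrow> conj_lin_map (fib A s) (fib A (inv s)) (fstar A s)"
    and star_star: "s \<in> S \<Longrightarrow> a \<in> fcarrier A s \<Longrightarrow> fstar A (inv s) (fstar A s a) = a"
    and norm_star: "s \<in> S \<Longrightarrow> a \<in> fcarrier A s \<Longrightarrow>
      vnorm (fib A (inv s)) (fstar A s a) = vnorm (fib A s) a"
    and star_mult: "s \<in> S \<Longrightarrow> t \<in> S \<Longrightarrow> a \<in> fcarrier A s \<Longrightarrow> b \<in> fcarrier A t \<Longrightarrow>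
      fstar A (s \<odot> t) (fmult A s t a b) = fmult A (inv t) (inv s) (fstar A t b) (fstar A s a)"
    and cstar_identity: "s \<in> S \<Longrightarrow> a \<in> fcarrier A s \<Longrightarrow>
      vnorm (fib A (inv s \<odot> s)) (fmult A (inv s) s (fstar A s a) a) = (vnorm (fib A s) a)\<^sup>2"
    and star_mult_positive: "s \<in> S \<Longrightarrow> a \<in> fcarrier A s \<Longrightarrow>
      positive_elem (fib_alg A (inv s \<odot> s)) (fmult A (inv s) s (fstar A s a) a)"
    and incl_incl: "r \<preceq> s \<Longrightarrow> s \<preceq> t \<Longrightarrow> a \<in> fcarrier A r \<Longrightarrow>
      fincl A t r a = fincl A t s (fincl A s r a)"
    and incl_mult: "s \<preceq> t \<Longrightarrow> u \<preceq> v \<Longrightarrow> a \<in> fcarrier A s \<Longrightarrow> b \<in> fcarrier A u \<Longrightarrow>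
      fmult A t v (fincl A t s a) (fincl A v u b) = fincl A (t \<odot> v) (s \<odot> u) (fmult A s u a b)"
    and incl_star: "s \<preceq> t \<Longrightarrow> a \<in> fcarrier A s \<Longrightarrow>
      fstar A t (fincl A t s a) = fincl A (inv t) (inv s) (fstar A s a)"

definition saturated :: "('s, 'a) fell \<Rightarrow> bool" where
  "saturated A \<longleftrightarrow> (\<forall>s\<in>elts (base A). \<forall>t\<in>elts (base A).
     closed_span (fib A (smult (base A) s t))
       {fmult A s t a b |a b. a \<in> fcarrier A s \<and> b \<in> fcarrier A t} =
     fcarrier A (smult (base A) s t))"

text \<open>The fiber at \<open>s\<close> as an imprimitivity bimodule with inner products
  \<open>a b*\<close> and \<open>a* b\<close>.\<close>

definition fib_bimod :: "('s, 'a) fell \<Rightarrow> 's \<Rightarrow> ('a, 'a, 'a) bimod" where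
  "fib_bimod A s = (let s' = sinv (base A) s;
      e = smult (base A) s s'; f = smult (base A) s' s;
      lip = (\<lambda>a b. fmult A s s' a (fstar A s b));
      rip = (\<lambda>a b. fmult A s' s (fstar A s a) b)
    in \<lparr>lalg = (fib_alg A e)\<lparr>vcarrier :=
            closed_span (fib A e) {lip a b |a b. a \<in> fcarrier A s \<and> b \<in> fcarrier A s}\<rparr>,
        ralg = (fib_alg A f)\<lparr>vcarrier :=
            closed_span (fib A f) {rip a b |a b. a \<in> fcarrier A s \<and> b \<in> fcarrier A s}\<rparr>,
        bspace = fib A s, lact = fmult A e s, ract = fmult A s f,
        linner = lip, rinner = rip\<rparr>)"

definition regular :: "('s, 'a) fell \<Rightarrow> bool" where
  "regular A \<longleftrightarrow> (\<forall>s\<in>elts (base A). regular_bimod (fib_bimod A s))"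

definition locally_regular :: "('s, 'a) fell \<Rightarrow> bool" where
  "locally_regular A \<longleftrightarrow> (\<forall>s\<in>elts (base A). locally_regular_bimod (fib_bimod A s))"


section \<open>Morphisms and refinements\<close>

text \<open>The map of total spaces is given by its restrictions \<open>\<psi> t\<close> to the fibers.\<close>

definition fell_morphism ::
    "('t, 'b) fell \<Rightarrow> ('s, 'a) fell \<Rightarrow> ('t \<Rightarrow> 's) \<Rightarrow> ('t \<Rightarrow> 'b \<Rightarrow> 'a) \<Rightarrow> bool" where
  "fell_morphism B A \<phi> \<psi> \<longleftrightarrow>
    (\<forall>t\<in>elts (base B). \<phi> t \<in> elts (base A)) \<and>
    (\<forall>t\<in>elts (base B). \<forall>u\<in>elts (base B).
       \<phi> (smult (base B) t u) = smult (base A) (\<phi> t) (\<phi> u)) \<and>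
    (\<forall>t\<in>elts (base B). lin_map (fib B t) (fib A (\<phi> t)) (\<psi> t)) \<and>
    (\<forall>t\<in>elts (base B). \<forall>u\<in>elts (base B). \<forall>a\<in>fcarrier B t. \<forall>b\<in>fcarrier B u.
       \<psi> (smult (base B) t u) (fmult B t u a b) = fmult A (\<phi> t) (\<phi> u) (\<psi> t a) (\<psi> u b)) \<and>
    (\<forall>t\<in>elts (base B). \<forall>a\<in>fcarrier B t.
       \<psi> (sinv (base B) t) (fstar B t a) = fstar A (\<phi> t) (\<psi> t a)) \<and>
    (\<forall>t t'. nat_le (base B) t t' \<longrightarrow> (\<forall>a\<in>fcarrier B t.
       \<psi> t' (fincl B t' t a) = fincl A (\<phi> t') (\<phi> t) (\<psi> t a)))"

definition refinement_of :: "('t, 'b) fell \<Rightarrow> ('s, 'a) fell \<Rightarrow> bool" where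
  "refinement_of B A \<longleftrightarrow> fell_bundle B \<and> fell_bundle A \<and> (\<exists>\<phi> \<psi>.
     fell_morphism B A \<phi> \<psi> \<and>
     \<phi> ` elts (base B) = elts (base A) \<and>
     (\<forall>t\<in>elts (base B). \<phi> t \<in> idempotents (base A) \<longrightarrow> t \<in> idempotents (base B)) \<and>
     (\<forall>t\<in>elts (base B). inj_on (\<psi> t) (fcarrier B t)) \<and>
     (\<forall>s\<in>elts (base A). fcarrier A s =
        closed_span (fib A s) (\<Union>t\<in>{t \<in> elts (base B). \<phi> t = s}. \<psi> t ` fcarrier B t)))"

end

theory Submission
  imports Defs
begin

text \<open>Call a closed subspace \<open>M\<close> of a fiber \<open>A\<^sub>s\<close> a slice if the unit fibers over \<open>s s\<^sup>*\<close> and \<open>s\<^sup>* s\<close>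
  act on it from both sides. With \<open>(s, M) (t, N)\<close> being \<open>s t\<close> together with the closed span of \<open>M N\<close>,
  and \<open>(s, M)\<^sup>* = (s\<^sup>*, M\<^sup>*)\<close>, the slices form an inverse semigroup. The slices themselves are the fibers of
  a Fell bundle over it, with the operations of \<open>A\<close>. Since the fiber over a product is by definition the
  closed span of the product of the fibers, this bundle is saturated, and forgetting the second
  component makes it a refinement of \<open>A\<close>. The same works for every family of slices that is closed
  under products and adjoints and contains, over each \<open>s\<close>, enough slices to span \<open>A\<^sub>s\<close>.

  Two facts make the slices an inverse semigroup: \<open>M M\<^sup>* M = M\<close>, and idempotent slices, which are the
  closed ideals of the fibers over idempotents, commute because closed ideals are self-adjoint. Both
  follow from \<open>in_vclosure_triple_products\<close>: every \<open>m \<in> M\<close> is a limit of elements \<open>m (m\<^sup>* y)\<close> with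
  \<open>y \<in> M\<close>. In place of functional calculus this rests on the norm estimate
  \<open>Cayley_estimate\<close> for a resolvent of \<open>m\<^sup>* m\<close> at an imaginary number, which exists because \<open>m\<^sup>* m\<close> is
  positive.

  A slice \<open>M\<close> is regular if and only if it is unitarily equivalent, as a right Hilbert module, to
  \<open>M\<^sup>* M\<close>. Unitary equivalence is compatible with multiplication by a slice from the right
  (\<open>unitarily_equivalent_mult\<close>), and from this it follows by semigroup computations alone that the
  regular slices are closed under products and adjoints. Local regularity of \<open>A\<close> says that regular
  slices span each fiber, so the bundle of regular slices is a regular, saturated refinement.

  Conversely, let \<open>B\<close> be a regular refinement of \<open>A\<close>, with fiber maps \<open>\<psi>\<^sub>t\<close>. The closure of the image of
  \<open>\<psi>\<^sub>t\<close> is a slice because \<open>\<phi>\<close> is essentially injective, and these closures span the fibers of \<open>A\<close>. A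
  unitary from \<open>B\<^sub>t\<^sup>* B\<^sub>t\<close> to \<open>B\<^sub>t\<close> induces a relation in \<open>A\<close> that preserves inner products. By
  \<open>unitary_extension\<close> such a relation extends to a unitary between the closed spans of its domain and
  its range, and these are the right ones by the Cayley estimate.\<close>

section \<open>Inverse semigroups\<close>

text \<open>If \<open>t\<close> and \<open>t'\<close> are inverses of \<open>s\<close>, commuting idempotents give \<open>t = t s t' = t'\<close>.\<close>

lemma inverse_semigroupI:
  fixes G :: "'s sgrp" (structure)
  assumes closed: "\<And>s t. s \<in> elts G \<Longrightarrow> t \<in> elts G \<Longrightarrow> s \<cdot> t \<in> elts G"
    and assoc: "\<And>r s t. r \<in> elts G \<Longrightarrow> s \<in> elts G \<Longrightarrow> t \<in> elts G \<Longrightarrow> (r \<cdot> s) \<cdot> t = r \<cdot> (s \<cdot> t)"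
    and inverse: "\<And>s. s \<in> elts G \<Longrightarrow> \<exists>t\<in>elts G. s \<cdot> t \<cdot> s = s \<and> t \<cdot> s \<cdot> t = t"
    and commute: "\<And>e f. e \<in> idempotents G \<Longrightarrow> f \<in> idempotents G \<Longrightarrow> e \<cdot> f = f \<cdot> e"
  shows "inverse_semigroup G"
proof
  fix s assume s: "s \<in> elts G"
  have unique: "t = t'"
    if t: "t \<in> elts G" "s \<cdot> t \<cdot> s = s" "t \<cdot> s \<cdot> t = t"
      and t': "t' \<in> elts G" "s \<cdot> t' \<cdot> s = s" "t' \<cdot> s \<cdot> t' = t'" for t t'
  proof -
    have "x \<cdot> y \<in> idempotents G" if "x \<in> elts G" "y \<in> elts G" "x \<cdot> y \<cdot> x = x" for x y
      unfolding idempotents_def using that assoc[of "x \<cdot> y" x y] closed by simp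
    then have idem: "s \<cdot> t \<in> idempotents G" "t \<cdot> s \<in> idempotents G"
      "s \<cdot> t' \<in> idempotents G" "t' \<cdot> s \<in> idempotents G"
      using s t t' by blast+
    have "t = t \<cdot> ((s \<cdot> t') \<cdot> (s \<cdot> t))"
      using s t t' by (metis assoc closed)
    also have "\<dots> = t \<cdot> ((s \<cdot> t) \<cdot> (s \<cdot> t'))"
      using commute idem by simp
    also have "\<dots> = t \<cdot> (s \<cdot> t')"
      using s t t' by (metis assoc closed)
    finally have 1: "t = t \<cdot> (s \<cdot> t')" .
    have "t' = ((t' \<cdot> s) \<cdot> (t \<cdot> s)) \<cdot> t'"
      using s t t' by (metis assoc closed)
    also have "\<dots> = ((t \<cdot> s) \<cdot> (t' \<cdot> s)) \<cdot> t'"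
      using commute idem by simp
    also have "\<dots> = t \<cdot> (s \<cdot> t')"
      using s t t' by (metis assoc closed)
    finally show ?thesis using 1 by simp
  qed
  from inverse[OF s] unique show "\<exists>!t. t \<in> elts G \<and> s \<cdot> t \<cdot> s = s \<and> t \<cdot> s \<cdot> t = t"
    by blast
qed (use closed assoc in auto)

context inverse_semigroup
begin

lemma inv_laws:
  assumes "s \<in> elts G"
  shows inv_closed: "sinv G s \<in> elts G"
    and "s \<cdot> sinv G s \<cdot> s = s"
    and "sinv G s \<cdot> s \<cdot> sinv G s = sinv G s"
  using theI'[OF ex1_inverse[OF assms]] unfolding sinv_def by auto

lemma inv_unique:
  assumes "s \<in> elts G" "t \<in> elts G" "s \<cdot> t \<cdot> s = s" "t \<cdot> s \<cdot> t = t"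
  shows "sinv G s = t"
  using ex1_inverse[OF assms(1)] inv_laws[OF assms(1)] assms(2-) by blast

lemma inv_inv: "s \<in> elts G \<Longrightarrow> sinv G (sinv G s) = s"
  by (intro inv_unique inv_laws) auto

lemma idempotent_inv: "e \<in> idempotents G \<Longrightarrow> sinv G e = e"
  unfolding idempotents_def by (intro inv_unique) auto

lemma idempotents_closed:
  assumes e: "e \<in> idempotents G" and f: "f \<in> idempotents G"
  shows "e \<cdot> f \<in> idempotents G"
proof -
  have ef: "e \<in> elts G" "f \<in> elts G" "e \<cdot> e = e" "f \<cdot> f = f"
    using e f unfolding idempotents_def by auto
  define x where "x = sinv G (e \<cdot> f)"
  have x: "x \<in> elts G" "e \<cdot> f \<cdot> x \<cdot> (e \<cdot> f) = e \<cdot> f" "x \<cdot> (e \<cdot> f) \<cdot> x = x"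
    using inv_laws[of "e \<cdot> f"] mult_closed ef unfolding x_def by auto
  \<comment> \<open>\<open>f x e\<close> is another inverse of \<open>e f\<close>, and it is idempotent.\<close>
  have ee: "e \<cdot> (e \<cdot> z) = e \<cdot> z" "f \<cdot> (f \<cdot> z) = f \<cdot> z" if "z \<in> elts G" for z
    using ef that by (metis mult_assoc)+
  have xx: "x \<cdot> (e \<cdot> (f \<cdot> x)) = x"
    using x ef by (simp add: mult_assoc mult_closed)
  have xx': "x \<cdot> (e \<cdot> (f \<cdot> (x \<cdot> z))) = x \<cdot> z" if "z \<in> elts G" for z
    using xx x ef that by (metis mult_assoc mult_closed)
  have "x = f \<cdot> (x \<cdot> e)"
    unfolding x_def
  proof (rule inv_unique)
    show "e \<cdot> f \<cdot> (f \<cdot> (sinv G (e \<cdot> f) \<cdot> e)) \<cdot> (e \<cdot> f) = e \<cdot> f"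
      using x ef ee unfolding x_def[symmetric] by (simp add: mult_assoc mult_closed)
    show "f \<cdot> (sinv G (e \<cdot> f) \<cdot> e) \<cdot> (e \<cdot> f) \<cdot> (f \<cdot> (sinv G (e \<cdot> f) \<cdot> e)) = f \<cdot> (sinv G (e \<cdot> f) \<cdot> e)"
      using x ef ee xx' unfolding x_def[symmetric] by (simp add: mult_assoc mult_closed)
  qed (use ef x mult_closed in \<open>auto simp: x_def[symmetric]\<close>)
  then have "x \<cdot> x = x"
    using x ef ee xx' by (metis mult_assoc mult_closed)
  then have "x \<in> idempotents G"
    using x unfolding idempotents_def by auto
  then show ?thesis
    using idempotent_inv[of x] inv_inv[of "e \<cdot> f"] ef mult_closed unfolding x_def by auto
qed

lemma idempotents_commute:
  assumes e: "e \<in> idempotents G" and f: "f \<in> idempotents G"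
  shows "e \<cdot> f = f \<cdot> e"
proof -
  have ef: "e \<in> elts G" "f \<in> elts G" "e \<cdot> e = e" "f \<cdot> f = f"
    and ef': "e \<cdot> f \<in> elts G" "f \<cdot> e \<in> elts G" "(e \<cdot> f) \<cdot> (e \<cdot> f) = e \<cdot> f" "(f \<cdot> e) \<cdot> (f \<cdot> e) = f \<cdot> e"
    using e f idempotents_closed unfolding idempotents_def by auto
  have "sinv G (e \<cdot> f) = f \<cdot> e"
    using ef ef' by (intro inv_unique) (metis mult_assoc mult_closed)+
  then show ?thesis
    using idempotent_inv[OF idempotents_closed[OF e f]] by simp
qed

lemma mult_inv_idempotent:
  assumes "s \<in> elts G"
  shows "s \<cdot> sinv G s \<in> idempotents G"
  unfolding idempotents_def
  using inv_laws[OF assms] assms mult_closed mult_assoc[of "s \<cdot> sinv G s" s "sinv G s"] by simp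

lemma inv_mult_idempotent: "s \<in> elts G \<Longrightarrow> sinv G s \<cdot> s \<in> idempotents G"
  using mult_inv_idempotent[of "sinv G s"] inv_closed inv_inv by simp

lemma inv_mult:
  assumes s: "s \<in> elts G" and t: "t \<in> elts G"
  shows "sinv G (s \<cdot> t) = sinv G t \<cdot> sinv G s"
proof (rule inv_unique)
  let ?s = "sinv G s" and ?t = "sinv G t"
  note closed = s t inv_closed[OF s] inv_closed[OF t] mult_closed
  have comm: "(t \<cdot> ?t) \<cdot> (?s \<cdot> s) = (?s \<cdot> s) \<cdot> (t \<cdot> ?t)"
    using idempotents_commute inv_mult_idempotent mult_inv_idempotent s t by simp
  have "s \<cdot> t \<cdot> (?t \<cdot> ?s) \<cdot> (s \<cdot> t) = s \<cdot> ((t \<cdot> ?t) \<cdot> (?s \<cdot> s)) \<cdot> t"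
    using closed by (simp add: mult_assoc)
  also have "\<dots> = (s \<cdot> ?s \<cdot> s) \<cdot> (t \<cdot> ?t \<cdot> t)"
    unfolding comm using closed by (simp add: mult_assoc)
  finally show "s \<cdot> t \<cdot> (?t \<cdot> ?s) \<cdot> (s \<cdot> t) = s \<cdot> t"
    using inv_laws s t by simp
  have "?t \<cdot> ?s \<cdot> (s \<cdot> t) \<cdot> (?t \<cdot> ?s) = ?t \<cdot> ((?s \<cdot> s) \<cdot> (t \<cdot> ?t)) \<cdot> ?s"
    using closed by (simp add: mult_assoc)
  also have "\<dots> = (?t \<cdot> t \<cdot> ?t) \<cdot> (?s \<cdot> s \<cdot> ?s)"
    unfolding comm[symmetric] using closed by (simp add: mult_assoc)
  finally show "?t \<cdot> ?s \<cdot> (s \<cdot> t) \<cdot> (?t \<cdot> ?s) = ?t \<cdot> ?s"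
    using inv_laws s t by simp
qed (use assms inv_closed mult_closed in auto)

lemma nat_le_refl: "s \<in> elts G \<Longrightarrow> nat_le G s s"
  unfolding nat_le_def using inv_laws mult_assoc by force

lemma nat_le_mult_idempotent:
  assumes s: "s \<in> elts G" and e: "e \<in> idempotents G"
  shows "nat_le G (s \<cdot> e) s"
proof -
  have e': "e \<in> elts G" "sinv G e = e" "e \<cdot> e = e"
    using e idempotent_inv unfolding idempotents_def by auto
  have i: "sinv G s \<in> elts G" using inv_closed s by simp
  have "s \<cdot> (sinv G (s \<cdot> e) \<cdot> (s \<cdot> e)) = s \<cdot> (e \<cdot> (sinv G s \<cdot> s)) \<cdot> e"
    using s e' i by (simp add: inv_mult mult_assoc mult_closed)
  also have "e \<cdot> (sinv G s \<cdot> s) = (sinv G s \<cdot> s) \<cdot> e"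
    using idempotents_commute[OF e inv_mult_idempotent[OF s]] .
  also have "s \<cdot> ((sinv G s \<cdot> s) \<cdot> e) \<cdot> e = (s \<cdot> sinv G s \<cdot> s) \<cdot> (e \<cdot> e)"
    using s e' i by (simp add: mult_assoc mult_closed)
  also have "\<dots> = s \<cdot> e"
    using inv_laws s e' by simp
  finally show ?thesis
    unfolding nat_le_def using s e' mult_closed by auto
qed

lemma nat_le_idempotent_mult:
  assumes s: "s \<in> elts G" and e: "e \<in> idempotents G"
  shows "nat_le G (e \<cdot> s) s"
proof -
  have e': "e \<in> elts G" "sinv G e = e" "e \<cdot> e = e"
    using e idempotent_inv unfolding idempotents_def by auto
  have i: "sinv G s \<in> elts G" using inv_closed s by simp
  have "s \<cdot> (sinv G (e \<cdot> s) \<cdot> (e \<cdot> s)) = (s \<cdot> sinv G s) \<cdot> (e \<cdot> e) \<cdot> s"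
    using s e' i mult_assoc[of e e s] by (simp add: inv_mult mult_assoc mult_closed)
  also have "\<dots> = ((s \<cdot> sinv G s) \<cdot> e) \<cdot> s"
    using e' by simp
  also have "(s \<cdot> sinv G s) \<cdot> e = e \<cdot> (s \<cdot> sinv G s)"
    using idempotents_commute[OF mult_inv_idempotent[OF s] e] .
  also have "e \<cdot> (s \<cdot> sinv G s) \<cdot> s = e \<cdot> (s \<cdot> sinv G s \<cdot> s)"
    using s e' i by (simp add: mult_assoc mult_closed)
  also have "\<dots> = e \<cdot> s"
    using inv_laws s by simp
  finally show ?thesis
    unfolding nat_le_def using s e' mult_closed by auto
qed

lemma nat_le_source:
  assumes "nat_le G s t"
  shows "nat_le G (sinv G s \<cdot> s) (sinv G t \<cdot> t)"
proof -
  define e where "e = sinv G s \<cdot> s"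
  have st: "s \<in> elts G" "t \<in> elts G" "s = t \<cdot> e"
    using assms unfolding nat_le_def e_def by auto
  have e: "e \<in> idempotents G" "e \<in> elts G" "sinv G e = e" "e \<cdot> e = e"
    using inv_mult_idempotent[OF st(1)] idempotent_inv unfolding e_def idempotents_def by auto
  have i: "sinv G t \<in> elts G" using inv_closed st by simp
  have "e = sinv G (t \<cdot> e) \<cdot> (t \<cdot> e)"
    using st(3) unfolding e_def by simp
  also have "\<dots> = (e \<cdot> (sinv G t \<cdot> t)) \<cdot> e"
    using st e i by (simp add: inv_mult mult_assoc mult_closed)
  also have "e \<cdot> (sinv G t \<cdot> t) = (sinv G t \<cdot> t) \<cdot> e"
    using idempotents_commute[OF e(1) inv_mult_idempotent[OF st(2)]] .
  also have "(sinv G t \<cdot> t) \<cdot> e \<cdot> e = (sinv G t \<cdot> t) \<cdot> e"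
    using st e i by (simp add: mult_assoc mult_closed)
  finally show ?thesis
    using nat_le_mult_idempotent[OF _ e(1), of "sinv G t \<cdot> t"] st i mult_closed
    unfolding e_def[symmetric] by metis
qed

end

section \<open>Closed subspaces of Banach spaces\<close>

lemma closed_span_cong:
  assumes "vcarrier V = vcarrier W" "vzero V = vzero W" "vadd V = vadd W"
    "vscale V = vscale W" "vnorm V = vnorm W"
  shows "closed_span V X = closed_span W X"
proof -
  have d: "vdist V = vdist W"
    using assms by (simp add: vdist_def fun_eq_iff)
  show ?thesis
    unfolding closed_span_def lin_span_def lin_subspace_def vclosure_def using assms d by simp
qed

definition closed_subspace :: "('a, 'm) cspace_scheme \<Rightarrow> 'a set \<Rightarrow> bool" where
  "closed_subspace V W \<longleftrightarrow> lin_subspace V W \<and> vclosure V W = W"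

text \<open>Linear and conjugate-linear bounded maps are treated together, since all that matters here
  is that preimages of closed subspaces are closed subspaces.\<close>

definition bounded_semilinear :: "('a, 'm) cspace_scheme \<Rightarrow> ('b, 'n) cspace_scheme \<Rightarrow> ('a \<Rightarrow> 'b) \<Rightarrow> bool"
  where "bounded_semilinear V W f \<longleftrightarrow> (lin_map V W f \<or> conj_lin_map V W f) \<and>
    (\<exists>K. \<forall>x\<in>vcarrier V. vnorm W (f x) \<le> K * vnorm V x)"

context complex_banach_space
begin

lemma add_left_commute:
  assumes "x \<in> vcarrier V" "y \<in> vcarrier V" "z \<in> vcarrier V"
  shows "vadd V x (vadd V y z) = vadd V y (vadd V x z)"
  using assms by (metis add_assoc add_commute)

lemma zero_add: "x \<in> vcarrier V \<Longrightarrow> vadd V (vzero V) x = x"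
  using add_zero add_commute zero_closed by metis

lemma scale_0: "x \<in> vcarrier V \<Longrightarrow> vscale V 0 x = vzero V"
  using scale_add_left[of x 1 "-1"] add_uminus[of x] scale_one by auto

lemma scale_zero: "vscale V c (vzero V) = vzero V"
  using scale_0[OF zero_closed] scale_scale[OF zero_closed, of c 0] by simp

lemma norm_zero: "vnorm V (vzero V) = 0"
  using norm_eq_zero zero_closed by auto

lemma diff_add_cancel:
  assumes "x \<in> vcarrier V" "y \<in> vcarrier V"
  shows "vadd V (vadd V x (vscale V (-1) y)) y = x"
  using assms by (simp add: add_assoc scale_closed add_commute[of "vscale V (-1) y" y] add_uminus add_zero)

lemma add_right_imp_eq:
  assumes "x \<in> vcarrier V" "y \<in> vcarrier V" "z \<in> vcarrier V" "vadd V x z = vadd V y z"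
  shows "x = y"
proof -
  have "vadd V (vadd V x z) (vscale V (-1) z) = vadd V (vadd V y z) (vscale V (-1) z)"
    using assms by simp
  then show ?thesis
    using assms by (metis add_assoc scale_closed add_uminus add_zero)
qed

lemma dist_eq: "x \<in> vcarrier V \<Longrightarrow> y \<in> vcarrier V \<Longrightarrow>
    vdist V x y = vnorm V (vadd V x (vscale V (-1) y))"
  by (simp add: vdist_def)

lemma scale_minus_add_minus:
  assumes "x \<in> vcarrier V" "y \<in> vcarrier V"
  shows "vscale V (-1) (vadd V x (vscale V (-1) y)) = vadd V y (vscale V (-1) x)"
  using assms by (simp add: scale_add_right scale_closed scale_scale scale_one add_commute)

lemma dist_add:
  assumes "x \<in> vcarrier V" "y \<in> vcarrier V" "x' \<in> vcarrier V" "y' \<in> vcarrier V"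
  shows "vdist V (vadd V x y) (vadd V x' y') \<le> vdist V x x' + vdist V y y'"
proof -
  have "vadd V (vadd V x y) (vscale V (-1) (vadd V x' y'))
      = vadd V (vadd V x (vscale V (-1) x')) (vadd V y (vscale V (-1) y'))"
    using assms
    by (simp add: scale_add_right scale_closed add_closed add_assoc add_left_commute add_commute)
  then show ?thesis
    using assms norm_triangle by (simp add: dist_eq add_closed scale_closed)
qed

lemma dist_scale:
  assumes "x \<in> vcarrier V" "x' \<in> vcarrier V"
  shows "vdist V (vscale V c x) (vscale V c x') = cmod c * vdist V x x'"
proof -
  have "vadd V (vscale V c x) (vscale V (-1) (vscale V c x')) = vscale V c (vadd V x (vscale V (-1) x'))"
    using assms by (simp add: scale_add_right scale_closed scale_scale)
  then show ?thesis
    using assms norm_scale by (simp add: dist_eq add_closed scale_closed)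
qed

lemma dist_metric: "Metric_space (vcarrier V) (vdist V)"
proof
  fix x y z
  show "0 \<le> vdist V x y"
    by (simp add: vdist_def norm_nonneg add_closed scale_closed)
  show "vdist V x y = vdist V y x"
    using scale_minus_add_minus[of x y] norm_scale[of "vadd V x (vscale V (-1) y)" "-1"]
    by (auto simp: vdist_def add_closed scale_closed)
  assume x: "x \<in> vcarrier V" and y: "y \<in> vcarrier V"
  show "vdist V x y = 0 \<longleftrightarrow> x = y"
    using x y diff_add_cancel[OF x y] zero_add[OF y]
    by (auto simp: dist_eq norm_eq_zero add_closed scale_closed add_uminus)
  assume z: "z \<in> vcarrier V"
  have "vadd V x (vscale V (-1) z) = vadd V (vadd V x (vscale V (-1) y)) (vadd V y (vscale V (-1) z))"
    using x y z diff_add_cancel[OF x y] by (simp add: add_assoc[symmetric] add_closed scale_closed)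
  then show "vdist V x z \<le> vdist V x y + vdist V y z"
    using x y z norm_triangle by (simp add: dist_eq add_closed scale_closed)
qed

sublocale metric: Metric_space "vcarrier V" "vdist V"
  by (rule dist_metric)

lemma in_vclosure_iff:
  "x \<in> vclosure V X \<longleftrightarrow> x \<in> vcarrier V \<and> (\<forall>\<epsilon>>0. \<exists>y\<in>X. y \<in> vcarrier V \<and> vdist V x y < \<epsilon>)"
  unfolding vclosure_def metric.metric_closure_of by auto

lemma vclosure_subset_carrier: "vclosure V X \<subseteq> vcarrier V"
  using in_vclosure_iff by auto

lemma subset_vclosure: "X \<subseteq> vcarrier V \<Longrightarrow> X \<subseteq> vclosure V X"
  unfolding vclosure_def by (simp add: closure_of_subset)

lemma vclosure_mono: "X \<subseteq> Y \<Longrightarrow> vclosure V X \<subseteq> vclosure V Y"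
  unfolding vclosure_def by (rule closure_of_mono)

lemma vclosure_idem: "vclosure V (vclosure V X) = vclosure V X"
  unfolding vclosure_def by (rule closure_of_closure_of)

lemma closed_subspaceI:
  assumes "lin_subspace V W" "vclosure V W \<subseteq> W"
  shows "closed_subspace V W"
  using assms subset_vclosure unfolding closed_subspace_def lin_subspace_def by blast

lemma vclosure_lin_subspace:
  assumes "lin_subspace V W"
  shows "closed_subspace V (vclosure V W)"
  unfolding closed_subspace_def lin_subspace_def
proof (intro conjI ballI allI vclosure_subset_carrier vclosure_idem)
  have W: "W \<subseteq> vcarrier V" "vzero V \<in> W" "\<And>x y. x \<in> W \<Longrightarrow> y \<in> W \<Longrightarrow> vadd V x y \<in> W"
    "\<And>c x. x \<in> W \<Longrightarrow> vscale V c x \<in> W"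
    using assms unfolding lin_subspace_def by auto
  show "vzero V \<in> vclosure V W"
    using subset_vclosure W by blast
  fix x c assume x: "x \<in> vclosure V W"
  show "vscale V c x \<in> vclosure V W"
    unfolding in_vclosure_iff
  proof (intro conjI allI impI)
    fix \<epsilon> :: real assume "\<epsilon> > 0"
    then have "\<epsilon> / (cmod c + 1) > 0"
      by (simp add: add_nonneg_pos)
    then obtain y where y: "y \<in> W" "vdist V x y < \<epsilon> / (cmod c + 1)"
      using x unfolding in_vclosure_iff by metis
    have "cmod c * vdist V x y \<le> (cmod c + 1) * vdist V x y"
      by (simp add: mult_right_mono)
    also have "\<dots> < \<epsilon>"
      using y(2) by (simp add: pos_less_divide_eq add_nonneg_pos mult.commute)
    finally show "\<exists>y\<in>W. y \<in> vcarrier V \<and> vdist V (vscale V c x) y < \<epsilon>"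
      using W y x dist_scale[of x y c] in_vclosure_iff by (intro bexI[of _ "vscale V c y"]) auto
  qed (use x in_vclosure_iff scale_closed in auto)
next
  have W: "W \<subseteq> vcarrier V" "\<And>x y. x \<in> W \<Longrightarrow> y \<in> W \<Longrightarrow> vadd V x y \<in> W"
    using assms unfolding lin_subspace_def by auto
  fix x y assume x: "x \<in> vclosure V W" and y: "y \<in> vclosure V W"
  show "vadd V x y \<in> vclosure V W"
    unfolding in_vclosure_iff
  proof (intro conjI allI impI)
    fix \<epsilon> :: real assume "\<epsilon> > 0"
    then have "\<epsilon> / 2 > 0" by simp
    then obtain x' y' where xy: "x' \<in> W" "vdist V x x' < \<epsilon> / 2" "y' \<in> W" "vdist V y y' < \<epsilon> / 2"
      using x y unfolding in_vclosure_iff by metis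
    then show "\<exists>z\<in>W. z \<in> vcarrier V \<and> vdist V (vadd V x y) z < \<epsilon>"
      using W x y dist_add[of x y x' y'] in_vclosure_iff
      by (intro bexI[of _ "vadd V x' y'"]) (force simp: subset_iff)+
  qed (use x y in_vclosure_iff add_closed in auto)
qed

lemma lin_subspace_carrier: "lin_subspace V (vcarrier V)"
  unfolding lin_subspace_def using zero_closed add_closed scale_closed by auto

lemma closed_subspace_carrier: "closed_subspace V (vcarrier V)"
  using lin_subspace_carrier closed_subspaceI vclosure_subset_carrier by auto

lemma lin_subspace_span: "X \<subseteq> vcarrier V \<Longrightarrow> lin_subspace V (lin_span V X)"
  using lin_subspace_carrier unfolding lin_span_def lin_subspace_def by blast

lemma closed_subspace_closed_span: "X \<subseteq> vcarrier V \<Longrightarrow> closed_subspace V (closed_span V X)"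
  unfolding closed_span_def using lin_subspace_span vclosure_lin_subspace by auto

lemma subset_closed_span:
  assumes "X \<subseteq> vcarrier V"
  shows "X \<subseteq> closed_span V X"
proof -
  have "X \<subseteq> lin_span V X" unfolding lin_span_def by auto
  moreover have "lin_span V X \<subseteq> vcarrier V"
    using lin_subspace_span[OF assms] unfolding lin_subspace_def by simp
  ultimately show ?thesis
    unfolding closed_span_def using subset_vclosure by blast
qed

lemma closed_span_least:
  assumes "closed_subspace V W" "X \<subseteq> W"
  shows "closed_span V X \<subseteq> W"
proof -
  have "lin_span V X \<subseteq> W"
    unfolding lin_span_def using assms closed_subspace_def by blast
  then show ?thesis
    using vclosure_mono assms unfolding closed_span_def closed_subspace_def by blast
qed

lemma closed_span_closed_subspace: "closed_subspace V W \<Longrightarrow> closed_span V W = W"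
  using closed_span_least[of W W] subset_closed_span[of W]
  unfolding closed_subspace_def lin_subspace_def by blast

lemma closed_span_subset_carrier: "closed_span V X \<subseteq> vcarrier V"
  unfolding closed_span_def by (rule vclosure_subset_carrier)

lemma closed_span_mono: "X \<subseteq> Y \<Longrightarrow> Y \<subseteq> vcarrier V \<Longrightarrow> closed_span V X \<subseteq> closed_span V Y"
  by (meson closed_span_least closed_subspace_closed_span order_trans subset_closed_span)

lemma closed_subspace_zero: "closed_subspace V {vzero V}"
proof (rule closed_subspaceI)
  show "lin_subspace V {vzero V}"
    unfolding lin_subspace_def using zero_closed add_zero scale_zero by auto
  have "x = vzero V" if "x \<in> vcarrier V" "\<forall>\<epsilon>>0. vdist V x (vzero V) < \<epsilon>" for x
    using that zero_closed by (metis metric.mdist_pos_eq order_less_irrefl)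
  then show "vclosure V {vzero V} \<subseteq> {vzero V}"
    using in_vclosure_iff by auto
qed

end

lemma closed_subspace_imp_carrier: "closed_subspace V W \<Longrightarrow> x \<in> W \<Longrightarrow> x \<in> vcarrier V"
  unfolding closed_subspace_def lin_subspace_def by auto

lemma closed_subspace_add: "closed_subspace V W \<Longrightarrow> x \<in> W \<Longrightarrow> y \<in> W \<Longrightarrow> vadd V x y \<in> W"
  unfolding closed_subspace_def lin_subspace_def by auto

lemma closed_subspace_scale: "closed_subspace V W \<Longrightarrow> x \<in> W \<Longrightarrow> vscale V c x \<in> W"
  unfolding closed_subspace_def lin_subspace_def by auto

lemma bounded_semilinear_closed:
  "bounded_semilinear V W f \<Longrightarrow> x \<in> vcarrier V \<Longrightarrow> f x \<in> vcarrier W"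
  unfolding bounded_semilinear_def lin_map_def conj_lin_map_def by auto

lemma bounded_semilinear_bound:
  assumes "bounded_semilinear V W f" "complex_banach_space V"
  obtains K where "K > 0" "\<And>x. x \<in> vcarrier V \<Longrightarrow> vnorm W (f x) \<le> K * vnorm V x"
proof -
  obtain K where K: "\<And>x. x \<in> vcarrier V \<Longrightarrow> vnorm W (f x) \<le> K * vnorm V x"
    using assms(1) unfolding bounded_semilinear_def by blast
  show ?thesis
  proof (rule that[of "\<bar>K\<bar> + 1"])
    fix x assume x: "x \<in> vcarrier V"
    have "K * vnorm V x \<le> (\<bar>K\<bar> + 1) * vnorm V x"
      using complex_banach_space.norm_nonneg[OF assms(2) x] by (simp add: mult_right_mono)
    then show "vnorm W (f x) \<le> (\<bar>K\<bar> + 1) * vnorm V x"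
      using K[OF x] by simp
  qed simp
qed

lemma bounded_semilinear_compose:
  assumes U: "complex_banach_space U" and f: "bounded_semilinear U V f" and g: "bounded_semilinear V W g"
    and V: "complex_banach_space V"
  shows "bounded_semilinear U W (\<lambda>x. g (f x))"
proof -
  obtain K where K: "K > 0" "\<And>x. x \<in> vcarrier U \<Longrightarrow> vnorm V (f x) \<le> K * vnorm U x"
    using bounded_semilinear_bound[OF f U] by blast
  obtain L where L: "L > 0" "\<And>x. x \<in> vcarrier V \<Longrightarrow> vnorm W (g x) \<le> L * vnorm V x"
    using bounded_semilinear_bound[OF g V] by blast
  have "vnorm W (g (f x)) \<le> (L * K) * vnorm U x" if x: "x \<in> vcarrier U" for x
  proof -
    have "vnorm W (g (f x)) \<le> L * vnorm V (f x)"
      using L(2)[OF bounded_semilinear_closed[OF f x]] .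
    also have "\<dots> \<le> L * (K * vnorm U x)"
      using K(2)[OF x] L(1) by simp
    finally show ?thesis by simp
  qed
  moreover have "lin_map U W (\<lambda>x. g (f x)) \<or> conj_lin_map U W (\<lambda>x. g (f x))"
    using f g unfolding bounded_semilinear_def lin_map_def conj_lin_map_def by auto
  ultimately show ?thesis
    unfolding bounded_semilinear_def by blast
qed

lemma semilinear_dist:
  assumes V: "complex_banach_space V" and W: "complex_banach_space W"
    and f: "lin_map V W f \<or> conj_lin_map V W f"
    and x: "x \<in> vcarrier V" and y: "y \<in> vcarrier V"
  shows "vdist W (f x) (f y) = vnorm W (f (vadd V x (vscale V (-1) y)))"
  using f x y complex_banach_space.scale_closed[OF V]
  by (auto simp: vdist_def lin_map_def conj_lin_map_def)

lemma semilinear_zero: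
  assumes V: "complex_banach_space V" and W: "complex_banach_space W"
    and f: "lin_map V W f \<or> conj_lin_map V W f"
  shows "f (vzero V) = vzero W"
proof -
  interpret V: complex_banach_space V by (fact V)
  interpret W: complex_banach_space W by (fact W)
  have "f (vzero V) \<in> vcarrier W" "f (vscale V 0 (vzero V)) = vscale W 0 (f (vzero V))"
    using f V.zero_closed unfolding lin_map_def conj_lin_map_def by auto
  then show ?thesis
    using V.scale_0[OF V.zero_closed] W.scale_0 by simp
qed

lemma closed_subspace_vimage:
  assumes V: "complex_banach_space V" and W: "complex_banach_space W"
    and f: "bounded_semilinear V W f" and U: "closed_subspace W U"
  shows "closed_subspace V {x \<in> vcarrier V. f x \<in> U}"
proof -
  interpret V: complex_banach_space V by (fact V)
  interpret W: complex_banach_space W by (fact W)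
  have f': "lin_map V W f \<or> conj_lin_map V W f"
    using f unfolding bounded_semilinear_def by auto
  have U': "lin_subspace W U" "vclosure W U = U"
    using U unfolding closed_subspace_def by auto
  show ?thesis
  proof (rule V.closed_subspaceI)
    have add: "f (vadd V x y) = vadd W (f x) (f y)" if "x \<in> vcarrier V" "y \<in> vcarrier V" for x y
      using f' that unfolding lin_map_def conj_lin_map_def by auto
    have scale: "\<exists>d. f (vscale V c x) = vscale W d (f x)" if "x \<in> vcarrier V" for c x
      using f' that unfolding lin_map_def conj_lin_map_def by auto
    show "lin_subspace V {x \<in> vcarrier V. f x \<in> U}"
      unfolding lin_subspace_def
      using U' semilinear_zero[OF V W f'] V.zero_closed V.add_closed V.scale_closed add scale
      unfolding lin_subspace_def by (auto, metis)
    show "vclosure V {x \<in> vcarrier V. f x \<in> U} \<subseteq> {x \<in> vcarrier V. f x \<in> U}"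
    proof
      fix x assume "x \<in> vclosure V {x \<in> vcarrier V. f x \<in> U}"
      then have x: "x \<in> vcarrier V"
        and ap: "\<And>\<epsilon>. \<epsilon> > 0 \<Longrightarrow> \<exists>y\<in>vcarrier V. f y \<in> U \<and> vdist V x y < \<epsilon>"
        unfolding V.in_vclosure_iff by auto
      obtain K where K: "K > 0" "\<And>x. x \<in> vcarrier V \<Longrightarrow> vnorm W (f x) \<le> K * vnorm V x"
        using bounded_semilinear_bound[OF f V] by blast
      have "f x \<in> vclosure W U"
        unfolding W.in_vclosure_iff
      proof (intro conjI allI impI)
        show "f x \<in> vcarrier W" using bounded_semilinear_closed[OF f x] .
        fix \<epsilon> :: real assume "\<epsilon> > 0"
        then have "\<epsilon> / K > 0" using K by simp
        then obtain y where y: "y \<in> vcarrier V" "f y \<in> U" "vdist V x y < \<epsilon> / K"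
          using ap by metis
        have "vdist W (f x) (f y) \<le> K * vdist V x y"
          using K(2)[of "vadd V x (vscale V (-1) y)"] x y(1)
          by (simp add: semilinear_dist[OF V W f'] V.dist_eq V.add_closed V.scale_closed)
        also have "\<dots> < \<epsilon>"
          using y(3) K(1) by (simp add: field_simps)
        finally show "\<exists>y\<in>U. y \<in> vcarrier W \<and> vdist W (f x) y < \<epsilon>"
          using y bounded_semilinear_closed[OF f] by blast
      qed
      then show "x \<in> {x \<in> vcarrier V. f x \<in> U}"
        using U' x by simp
    qed
  qed
qed

lemma closed_span_vimage:
  assumes V: "complex_banach_space V" and W: "complex_banach_space W"
    and f: "bounded_semilinear V W f" and U: "closed_subspace W U"
    and X: "X \<subseteq> vcarrier V" "\<And>x. x \<in> X \<Longrightarrow> f x \<in> U" and x: "x \<in> closed_span V X"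
  shows "f x \<in> U"
  using complex_banach_space.closed_span_least[OF V closed_subspace_vimage[OF V W f U], of X] X x
  by auto

lemma closed_subspace_equalizer:
  assumes V: "complex_banach_space V" and W: "complex_banach_space W"
    and f: "bounded_semilinear V W f" "lin_map V W f"
    and g: "bounded_semilinear V W g" "lin_map V W g"
  shows "closed_subspace V {x \<in> vcarrier V. f x = g x}"
proof -
  interpret V: complex_banach_space V by (fact V)
  interpret W: complex_banach_space W by (fact W)
  let ?h = "\<lambda>x. vadd W (f x) (vscale W (-1) (g x))"
  have fg: "f x \<in> vcarrier W" "g x \<in> vcarrier W" if "x \<in> vcarrier V" for x
    using that f g unfolding lin_map_def by auto
  obtain K where K: "K > 0" "\<And>x. x \<in> vcarrier V \<Longrightarrow> vnorm W (f x) \<le> K * vnorm V x"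
    using bounded_semilinear_bound[OF f(1) V] by blast
  obtain L where L: "L > 0" "\<And>x. x \<in> vcarrier V \<Longrightarrow> vnorm W (g x) \<le> L * vnorm V x"
    using bounded_semilinear_bound[OF g(1) V] by blast
  have "lin_map V W ?h"
    unfolding lin_map_def
  proof (intro conjI ballI allI)
    fix x assume x: "x \<in> vcarrier V"
    then show "?h x \<in> vcarrier W"
      using fg W.add_closed W.scale_closed by simp
    fix c
    show "?h (vscale V c x) = vscale W c (?h x)"
      using f(2) g(2) x fg[OF x] unfolding lin_map_def
      by (simp add: W.scale_add_right W.scale_closed W.scale_scale)
    fix y assume y: "y \<in> vcarrier V"
    show "?h (vadd V x y) = vadd W (?h x) (?h y)"
      using f(2) g(2) x y fg[OF x] fg[OF y] unfolding lin_map_def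
      by (simp add: W.scale_add_right W.scale_closed W.add_assoc W.add_left_commute W.add_closed)
  qed
  moreover have "vnorm W (?h x) \<le> (K + L) * vnorm V x" if x: "x \<in> vcarrier V" for x
    using W.norm_triangle[of "f x" "vscale W (-1) (g x)"] W.norm_scale[of "g x" "-1"] K(2)[OF x] L(2)[OF x]
      fg[OF x] W.scale_closed by (auto simp: algebra_simps)
  ultimately have "bounded_semilinear V W ?h"
    unfolding bounded_semilinear_def by blast
  from closed_subspace_vimage[OF V W this W.closed_subspace_zero]
  have "closed_subspace V {x \<in> vcarrier V. ?h x \<in> {vzero W}}" .
  moreover have "?h x = vzero W \<longleftrightarrow> f x = g x" if x: "x \<in> vcarrier V" for x
    using W.diff_add_cancel[of "f x" "g x"] W.zero_add[of "g x"] W.add_uminus[of "g x"] fg[OF x] by auto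
  ultimately show ?thesis
    by (smt (verit, best) Collect_cong singleton_iff)
qed

lemma vdist_carrier_update:
  "x \<in> W \<Longrightarrow> y \<in> W \<Longrightarrow> W \<subseteq> vcarrier V \<Longrightarrow> vdist (V\<lparr>vcarrier := W\<rparr>) x y = vdist V x y"
  by (auto simp: vdist_def)

context complex_banach_space
begin

lemma Cauchy_limit:
  fixes \<sigma> :: "nat \<Rightarrow> 'a"
  assumes "\<And>n. \<sigma> n \<in> vcarrier V"
    and "\<And>\<epsilon>. \<epsilon> > 0 \<Longrightarrow> \<exists>N. \<forall>m\<ge>N. \<forall>n\<ge>N. vdist V (\<sigma> m) (\<sigma> n) < \<epsilon>"
  obtains x where "x \<in> vcarrier V" "\<And>\<epsilon>. \<epsilon> > 0 \<Longrightarrow> \<exists>N. \<forall>n\<ge>N. vdist V (\<sigma> n) x < \<epsilon>"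
proof -
  have "metric.MCauchy \<sigma>"
    unfolding metric.MCauchy_def using assms by (metis image_subsetI)
  then obtain x where "limitin metric.mtopology \<sigma> x sequentially"
    using complete unfolding metric.mcomplete_def by blast
  then have x: "x \<in> vcarrier V"
    "\<forall>\<epsilon>>0. \<exists>N. \<forall>n\<ge>N. \<sigma> n \<in> vcarrier V \<and> vdist V (\<sigma> n) x < \<epsilon>"
    unfolding metric.limitin_metric eventually_sequentially by auto
  show ?thesis
    by (rule that[of x]) (use x in meson)+
qed

end

lemma mcompleteI:
  fixes V :: "('a, 'm) cspace_scheme"
  assumes V: "Metric_space (vcarrier V) (vdist V)"
    and lim: "\<And>\<sigma> :: nat \<Rightarrow> 'a. (\<And>n. \<sigma> n \<in> vcarrier V) \<Longrightarrow>
      (\<And>\<epsilon>. \<epsilon> > 0 \<Longrightarrow> \<exists>N. \<forall>m\<ge>N. \<forall>n\<ge>N. vdist V (\<sigma> m) (\<sigma> n) < \<epsilon>) \<Longrightarrow>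
      \<exists>x\<in>vcarrier V. \<forall>\<epsilon>>0. \<exists>N. \<forall>n\<ge>N. vdist V (\<sigma> n) x < \<epsilon>"
  shows "Metric_space.mcomplete (vcarrier V) (vdist V)"
proof -
  interpret Metric_space "vcarrier V" "vdist V" by (fact V)
  show ?thesis
    unfolding mcomplete_def
  proof (intro allI impI)
    fix \<sigma> assume "MCauchy \<sigma>"
    then have \<sigma>: "\<And>n. \<sigma> n \<in> vcarrier V"
      "\<And>\<epsilon>. \<epsilon> > 0 \<Longrightarrow> \<exists>N. \<forall>m\<ge>N. \<forall>n\<ge>N. vdist V (\<sigma> m) (\<sigma> n) < \<epsilon>"
      unfolding MCauchy_def by auto
    have "\<exists>x\<in>vcarrier V. \<forall>\<epsilon>>0. \<exists>N. \<forall>n\<ge>N. vdist V (\<sigma> n) x < \<epsilon>"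
      by (rule lim) (use \<sigma> in simp_all)
    then obtain x
      where "x \<in> vcarrier V" "\<forall>\<epsilon>>0. \<exists>N. \<forall>n\<ge>N. vdist V (\<sigma> n) x < \<epsilon>"
      by auto
    then have "limitin mtopology \<sigma> x sequentially"
      unfolding limitin_metric eventually_sequentially using \<sigma>(1) by simp
    then show "\<exists>x. limitin mtopology \<sigma> x sequentially"
      by blast
  qed
qed

lemma closed_subspace_banach:
  assumes V: "complex_banach_space V" and W: "closed_subspace V W"
  shows "complex_banach_space (V\<lparr>vcarrier := W\<rparr>)"
proof -
  interpret V: complex_banach_space V by (fact V)
  have sub: "W \<subseteq> vcarrier V"
    and W': "vzero V \<in> W" "\<And>x y. x \<in> W \<Longrightarrow> y \<in> W \<Longrightarrow> vadd V x y \<in> W" "\<And>c x. x \<in> W \<Longrightarrow> vscale V c x \<in> W"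
    "vclosure V W = W"
    using W unfolding closed_subspace_def lin_subspace_def by auto
  have c: "x \<in> W \<Longrightarrow> x \<in> vcarrier V" for x using sub by auto
  note d = vdist_carrier_update[OF _ _ sub]
  show ?thesis
  proof (unfold_locales, goal_cases)
    case 16
    show ?case
    proof (rule mcompleteI)
      show "Metric_space (vcarrier (V\<lparr>vcarrier := W\<rparr>)) (vdist (V\<lparr>vcarrier := W\<rparr>))"
      proof
        fix x y z
        show "0 \<le> vdist (V\<lparr>vcarrier := W\<rparr>) x y"
          using d[of x y] V.metric.nonneg[of x y] by (cases "x \<in> W \<and> y \<in> W") (auto simp: vdist_def)
        show "vdist (V\<lparr>vcarrier := W\<rparr>) x y = vdist (V\<lparr>vcarrier := W\<rparr>) y x"
          using d[of x y] d[of y x] V.metric.commute[of x y]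
          by (cases "x \<in> W \<and> y \<in> W") (auto simp: vdist_def)
        assume xy: "x \<in> vcarrier (V\<lparr>vcarrier := W\<rparr>)" "y \<in> vcarrier (V\<lparr>vcarrier := W\<rparr>)"
        then show "(vdist (V\<lparr>vcarrier := W\<rparr>) x y = 0) = (x = y)"
          using d c by simp
        assume "z \<in> vcarrier (V\<lparr>vcarrier := W\<rparr>)"
        then show "vdist (V\<lparr>vcarrier := W\<rparr>) x z \<le> vdist (V\<lparr>vcarrier := W\<rparr>) x y + vdist (V\<lparr>vcarrier := W\<rparr>) y z"
          using xy d c V.metric.triangle by simp
      qed
      fix \<sigma> :: "nat \<Rightarrow> _"
      assume \<sigma>: "\<And>n. \<sigma> n \<in> vcarrier (V\<lparr>vcarrier := W\<rparr>)"
        "\<And>\<epsilon>. \<epsilon> > 0 \<Longrightarrow> \<exists>N. \<forall>m\<ge>N. \<forall>n\<ge>N. vdist (V\<lparr>vcarrier := W\<rparr>) (\<sigma> m) (\<sigma> n) < \<epsilon>"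
      then have \<sigma>': "\<And>n. \<sigma> n \<in> W" by simp
      obtain x where x: "x \<in> vcarrier V" "\<And>\<epsilon>. \<epsilon> > 0 \<Longrightarrow> \<exists>N. \<forall>n\<ge>N. vdist V (\<sigma> n) x < \<epsilon>"
      proof (rule V.Cauchy_limit[of \<sigma>])
        show "\<exists>N. \<forall>m\<ge>N. \<forall>n\<ge>N. vdist V (\<sigma> m) (\<sigma> n) < \<epsilon>" if "\<epsilon> > 0" for \<epsilon>
          using \<sigma>(2)[OF that] d[OF \<sigma>' \<sigma>'] by simp
      qed (use \<sigma>' c in auto)
      have "x \<in> vclosure V W"
        unfolding V.in_vclosure_iff
      proof (intro conjI allI impI x)
        fix \<epsilon> :: real assume "\<epsilon> > 0"
        from x(2)[OF this] obtain N where "vdist V (\<sigma> N) x < \<epsilon>" by blast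
        then show "\<exists>y\<in>W. y \<in> vcarrier V \<and> vdist V x y < \<epsilon>"
          using \<sigma>' c V.metric.commute[of x] by auto
      qed
      then have "x \<in> W" using W' by simp
      then show "\<exists>x\<in>vcarrier (V\<lparr>vcarrier := W\<rparr>). \<forall>\<epsilon>>0. \<exists>N. \<forall>n\<ge>N. vdist (V\<lparr>vcarrier := W\<rparr>) (\<sigma> n) x < \<epsilon>"
        using x(2) d \<sigma>' by auto
    qed
  next
    case (5 x y)
    then show ?case using V.add_commute[of x y] c by simp
  qed (simp_all add: W' c V.add_assoc V.add_zero V.add_uminus V.scale_scale V.scale_one
      V.scale_add_left V.scale_add_right V.norm_nonneg V.norm_eq_zero V.norm_scale V.norm_triangle)
qed

lemma vclosure_carrier_update:
  assumes V: "complex_banach_space V" and W: "closed_subspace V W" and X: "X \<subseteq> W"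
  shows "vclosure (V\<lparr>vcarrier := W\<rparr>) X = vclosure V X"
proof -
  interpret V: complex_banach_space V by (fact V)
  interpret W: complex_banach_space "V\<lparr>vcarrier := W\<rparr>" using closed_subspace_banach[OF V W] .
  have W': "W \<subseteq> vcarrier V" "vclosure V W = W"
    using W unfolding closed_subspace_def lin_subspace_def by auto
  have 1: "vclosure V X \<subseteq> W"
    using V.vclosure_mono[OF X] W' by simp
  have c: "y \<in> X \<Longrightarrow> y \<in> W" "y \<in> X \<Longrightarrow> y \<in> vcarrier V" for y using X W' by auto
  have "x \<in> vclosure (V\<lparr>vcarrier := W\<rparr>) X \<longleftrightarrow> x \<in> vclosure V X" if x: "x \<in> W" for x
  proof -
    have "vdist (V\<lparr>vcarrier := W\<rparr>) x y = vdist V x y" if "y \<in> X" for y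
      using vdist_carrier_update[OF x c(1)[OF that] W'(1)] .
    then show ?thesis
      unfolding W.in_vclosure_iff V.in_vclosure_iff using x c W'(1) by auto
  qed
  moreover have "vclosure (V\<lparr>vcarrier := W\<rparr>) X \<subseteq> W"
    using W.vclosure_subset_carrier by simp
  ultimately show ?thesis using 1 by blast
qed

lemma closed_subspace_carrier_update:
  assumes V: "complex_banach_space V" and W: "closed_subspace V W" and U: "U \<subseteq> W"
  shows "closed_subspace (V\<lparr>vcarrier := W\<rparr>) U \<longleftrightarrow> closed_subspace V U"
  using vclosure_carrier_update[OF assms] U W
  unfolding closed_subspace_def lin_subspace_def by auto

lemma closed_span_carrier_update:
  assumes V: "complex_banach_space V" and W: "closed_subspace V W" and X: "X \<subseteq> W"
  shows "closed_span (V\<lparr>vcarrier := W\<rparr>) X = closed_span V X"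
proof -
  interpret V: complex_banach_space V by (fact V)
  interpret W: complex_banach_space "V\<lparr>vcarrier := W\<rparr>" using closed_subspace_banach[OF V W] .
  have Wc: "W \<subseteq> vcarrier V" using W unfolding closed_subspace_def lin_subspace_def by auto
  have 1: "closed_subspace (V\<lparr>vcarrier := W\<rparr>) (closed_span (V\<lparr>vcarrier := W\<rparr>) X)"
    using W.closed_subspace_closed_span X by simp
  have 2: "closed_subspace V (closed_span V X)"
    using V.closed_subspace_closed_span X Wc by blast
  have 3: "closed_span V X \<subseteq> W" using V.closed_span_least[OF W X] .
  have 4: "closed_span (V\<lparr>vcarrier := W\<rparr>) X \<subseteq> W"
    using W.closed_span_subset_carrier by simp
  show ?thesis
  proof
    show "closed_span (V\<lparr>vcarrier := W\<rparr>) X \<subseteq> closed_span V X"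
      using W.closed_span_least 2 closed_subspace_carrier_update[OF V W 3] V.subset_closed_span X Wc
      by blast
    show "closed_span V X \<subseteq> closed_span (V\<lparr>vcarrier := W\<rparr>) X"
      using V.closed_span_least 1 closed_subspace_carrier_update[OF V W 4] W.subset_closed_span X
      by simp
  qed
qed

text \<open>The image of a complete space under an isometry is complete, hence closed.\<close>

lemma isometric_image_closed_subspace:
  assumes V: "complex_banach_space V" and W: "complex_banach_space W"
    and U: "closed_subspace V U" and f: "lin_map V W f"
    and iso: "\<And>x. x \<in> U \<Longrightarrow> vnorm W (f x) = vnorm V x"
  shows "closed_subspace W (f ` U)"
proof -
  interpret V: complex_banach_space V by (fact V)
  interpret W: complex_banach_space W by (fact W)
  have U': "U \<subseteq> vcarrier V" "vzero V \<in> U" "\<And>x y. x \<in> U \<Longrightarrow> y \<in> U \<Longrightarrow> vadd V x y \<in> U"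
    "\<And>c x. x \<in> U \<Longrightarrow> vscale V c x \<in> U" "vclosure V U = U"
    using U unfolding closed_subspace_def lin_subspace_def by auto
  have f': "\<And>x. x \<in> U \<Longrightarrow> f x \<in> vcarrier W"
    "\<And>x y. x \<in> U \<Longrightarrow> y \<in> U \<Longrightarrow> f (vadd V x y) = vadd W (f x) (f y)"
    "\<And>c x. x \<in> U \<Longrightarrow> f (vscale V c x) = vscale W c (f x)"
    using f U'(1) unfolding lin_map_def by (auto simp: subset_iff)
  have dist: "vdist W (f x) (f y) = vdist V x y" if "x \<in> U" "y \<in> U" for x y
    using that U' iso semilinear_dist[OF V W _ , of f x y] f by (simp add: V.dist_eq subset_iff)
  show ?thesis
  proof (rule W.closed_subspaceI)
    show "lin_subspace W (f ` U)"
      unfolding lin_subspace_def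
    proof (intro conjI ballI allI)
      show "vzero W \<in> f ` U"
        using semilinear_zero[OF V W, of f] f U' by (metis imageI)
      show "f ` U \<subseteq> vcarrier W" using f' by auto
      fix y c assume "y \<in> f ` U"
      then show "vscale W c y \<in> f ` U"
        using f'(3) U'(4) by (metis (no_types, lifting) imageE imageI)
      fix y' assume "y' \<in> f ` U"
      then show "vadd W y y' \<in> f ` U"
        using \<open>y \<in> f ` U\<close> f'(2) U'(3) by (metis (no_types, lifting) imageE imageI)
    qed
    show "vclosure W (f ` U) \<subseteq> f ` U"
    proof
      fix y assume "y \<in> vclosure W (f ` U)"
      then have y: "y \<in> vcarrier W" and ap: "\<And>\<epsilon>. \<epsilon> > 0 \<Longrightarrow> \<exists>x\<in>U. vdist W y (f x) < \<epsilon>"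
        unfolding W.in_vclosure_iff by blast+
      have "\<exists>x\<in>U. vdist W y (f x) < inverse (real (Suc n))" for n
        using ap by simp
      then obtain \<sigma> where \<sigma>: "\<And>n. \<sigma> n \<in> U" "\<And>n. vdist W y (f (\<sigma> n)) < inverse (real (Suc n))"
        by metis
      have small: "\<exists>N. \<forall>n\<ge>N. vdist W y (f (\<sigma> n)) < \<epsilon>" if "\<epsilon> > 0" for \<epsilon>
      proof -
        obtain N where N: "inverse (real (Suc N)) < \<epsilon>"
          using reals_Archimedean[OF \<open>\<epsilon> > 0\<close>] by blast
        have "vdist W y (f (\<sigma> n)) < \<epsilon>" if "n \<ge> N" for n
        proof -
          have "inverse (real (Suc n)) \<le> inverse (real (Suc N))"
            using that by (simp add: le_imp_inverse_le)
          then show ?thesis using \<sigma>(2)[of n] N by linarith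
        qed
        then show ?thesis by blast
      qed
      have "\<exists>N. \<forall>m\<ge>N. \<forall>n\<ge>N. vdist V (\<sigma> m) (\<sigma> n) < \<epsilon>" if "\<epsilon> > 0" for \<epsilon>
      proof -
        obtain N where N: "\<And>n. n \<ge> N \<Longrightarrow> vdist W y (f (\<sigma> n)) < \<epsilon> / 2"
          using small[of "\<epsilon> / 2"] \<open>\<epsilon> > 0\<close> by auto
        have "vdist V (\<sigma> m) (\<sigma> n) < \<epsilon>" if "m \<ge> N" "n \<ge> N" for m n
        proof -
          have "vdist W (f (\<sigma> m)) (f (\<sigma> n)) \<le> vdist W y (f (\<sigma> m)) + vdist W y (f (\<sigma> n))"
            using W.metric.triangle'' y f'(1) \<sigma>(1) by simp
          then show ?thesis
            using N[OF that(1)] N[OF that(2)] dist \<sigma>(1) by simp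
        qed
        then show ?thesis by blast
      qed
      moreover have "\<And>n. \<sigma> n \<in> vcarrier V" using \<sigma> U' by blast
      ultimately obtain x where x: "x \<in> vcarrier V" "\<And>\<epsilon>. \<epsilon> > 0 \<Longrightarrow> \<exists>N. \<forall>n\<ge>N. vdist V (\<sigma> n) x < \<epsilon>"
        using V.Cauchy_limit[of \<sigma>] by blast
      have "x \<in> vclosure V U"
        unfolding V.in_vclosure_iff
      proof (intro conjI allI impI x)
        fix \<epsilon> :: real assume "\<epsilon> > 0"
        from x(2)[OF this] obtain N where "vdist V (\<sigma> N) x < \<epsilon>" by blast
        then show "\<exists>y\<in>U. y \<in> vcarrier V \<and> vdist V x y < \<epsilon>"
          using \<sigma>(1) U'(1) V.metric.commute[of x] by auto
      qed
      then have xU: "x \<in> U" using U' by simp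
      have "vdist W y (f x) < \<epsilon>" if "\<epsilon> > 0" for \<epsilon>
      proof -
        obtain N M where "\<And>n. n \<ge> N \<Longrightarrow> vdist W y (f (\<sigma> n)) < \<epsilon> / 2"
          "\<And>n. n \<ge> M \<Longrightarrow> vdist V (\<sigma> n) x < \<epsilon> / 2"
          using small[of "\<epsilon> / 2"] x(2)[of "\<epsilon> / 2"] \<open>\<epsilon> > 0\<close> by auto
        then have "vdist W y (f (\<sigma> (max N M))) < \<epsilon> / 2" "vdist W (f (\<sigma> (max N M))) (f x) < \<epsilon> / 2"
          using dist[OF \<sigma>(1) xU] by simp_all
        then show ?thesis
          using W.metric.triangle[of y "f (\<sigma> (max N M))" "f x"] y f'(1)[OF \<sigma>(1)] f'(1)[OF xU]
          by fastforce
      qed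
      then have "y = f x"
        using y f'(1)[OF xU] W.metric.mdist_pos_eq by (metis order_less_irrefl)
      then show "y \<in> f ` U" using xU by simp
    qed
  qed
qed

text \<open>The product of two Banach spaces is where the closure of a linear relation lives.\<close>

definition prod_space :: "'a cspace \<Rightarrow> 'b cspace \<Rightarrow> ('a \<times> 'b) cspace" where
  "prod_space V W = \<lparr>vcarrier = vcarrier V \<times> vcarrier W, vzero = (vzero V, vzero W),
     vadd = (\<lambda>p q. (vadd V (fst p) (fst q), vadd W (snd p) (snd q))),
     vscale = (\<lambda>c p. (vscale V c (fst p), vscale W c (snd p))),
     vnorm = (\<lambda>p. max (vnorm V (fst p)) (vnorm W (snd p)))\<rparr>"

lemma prod_space_banach:
  assumes V: "complex_banach_space V" and W: "complex_banach_space W"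
  shows "complex_banach_space (prod_space V W)"
proof -
  interpret V: complex_banach_space V by (fact V)
  interpret W: complex_banach_space W by (fact W)
  have d: "vdist (prod_space V W) p q = max (vdist V (fst p) (fst q)) (vdist W (snd p) (snd q))"
    if "p \<in> vcarrier V \<times> vcarrier W" "q \<in> vcarrier V \<times> vcarrier W" for p q
    using that by (auto simp: prod_space_def vdist_def)
  have d': "vdist (prod_space V W) p q = 0"
    if "p \<notin> vcarrier V \<times> vcarrier W \<or> q \<notin> vcarrier V \<times> vcarrier W" for p q
    using that by (auto simp: prod_space_def vdist_def)
  have c: "vcarrier (prod_space V W) = vcarrier V \<times> vcarrier W"
    by (simp add: prod_space_def)
  show ?thesis
  proof (unfold_locales, goal_cases)
    case 16
    show ?case
    proof (rule mcompleteI)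
      show "Metric_space (vcarrier (prod_space V W)) (vdist (prod_space V W))"
      proof
        fix p q r
        show "0 \<le> vdist (prod_space V W) p q"
          using d[of p q] d'[of p q] V.metric.nonneg by (cases "p \<in> vcarrier V \<times> vcarrier W \<and> q \<in> vcarrier V \<times> vcarrier W") (auto simp: le_max_iff_disj)
        show "vdist (prod_space V W) p q = vdist (prod_space V W) q p"
          using d[of p q] d[of q p] d'[of p q] d'[of q p] V.metric.commute W.metric.commute
          by (cases "p \<in> vcarrier V \<times> vcarrier W \<and> q \<in> vcarrier V \<times> vcarrier W") auto
        assume pq: "p \<in> vcarrier (prod_space V W)" "q \<in> vcarrier (prod_space V W)"
        have "max a b = 0 \<longleftrightarrow> a = 0 \<and> b = 0" if "a \<ge> 0" "b \<ge> 0" for a b :: real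
          using that by auto
        then show "(vdist (prod_space V W) p q = 0) = (p = q)"
          using pq unfolding c by (auto simp: d)
        assume r: "r \<in> vcarrier (prod_space V W)"
        show "vdist (prod_space V W) p r \<le> vdist (prod_space V W) p q + vdist (prod_space V W) q r"
          using pq r V.metric.triangle[of "fst p" "fst q" "fst r"] W.metric.triangle[of "snd p" "snd q" "snd r"]
          unfolding c by (auto simp: d)
      qed
      fix \<sigma> :: "nat \<Rightarrow> _"
      assume \<sigma>: "\<And>n. \<sigma> n \<in> vcarrier (prod_space V W)"
        and cauchy: "\<And>\<epsilon>. \<epsilon> > 0 \<Longrightarrow> \<exists>N. \<forall>m\<ge>N. \<forall>n\<ge>N. vdist (prod_space V W) (\<sigma> m) (\<sigma> n) < \<epsilon>"
      have \<sigma>': "\<sigma> n \<in> vcarrier V \<times> vcarrier W" "fst (\<sigma> n) \<in> vcarrier V" "snd (\<sigma> n) \<in> vcarrier W" for n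
        using \<sigma>[of n] unfolding c by auto
      have cauchy': "\<exists>N. \<forall>m\<ge>N. \<forall>n\<ge>N. vdist V (fst (\<sigma> m)) (fst (\<sigma> n)) < \<epsilon>"
        "\<exists>N. \<forall>m\<ge>N. \<forall>n\<ge>N. vdist W (snd (\<sigma> m)) (snd (\<sigma> n)) < \<epsilon>" if "\<epsilon> > 0" for \<epsilon>
        using cauchy[OF that] by (simp_all add: d \<sigma>'(1)) blast+
      obtain x where x: "x \<in> vcarrier V" "\<And>\<epsilon>. \<epsilon> > 0 \<Longrightarrow> \<exists>N. \<forall>n\<ge>N. vdist V (fst (\<sigma> n)) x < \<epsilon>"
        using V.Cauchy_limit[of "\<lambda>n. fst (\<sigma> n)"] \<sigma>' cauchy'(1) by blast
      obtain y where y: "y \<in> vcarrier W" "\<And>\<epsilon>. \<epsilon> > 0 \<Longrightarrow> \<exists>N. \<forall>n\<ge>N. vdist W (snd (\<sigma> n)) y < \<epsilon>"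
        using W.Cauchy_limit[of "\<lambda>n. snd (\<sigma> n)"] \<sigma>' cauchy'(2) by blast
      have "\<exists>N. \<forall>n\<ge>N. vdist (prod_space V W) (\<sigma> n) (x, y) < \<epsilon>" if "\<epsilon> > 0" for \<epsilon>
      proof -
        obtain N M where "\<forall>n\<ge>N. vdist V (fst (\<sigma> n)) x < \<epsilon>" "\<forall>n\<ge>M. vdist W (snd (\<sigma> n)) y < \<epsilon>"
          using x(2)[OF \<open>\<epsilon> > 0\<close>] y(2)[OF \<open>\<epsilon> > 0\<close>] by blast
        then have "\<forall>n\<ge>max N M. vdist (prod_space V W) (\<sigma> n) (x, y) < \<epsilon>"
          using x(1) y(1) \<sigma>'(1) by (simp add: d)
        then show ?thesis by blast
      qed
      then show "\<exists>x\<in>vcarrier (prod_space V W). \<forall>\<epsilon>>0. \<exists>N. \<forall>n\<ge>N. vdist (prod_space V W) (\<sigma> n) x < \<epsilon>"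
        unfolding c using x y by blast
    qed
  next
    case (12 p)
    then show ?case using V.norm_nonneg W.norm_nonneg by (auto simp: prod_space_def le_max_iff_disj)
  next
    case (13 p)
    have "max a b = 0 \<longleftrightarrow> a = 0 \<and> b = 0" if "a \<ge> 0" "b \<ge> 0" for a b :: real
      using that by auto
    then show ?case using 13 V.norm_eq_zero W.norm_eq_zero V.norm_nonneg W.norm_nonneg
      by (auto simp: prod_space_def)
  next
    case (14 p k)
    then show ?case using V.norm_scale W.norm_scale
      by (auto simp: prod_space_def max_mult_distrib_left)
  next
    case (15 p q)
    then show ?case using V.norm_triangle[of "fst p" "fst q"] W.norm_triangle[of "snd p" "snd q"]
      by (auto simp: prod_space_def)
  next
    case (5 p q)
    then show ?case
      using V.add_commute[of "fst p" "fst q"] W.add_commute[of "snd p" "snd q"]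
      by (auto simp: prod_space_def)
  qed (auto simp: prod_space_def V.zero_closed W.zero_closed V.add_closed W.add_closed V.scale_closed W.scale_closed
      V.add_assoc W.add_assoc V.add_zero W.add_zero V.add_uminus W.add_uminus
      V.scale_scale W.scale_scale V.scale_one W.scale_one V.scale_add_left W.scale_add_left
      V.scale_add_right W.scale_add_right)
qed

section \<open>Fibers of a Fell bundle\<close>

context fell_bundle
begin

sublocale sg: inverse_semigroup "base A"
  by (rule base)

lemmas S_mult = sg.mult_closed[folded S_def mul_def]
  and S_inv = sg.inv_closed[folded S_def inv_def]
  and S_assoc = sg.mult_assoc[folded S_def mul_def]
  and S_inv_inv = sg.inv_inv[folded S_def inv_def]
  and S_inv_mult = sg.inv_mult[folded S_def inv_def mul_def]

lemma S_mult_inv_mult: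
  assumes "s \<in> S"
  shows "s \<odot> (inv s \<odot> s) = s" "inv s \<odot> (s \<odot> inv s) = inv s"
  using sg.inv_laws[folded S_def mul_def inv_def, OF assms] S_assoc S_inv assms by simp_all

lemma S_mult_inv_mult_left:
  assumes "s \<in> S" "t \<in> S"
  shows "s \<odot> (inv s \<odot> (s \<odot> t)) = s \<odot> t" "inv s \<odot> (s \<odot> (inv s \<odot> t)) = inv s \<odot> t"
  using sg.inv_laws[folded S_def mul_def inv_def, OF assms(1)] S_assoc S_inv S_mult assms by metis+

lemmas S_simps = S_mult S_inv S_assoc S_inv_inv S_inv_mult S_mult_inv_mult S_mult_inv_mult_left

abbreviation E where "E \<equiv> idempotents (base A)"

lemma E_simps:
  assumes "e \<in> E"
  shows "e \<in> S" "e \<odot> e = e" "inv e = e"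
  using assms sg.idempotent_inv[OF assms] unfolding idempotents_def S_def mul_def inv_def by auto

lemmas E_commute = sg.idempotents_commute[folded mul_def]
  and E_mult = sg.idempotents_closed[folded mul_def]
  and E_source = sg.inv_mult_idempotent[folded S_def mul_def inv_def]
  and E_range = sg.mult_inv_idempotent[folded S_def mul_def inv_def]
  and le_refl = sg.nat_le_refl[folded S_def le_def]
  and le_mult_idempotent = sg.nat_le_mult_idempotent[folded S_def mul_def le_def]
  and le_idempotent_mult = sg.nat_le_idempotent_mult[folded S_def mul_def le_def]
  and le_source = sg.nat_le_source[folded mul_def le_def inv_def]

lemma mult_in_fib:
  "s \<in> S \<Longrightarrow> t \<in> S \<Longrightarrow> a \<in> fcarrier A s \<Longrightarrow> b \<in> fcarrier A t \<Longrightarrow>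
    fmult A s t a b \<in> fcarrier A (s \<odot> t)"
  using mult_linear_right unfolding lin_map_def by blast

lemma mult_add_right:
  "s \<in> S \<Longrightarrow> t \<in> S \<Longrightarrow> a \<in> fcarrier A s \<Longrightarrow> b \<in> fcarrier A t \<Longrightarrow> c \<in> fcarrier A t \<Longrightarrow>
    fmult A s t a (vadd (fib A t) b c) = vadd (fib A (s \<odot> t)) (fmult A s t a b) (fmult A s t a c)"
  using mult_linear_right unfolding lin_map_def by blast

lemma mult_add_left:
  "s \<in> S \<Longrightarrow> t \<in> S \<Longrightarrow> a \<in> fcarrier A s \<Longrightarrow> b \<in> fcarrier A s \<Longrightarrow> c \<in> fcarrier A t \<Longrightarrow>
    fmult A s t (vadd (fib A s) a b) c = vadd (fib A (s \<odot> t)) (fmult A s t a c) (fmult A s t b c)"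
  using mult_linear_left unfolding lin_map_def by blast

lemma mult_scale_right:
  "s \<in> S \<Longrightarrow> t \<in> S \<Longrightarrow> a \<in> fcarrier A s \<Longrightarrow> b \<in> fcarrier A t \<Longrightarrow>
    fmult A s t a (vscale (fib A t) k b) = vscale (fib A (s \<odot> t)) k (fmult A s t a b)"
  using mult_linear_right unfolding lin_map_def by blast

lemma mult_scale_left:
  "s \<in> S \<Longrightarrow> t \<in> S \<Longrightarrow> a \<in> fcarrier A s \<Longrightarrow> b \<in> fcarrier A t \<Longrightarrow>
    fmult A s t (vscale (fib A s) k a) b = vscale (fib A (s \<odot> t)) k (fmult A s t a b)"
  using mult_linear_left unfolding lin_map_def by blast

lemma star_in_fib: "s \<in> S \<Longrightarrow> a \<in> fcarrier A s \<Longrightarrow> fstar A s a \<in> fcarrier A (inv s)"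
  using star_conj_linear unfolding conj_lin_map_def by blast

lemma star_add: "s \<in> S \<Longrightarrow> a \<in> fcarrier A s \<Longrightarrow> b \<in> fcarrier A s \<Longrightarrow>
    fstar A s (vadd (fib A s) a b) = vadd (fib A (inv s)) (fstar A s a) (fstar A s b)"
  using star_conj_linear unfolding conj_lin_map_def by blast

lemma star_scale: "s \<in> S \<Longrightarrow> a \<in> fcarrier A s \<Longrightarrow>
    fstar A s (vscale (fib A s) k a) = vscale (fib A (inv s)) (cnj k) (fstar A s a)"
  using star_conj_linear unfolding conj_lin_map_def by blast

lemma incl_in_fib: "s \<preceq> t \<Longrightarrow> a \<in> fcarrier A s \<Longrightarrow> fincl A t s a \<in> fcarrier A t"
  using incl_linear unfolding lin_map_def by blast

lemma bounded_mult_right: "s \<in> S \<Longrightarrow> t \<in> S \<Longrightarrow> a \<in> fcarrier A s \<Longrightarrow>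
    bounded_semilinear (fib A t) (fib A (s \<odot> t)) (\<lambda>b. fmult A s t a b)"
  unfolding bounded_semilinear_def using mult_linear_right norm_mult by blast

lemma bounded_mult_left: "s \<in> S \<Longrightarrow> t \<in> S \<Longrightarrow> b \<in> fcarrier A t \<Longrightarrow>
    bounded_semilinear (fib A s) (fib A (s \<odot> t)) (\<lambda>a. fmult A s t a b)"
  unfolding bounded_semilinear_def using mult_linear_left norm_mult mult.commute by metis

lemma bounded_star: "s \<in> S \<Longrightarrow> bounded_semilinear (fib A s) (fib A (inv s)) (fstar A s)"
  unfolding bounded_semilinear_def using star_conj_linear norm_star
  by (metis mult_1 order_refl)

lemma bounded_incl: "s \<preceq> t \<Longrightarrow> bounded_semilinear (fib A s) (fib A t) (fincl A t s)"
  unfolding bounded_semilinear_def using incl_linear incl_isometric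
  by (metis mult_1 order_refl)

text \<open>An isometric idempotent map is the identity.\<close>

lemma incl_refl:
  assumes s: "s \<in> S" and a: "a \<in> fcarrier A s"
  shows "fincl A s s a = a"
proof -
  interpret V: complex_banach_space "fib A s" using banach[OF s] .
  let ?j = "fincl A s s"
  have j: "?j a \<in> fcarrier A s" "?j (?j a) = ?j a"
    using incl_in_fib[OF le_refl[OF s] a] incl_incl[OF le_refl[OF s] le_refl[OF s] a] by auto
  have lin: "lin_map (fib A s) (fib A s) ?j" using incl_linear[OF le_refl[OF s]] .
  let ?d = "vadd (fib A s) (?j a) (vscale (fib A s) (-1) a)"
  have d: "?d \<in> fcarrier A s" using j a V.add_closed V.scale_closed by auto
  have "?j ?d = vzero (fib A s)"
    using lin j a V.scale_closed V.add_uminus unfolding lin_map_def by simp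
  then have "?d = vzero (fib A s)"
    using incl_isometric[OF le_refl[OF s] d] V.norm_zero V.norm_eq_zero[OF d] by simp
  then show ?thesis
    using V.diff_add_cancel[OF j(1) a] V.zero_add[OF a] by simp
qed

section \<open>A Cayley transform estimate\<close>

text \<open>Let \<open>b = a\<^sup>* a\<close> and \<open>z = i \<epsilon>\<close>. The relation \<open>z w = b + b w\<close> says that \<open>1 + w\<close> is
  \<open>z (z - b)\<^sup>-\<^sup>1\<close>, so that \<open>1 + 2 w = (z + b) (z - b)\<^sup>-\<^sup>1\<close> is the Cayley transform of \<open>b\<close>, a unitary;
  the unitarity reads \<open>2 w\<^sup>* w = - (w + w\<^sup>*)\<close> and gives \<open>\<parallel>w\<parallel> \<le> 1\<close>. Since
  \<open>(a + a w)\<^sup>* (a + a w) = z (w + w\<^sup>* w)\<close>, the vector \<open>a + a w\<close> is small. The relation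
  between \<open>b\<close> and \<open>w\<close> is algebraic, so homomorphisms preserve it.\<close>

lemma Cayley_estimate:
  fixes \<epsilon> :: real
  defines "z \<equiv> \<i> * complex_of_real \<epsilon>"
  assumes s: "s \<in> S" and a: "a \<in> fcarrier A s" and \<epsilon>: "\<epsilon> > 0"
    and w: "w \<in> fcarrier A (inv s \<odot> s)"
    and b: "b = fmult A (inv s) s (fstar A s a) a"
    and eq: "vscale (fib A (inv s \<odot> s)) z w =
      vadd (fib A (inv s \<odot> s)) b (fmult A (inv s \<odot> s) (inv s \<odot> s) b w)"
  shows "(vnorm (fib A s) (vadd (fib A s) a (fmult A s (inv s \<odot> s) a w)))\<^sup>2 \<le> 2 * \<epsilon>"
proof -
  define f where "f = inv s \<odot> s"
  let ?F = "fib A f" and ?m = "fmult A f f" and ?s' = "inv s" and ?a' = "fstar A s a"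
  have cz: "cmod z = \<epsilon>" "cmod (2 * z) = 2 * \<epsilon>"
    using \<epsilon> by (simp_all add: z_def Real_Vector_Spaces.norm_mult)
  have s': "?s' \<in> S" and f: "f \<in> S" "f \<odot> f = f" "inv f = f" "s \<odot> f = s" "f \<odot> ?s' = ?s'" "?s' \<odot> s = f"
    using s by (simp_all add: f_def S_simps)
  interpret V: complex_banach_space ?F using banach f by simp
  interpret X: complex_banach_space "fib A s" using banach s by simp
  have w: "w \<in> fcarrier A f" and eq: "vscale ?F z w = vadd ?F b (?m b w)"
    using assms unfolding f_def by simp_all
  have a': "?a' \<in> fcarrier A ?s'" using star_in_fib s a by simp
  have bF: "b \<in> fcarrier A f"
    using mult_in_fib[OF s' s a' a] f b by simp
  have b_star: "fstar A f b = b"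
    using star_mult[OF s' s a' a] star_star[OF s a] f b by (simp add: S_inv_inv s)
  define w' where "w' = fstar A f w"
  have w': "w' \<in> fcarrier A f" using star_in_fib[OF f(1) w] f unfolding w'_def by simp
  have m: "?m x y \<in> fcarrier A f" if "x \<in> fcarrier A f" "y \<in> fcarrier A f" for x y
    using mult_in_fib[OF f(1) f(1) that] f by simp
  have m_assoc: "?m (?m x y) u = ?m x (?m y u)"
    if "x \<in> fcarrier A f" "y \<in> fcarrier A f" "u \<in> fcarrier A f" for x y u
    using mult_assoc[OF f(1) f(1) f(1) that] f by simp
  note c = w w' bF m V.add_closed V.scale_closed
  define P where "P = ?m w' w"
  have P: "P \<in> fcarrier A f" unfolding P_def using c by simp
  have eq': "vscale ?F (-z) w' = vadd ?F b (?m w' b)"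
  proof -
    have "fstar A f (vscale ?F z w) = vadd ?F (fstar A f b) (fstar A f (?m b w))"
      unfolding eq using star_add[OF f(1) bF m[OF bF w]] f by simp
    also have "fstar A f (?m b w) = ?m w' b"
      using star_mult[OF f(1) f(1) bF w] f b_star unfolding w'_def by simp
    also have "fstar A f (vscale ?F z w) = vscale ?F (-z) w'"
      using star_scale[OF f(1) w, of z] f unfolding w'_def z_def by simp
    finally show ?thesis by (simp add: b_star)
  qed
  \<comment> \<open>the relation multiplied by \<open>w\<^sup>*\<close> from the left, and its adjoint multiplied by \<open>w\<close> from the right\<close>
  have zP: "vscale ?F z P = vadd ?F (?m w' b) (?m w' (?m b w))"
    using mult_scale_right[OF f(1) f(1) w' w, of z] mult_add_right[OF f(1) f(1) w' bF m[OF bF w]] f eq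
    unfolding P_def by simp
  have zP': "vscale ?F (-z) P = vadd ?F (?m b w) (?m w' (?m b w))"
    using mult_scale_left[OF f(1) f(1) w' w, of "-z"] mult_add_left[OF f(1) f(1) bF m[OF w' bF] w] f eq'
      m_assoc[OF w' bF w]
    unfolding P_def by simp
  define d where "d = vadd (fib A s) a (fmult A s f a w)"
  have aw: "fmult A s f a w \<in> fcarrier A s" using mult_in_fib[OF s f(1) a w] f by simp
  have d: "d \<in> fcarrier A s" unfolding d_def using a aw X.add_closed by simp
  have d_star: "fstar A s d = vadd (fib A ?s') ?a' (fmult A f ?s' w' ?a')"
    using star_add[OF s a aw] star_mult[OF s f(1) a w] f unfolding d_def w'_def by simp
  have wa': "fmult A f ?s' w' ?a' \<in> fcarrier A ?s'"
    using mult_in_fib[OF f(1) s' w' a'] f by simp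
  have d1: "fmult A ?s' s ?a' d = vadd ?F b (?m b w)"
    using mult_add_right[OF s' s a' a aw] mult_assoc[OF s' s f(1) a' a w] f
    unfolding d_def b by simp
  have "fmult A ?s' s (fmult A f ?s' w' ?a') d = ?m w' (vadd ?F b (?m b w))"
    using mult_assoc[OF f(1) s' s w' a' d] f d1 by simp
  also have "\<dots> = vscale ?F z P"
    using zP mult_add_right[OF f(1) f(1) w' bF m[OF bF w]] f by simp
  finally have "fmult A ?s' s (fstar A s d) d = vadd ?F (vscale ?F z w) (vscale ?F z P)"
    using mult_add_left[OF s' s a' wa' d] d1 d_star f eq by simp
  then have "(vnorm (fib A s) d)\<^sup>2 = vnorm ?F (vadd ?F (vscale ?F z w) (vscale ?F z P))"
    using cstar_identity[OF s d] f by simp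
  also have "\<dots> \<le> \<epsilon> * vnorm ?F w + \<epsilon> * vnorm ?F P"
    using V.norm_triangle[of "vscale ?F z w" "vscale ?F z P"] V.norm_scale w P V.scale_closed
    by (simp add: cz)
  finally have nd: "(vnorm (fib A s) d)\<^sup>2 \<le> \<epsilon> * vnorm ?F w + \<epsilon> * vnorm ?F P" .
  have nP: "vnorm ?F P = (vnorm ?F w)\<^sup>2"
    using cstar_identity[OF f(1) w] f unfolding P_def w'_def by simp
  \<comment> \<open>eliminating \<open>b\<close> and its products from the four relations leads to \<open>2 w\<^sup>* w = - (w + w\<^sup>*)\<close>\<close>
  have sum: "vadd ?F (vscale ?F z P) (vscale ?F z w) = vadd ?F (vscale ?F (-z) w') (vscale ?F (-z) P)"
    unfolding zP zP' eq eq' using c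
    by (simp add: V.add_assoc V.add_left_commute V.add_commute)
  have "vscale ?F (2 * z) P = vadd ?F (vscale ?F z P) (vscale ?F z P)"
    using V.scale_add_left[OF P, of z z] by (simp only: mult_2)
  also have "\<dots> = vadd ?F (vadd ?F (vadd ?F (vscale ?F z P) (vscale ?F z w)) (vscale ?F (-z) w)) (vscale ?F z P)"
    using V.scale_add_left[OF w, of z "-z"] V.scale_0[OF w] P w c V.add_zero by (simp add: V.add_assoc)
  also have "\<dots> = vadd ?F (vscale ?F (-z) w') (vscale ?F (-z) w)"
  proof -
    have "vadd ?F (vadd ?F (vadd ?F (vscale ?F (-z) w') (vscale ?F (-z) P)) (vscale ?F (-z) w)) (vscale ?F z P)
        = vadd ?F (vadd ?F (vscale ?F (-z) w') (vscale ?F (-z) w)) (vadd ?F (vscale ?F (-z) P) (vscale ?F z P))"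
      using c P by (simp add: V.add_assoc V.add_left_commute V.add_commute)
    then show ?thesis
      unfolding sum using V.scale_add_left[OF P, of "-z" z] V.scale_0[OF P] c V.add_zero by simp
  qed
  finally have "vscale ?F (2 * z) P = vadd ?F (vscale ?F (-z) w') (vscale ?F (-z) w)" .
  then have "2 * \<epsilon> * vnorm ?F P \<le> \<epsilon> * vnorm ?F w' + \<epsilon> * vnorm ?F w"
    using V.norm_triangle[of "vscale ?F (-z) w'" "vscale ?F (-z) w"] V.norm_scale[OF P, of "2 * z"]
      V.norm_scale[OF w', of "-z"] V.norm_scale[OF w, of "-z"] w w' V.scale_closed
    by (simp add: cz)
  moreover have "vnorm ?F w' = vnorm ?F w"
    using norm_star[OF f(1) w] f unfolding w'_def by simp
  ultimately have "\<epsilon> * (vnorm ?F w)\<^sup>2 \<le> \<epsilon> * vnorm ?F w"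
    unfolding nP by simp
  then have le: "(vnorm ?F w)\<^sup>2 \<le> vnorm ?F w" using \<epsilon> by simp
  have "vnorm ?F w \<le> 1"
  proof (rule ccontr)
    assume "\<not> vnorm ?F w \<le> 1"
    then show False using le by (simp add: power2_eq_square)
  qed
  then have "\<epsilon> * vnorm ?F w + \<epsilon> * vnorm ?F P \<le> \<epsilon> * 1 + \<epsilon> * 1"
    using le nP \<epsilon> by (intro add_mono mult_left_mono) auto
  then show ?thesis
    using nd unfolding d_def f_def by simp
qed

lemma fib_alg_simps:
  "vcarrier (fib_alg A e) = fcarrier A e" "vzero (fib_alg A e) = vzero (fib A e)"
  "vadd (fib_alg A e) = vadd (fib A e)" "vscale (fib_alg A e) = vscale (fib A e)"
  "vnorm (fib_alg A e) = vnorm (fib A e)" "atimes (fib_alg A e) = fmult A e e" "astar (fib_alg A e) = fstar A e"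
  by (simp_all add: fib_alg_def cspace.defs)

text \<open>Positivity of \<open>a\<^sup>* a\<close> keeps the imaginary number \<open>z = i \<epsilon>\<close> out of its spectrum. An inverse
  \<open>(1/z, y)\<close> of \<open>z - a\<^sup>* a\<close> in the unitization gives \<open>w = z y\<close>.\<close>

lemma Cayley_exists:
  fixes \<epsilon> :: real
  defines "z \<equiv> \<i> * complex_of_real \<epsilon>"
  assumes s: "s \<in> S" and a: "a \<in> fcarrier A s" and \<epsilon>: "\<epsilon> > 0"
  obtains w where "w \<in> fcarrier A (inv s \<odot> s)"
    "vscale (fib A (inv s \<odot> s)) z w = vadd (fib A (inv s \<odot> s)) (fmult A (inv s) s (fstar A s a) a)
      (fmult A (inv s \<odot> s) (inv s \<odot> s) (fmult A (inv s) s (fstar A s a) a) w)"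
    "w = fmult A (inv s) s (fstar A s a)
      (vscale (fib A s) (inverse z) (vadd (fib A s) a (fmult A s (inv s \<odot> s) a w)))"
proof -
  define f where "f = inv s \<odot> s"
  let ?F = "fib A f" and ?m = "fmult A f f" and ?s' = "inv s" and ?a' = "fstar A s a"
  have s': "?s' \<in> S" and f: "f \<in> S" "f \<odot> f = f" "inv f = f" "s \<odot> f = s" "?s' \<odot> s = f"
    using s by (simp_all add: f_def S_simps)
  interpret V: complex_banach_space ?F using banach f by simp
  interpret X: complex_banach_space "fib A s" using banach s by simp
  have a': "?a' \<in> fcarrier A ?s'" using star_in_fib s a by simp
  define b where "b = fmult A ?s' s ?a' a"
  have bF: "b \<in> fcarrier A f"
    using mult_in_fib[OF s' s a' a] f b_def by simp
  have z0: "z \<noteq> 0" using \<epsilon> unfolding z_def by auto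
  have "z \<notin> \<real>\<^sub>\<ge>\<^sub>0"
    using \<epsilon> unfolding z_def by (auto simp: complex_nonneg_Reals_iff)
  then have "z \<notin> spectrum (fib_alg A f) b"
    using star_mult_positive[OF s a] unfolding positive_elem_def b_def f_def by blast
  then obtain y where y: "snd y \<in> fcarrier A f"
    "unitization_mult (fib_alg A f) (z, vscale ?F (-1) b) y = (1, vzero ?F)"
    unfolding spectrum_def by (auto simp: fib_alg_simps)
  have m: "?m x y \<in> fcarrier A f" if "x \<in> fcarrier A f" "y \<in> fcarrier A f" for x y
    using mult_in_fib[OF f(1) f(1) that] f by simp
  have y1: "z * fst y = 1"
    and y2: "vadd ?F (vadd ?F (vscale ?F z (snd y)) (vscale ?F (fst y) (vscale ?F (-1) b)))
       (?m (vscale ?F (-1) b) (snd y)) = vzero ?F"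
    using y(2) unfolding unitization_mult_def by (auto simp: fib_alg_simps)
  define w where "w = vscale ?F z (snd y)"
  have w: "w \<in> fcarrier A f" unfolding w_def using V.scale_closed y by simp
  have mw: "?m b w = vscale ?F z (?m b (snd y))"
    unfolding w_def using mult_scale_right[OF f(1) f(1) bF y(1)] f by simp
  have "?m (vscale ?F (-1) b) (snd y) = vscale ?F (-1) (?m b (snd y))"
    using mult_scale_left[OF f(1) f(1) bF y(1)] f by simp
  with y2 have "vadd ?F (vadd ?F w (vscale ?F (- fst y) b)) (vscale ?F (-1) (?m b (snd y))) = vzero ?F"
    using bF unfolding w_def by (simp add: V.scale_scale)
  then have "vscale ?F z (vadd ?F (vadd ?F w (vscale ?F (- fst y) b)) (vscale ?F (-1) (?m b (snd y)))) = vzero ?F"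
    by (simp add: V.scale_zero)
  then have "vadd ?F (vadd ?F (vscale ?F z w) (vscale ?F (-1) b)) (vscale ?F (-1) (?m b w)) = vzero ?F"
    using w bF y(1) m[OF bF y(1)] y1 mw
    by (simp add: V.scale_add_right V.scale_scale V.add_closed V.scale_closed)
  then have "vadd ?F (vadd ?F (vadd ?F (vscale ?F z w) (vscale ?F (-1) b)) (vscale ?F (-1) (?m b w))) (?m b w) = ?m b w"
    using V.zero_add m[OF bF w] by simp
  then have "vadd ?F (vscale ?F z w) (vscale ?F (-1) b) = ?m b w"
    using V.diff_add_cancel m[OF bF w] w bF by (simp add: V.add_closed V.scale_closed)
  then have "vadd ?F (vadd ?F (vscale ?F z w) (vscale ?F (-1) b)) b = vadd ?F (?m b w) b" by simp
  then have eq: "vscale ?F z w = vadd ?F b (?m b w)"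
    using V.diff_add_cancel w bF m[OF bF w] V.add_commute by (simp add: V.scale_closed)
  let ?d = "vadd (fib A s) a (fmult A s f a w)"
  have aw: "fmult A s f a w \<in> fcarrier A s" using mult_in_fib[OF s f(1) a w] f by simp
  have d: "?d \<in> fcarrier A s" using a aw X.add_closed by simp
  have "fmult A ?s' s ?a' ?d = vscale ?F z w"
    using mult_add_right[OF s' s a' a aw] mult_assoc[OF s' s f(1) a' a w] f eq
    unfolding b_def by simp
  then have "fmult A ?s' s ?a' (vscale (fib A s) (inverse z) ?d) = w"
    using mult_scale_right[OF s' s a' d, of "inverse z"] f z0 w by (simp add: V.scale_scale V.scale_one)
  then show ?thesis
    using that w eq unfolding f_def b_def by simp
qed

text \<open>The substitute for approximate units: by the estimate \<open>a\<close> is close to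
  \<open>- a w\<close>, and \<open>w\<close> is of the form \<open>a\<^sup>* y\<close>. All factorizations of slices below come from this.\<close>

lemma in_vclosure_triple_products:
  assumes s: "s \<in> S" and M: "lin_subspace (fib A s) M"
    and act: "\<And>m c. m \<in> M \<Longrightarrow> c \<in> fcarrier A (inv s \<odot> s) \<Longrightarrow> fmult A s (inv s \<odot> s) m c \<in> M"
    and a: "a \<in> M"
  shows "a \<in> vclosure (fib A s)
    {fmult A s (inv s \<odot> s) a (fmult A (inv s) s (fstar A s a) y) | y. y \<in> M}"
proof -
  define f where "f = inv s \<odot> s"
  have s': "inv s \<in> S" and f: "f \<in> S" "s \<odot> f = s" "inv s \<odot> s = f"
    using s by (simp_all add: f_def S_simps)
  interpret X: complex_banach_space "fib A s" using banach s by simp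
  have M': "x \<in> M \<Longrightarrow> x \<in> fcarrier A s" "x \<in> M \<Longrightarrow> y \<in> M \<Longrightarrow> vadd (fib A s) x y \<in> M"
    "x \<in> M \<Longrightarrow> vscale (fib A s) k x \<in> M" for x y k
    using M unfolding lin_subspace_def by auto
  have aA: "a \<in> fcarrier A s" using M' a by simp
  have a': "fstar A s a \<in> fcarrier A (inv s)" using star_in_fib s aA by simp
  show ?thesis
    unfolding X.in_vclosure_iff f_def[symmetric]
  proof (intro conjI allI impI aA)
    fix \<delta> :: real assume \<delta>: "\<delta> > 0"
    define \<epsilon> where "\<epsilon> = \<delta>\<^sup>2 / 4"
    have \<epsilon>: "\<epsilon> > 0" using \<delta> unfolding \<epsilon>_def by simp
    obtain w where w: "w \<in> fcarrier A f"
      "vscale (fib A f) (\<i> * complex_of_real \<epsilon>) w = vadd (fib A f) (fmult A (inv s) s (fstar A s a) a)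
        (fmult A f f (fmult A (inv s) s (fstar A s a) a) w)"
      and w3: "w = fmult A (inv s) s (fstar A s a)
        (vscale (fib A s) (inverse (\<i> * complex_of_real \<epsilon>)) (vadd (fib A s) a (fmult A s f a w)))"
      using Cayley_exists[OF s aA \<epsilon>] unfolding f_def by blast
    define d where "d = vadd (fib A s) a (fmult A s f a w)"
    have "(vnorm (fib A s) d)\<^sup>2 \<le> 2 * \<epsilon>"
      using Cayley_estimate[OF s aA \<epsilon> _ refl, of w] w unfolding d_def f_def by simp
    also have "\<dots> < \<delta>\<^sup>2" using \<delta> unfolding \<epsilon>_def by simp
    finally have nd: "vnorm (fib A s) d < \<delta>"
      using \<delta> power_less_imp_less_base by (metis less_eq_real_def)
    have aw: "fmult A s f a w \<in> M" using act[OF a] w unfolding f_def by simp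
    then have dM: "d \<in> M" unfolding d_def using M' a by simp
    define y where "y = vscale (fib A s) (-1) (vscale (fib A s) (inverse (\<i> * complex_of_real \<epsilon>)) d)"
    have y: "y \<in> M" unfolding y_def using M' dM by simp
    have "fmult A (inv s) s (fstar A s a) y = vscale (fib A f) (-1) w"
      using mult_scale_right[OF s' s a', of "vscale (fib A s) (inverse (\<i> * complex_of_real \<epsilon>)) d" "-1"]
        w3 M' dM f unfolding y_def d_def[symmetric] by simp
    then have ay: "fmult A s f a (fmult A (inv s) s (fstar A s a) y) = vscale (fib A s) (-1) (fmult A s f a w)"
      using mult_scale_right[OF s f(1) aA w(1), of "-1"] f by simp
    have "vdist (fib A s) a (vscale (fib A s) (-1) (fmult A s f a w)) = vnorm (fib A s) d"
      using aA aw M' unfolding d_def by (simp add: X.dist_eq X.scale_closed X.scale_scale X.scale_one)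
    then have "vdist (fib A s) a (fmult A s f a (fmult A (inv s) s (fstar A s a) y)) < \<delta>"
      using nd ay by simp
    moreover have "fmult A s f a (fmult A (inv s) s (fstar A s a) y) \<in> fcarrier A s"
      unfolding ay using aw M' X.scale_closed by simp
    ultimately show "\<exists>y\<in>{fmult A s f a (fmult A (inv s) s (fstar A s a) y) |y. y \<in> M}.
        y \<in> fcarrier A s \<and> vdist (fib A s) a y < \<delta>"
      using y by blast
  qed
qed

end

context fell_bundle
begin

section \<open>The inverse semigroup of slices\<close>

definition slice :: "'s \<Rightarrow> 'a set \<Rightarrow> bool" where
  "slice s M \<longleftrightarrow> s \<in> S \<and> closed_subspace (fib A s) M \<and>
    (\<forall>a\<in>fcarrier A (s \<odot> inv s). \<forall>m\<in>M. fmult A (s \<odot> inv s) s a m \<in> M) \<and>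
    (\<forall>m\<in>M. \<forall>b\<in>fcarrier A (inv s \<odot> s). fmult A s (inv s \<odot> s) m b \<in> M)"

definition span_mult :: "'s \<Rightarrow> 's \<Rightarrow> 'a set \<Rightarrow> 'a set \<Rightarrow> 'a set" where
  "span_mult s t M N = closed_span (fib A (s \<odot> t)) {fmult A s t a b | a b. a \<in> M \<and> b \<in> N}"

lemma sliceD:
  assumes "slice s M"
  shows "s \<in> S" "closed_subspace (fib A s) M" "M \<subseteq> fcarrier A s"
    "m \<in> M \<Longrightarrow> m \<in> fcarrier A s"
    "a \<in> fcarrier A (s \<odot> inv s) \<Longrightarrow> m \<in> M \<Longrightarrow> fmult A (s \<odot> inv s) s a m \<in> M"
    "m \<in> M \<Longrightarrow> b \<in> fcarrier A (inv s \<odot> s) \<Longrightarrow> fmult A s (inv s \<odot> s) m b \<in> M"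
    "lin_subspace (fib A s) M"
  using assms unfolding slice_def closed_subspace_def lin_subspace_def by auto

context
  fixes s t M N
  assumes s: "s \<in> S" and t: "t \<in> S" and M: "M \<subseteq> fcarrier A s" and N: "N \<subseteq> fcarrier A t"
begin

lemma products_in_fib: "{fmult A s t a b | a b. a \<in> M \<and> b \<in> N} \<subseteq> fcarrier A (s \<odot> t)"
  using mult_in_fib[OF s t] M N by blast

lemma span_mult_closed_subspace: "closed_subspace (fib A (s \<odot> t)) (span_mult s t M N)"
  unfolding span_mult_def
  using complex_banach_space.closed_subspace_closed_span[OF banach[OF S_mult[OF s t]] products_in_fib] .

lemma span_mult_subset: "span_mult s t M N \<subseteq> fcarrier A (s \<odot> t)"
  using span_mult_closed_subspace unfolding closed_subspace_def lin_subspace_def by simp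

lemma span_multI: "a \<in> M \<Longrightarrow> b \<in> N \<Longrightarrow> fmult A s t a b \<in> span_mult s t M N"
  unfolding span_mult_def
  using complex_banach_space.subset_closed_span[OF banach[OF S_mult[OF s t]] products_in_fib] by blast

lemma span_mult_least:
  assumes "closed_subspace (fib A (s \<odot> t)) W"
    and "\<And>a b. a \<in> M \<Longrightarrow> b \<in> N \<Longrightarrow> fmult A s t a b \<in> W"
  shows "span_mult s t M N \<subseteq> W"
  unfolding span_mult_def
  by (rule complex_banach_space.closed_span_least[OF banach[OF S_mult[OF s t]] assms(1)])
    (use assms(2) in auto)

end

lemma span_mult_assoc:
  assumes r: "r \<in> S" and s: "s \<in> S" and t: "t \<in> S"
    and L: "L \<subseteq> fcarrier A r" and M: "M \<subseteq> fcarrier A s" and N: "N \<subseteq> fcarrier A t"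
  shows "span_mult (r \<odot> s) t (span_mult r s L M) N = span_mult r (s \<odot> t) L (span_mult s t M N)"
proof
  note rs = S_mult[OF r s] and st = S_mult[OF s t] and rst = S_mult[OF r S_mult[OF s t]]
  have assoc: "r \<odot> s \<odot> t = r \<odot> (s \<odot> t)" using S_assoc r s t by simp
  note LM = span_mult_subset[OF r s L M] and MN = span_mult_subset[OF s t M N]
  show "span_mult (r \<odot> s) t (span_mult r s L M) N \<subseteq> span_mult r (s \<odot> t) L (span_mult s t M N)"
  proof (rule span_mult_least[OF rs t LM N])
    show W: "closed_subspace (fib A (r \<odot> s \<odot> t)) (span_mult r (s \<odot> t) L (span_mult s t M N))"
      using span_mult_closed_subspace[OF r st L MN] assoc by simp
    fix x n assume x: "x \<in> span_mult r s L M" and n: "n \<in> N"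
    have "fmult A (r \<odot> s) t (fmult A r s l m) n \<in> span_mult r (s \<odot> t) L (span_mult s t M N)"
      if "l \<in> L" "m \<in> M" for l m
      using mult_assoc[OF r s t, of l m n] span_multI[OF r st L MN that(1) span_multI[OF s t M N that(2) n]]
        that n L M N by (simp add: subset_iff)
    then show "fmult A (r \<odot> s) t x n \<in> span_mult r (s \<odot> t) L (span_mult s t M N)"
      using closed_span_vimage[OF banach[OF rs] banach[OF S_mult[OF rs t]] bounded_mult_left[OF rs t] W
          products_in_fib[OF r s L M] _ x[unfolded span_mult_def], of n] n N by blast
  qed
  show "span_mult r (s \<odot> t) L (span_mult s t M N) \<subseteq> span_mult (r \<odot> s) t (span_mult r s L M) N"
  proof (rule span_mult_least[OF r st L MN])
    show W: "closed_subspace (fib A (r \<odot> (s \<odot> t))) (span_mult (r \<odot> s) t (span_mult r s L M) N)"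
      using span_mult_closed_subspace[OF rs t LM N] assoc by simp
    fix l x assume l: "l \<in> L" and x: "x \<in> span_mult s t M N"
    have "fmult A r (s \<odot> t) l (fmult A s t m n) \<in> span_mult (r \<odot> s) t (span_mult r s L M) N"
      if "m \<in> M" "n \<in> N" for m n
      using mult_assoc[OF r s t, of l m n] span_multI[OF rs t LM N span_multI[OF r s L M l that(1)] that(2)]
        that l L M N by (simp add: subset_iff)
    then show "fmult A r (s \<odot> t) l x \<in> span_mult (r \<odot> s) t (span_mult r s L M) N"
      using closed_span_vimage[OF banach[OF st] banach[OF rst] bounded_mult_right[OF r st] W
          products_in_fib[OF s t M N] _ x[unfolded span_mult_def], of l] l L by blast
  qed
qed

lemma star_image:
  assumes s: "s \<in> S" and M: "M \<subseteq> fcarrier A s"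
  shows "fstar A s ` M = {x \<in> fcarrier A (inv s). fstar A (inv s) x \<in> M}"
proof -
  have "x \<in> fstar A s ` M" if "x \<in> fcarrier A (inv s)" "fstar A (inv s) x \<in> M" for x
    using star_star[OF S_inv[OF s] that(1)] that(2) S_inv_inv[OF s] by (metis imageI)
  then show ?thesis
    using star_in_fib[OF s] star_star[OF s] M by (auto simp: subset_iff)
qed

lemma slice_star:
  assumes M: "slice s M"
  shows "slice (inv s) (fstar A s ` M)"
proof -
  note s = sliceD(1)[OF M] and M' = sliceD(4-6)[OF M]
  have s': "inv s \<in> S" using S_inv s .
  note img = star_image[OF s sliceD(3)[OF M]]
  let ?e = "s \<odot> inv s" and ?f = "inv s \<odot> s"
  have e: "?e \<in> S" "inv ?e = ?e" and f: "?f \<in> S" "inv ?f = ?f" using s by (simp_all add: S_simps)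
  have ind: "s \<odot> ?f = s" "?e \<odot> s = s" using s by (simp_all add: S_simps)
  show ?thesis
    unfolding slice_def
  proof (intro conjI ballI)
    show "closed_subspace (fib A (inv s)) (fstar A s ` M)"
      unfolding img using closed_subspace_vimage[OF banach[OF s'] banach[OF s] _ sliceD(2)[OF M]]
        bounded_star[OF s'] S_inv_inv[OF s] by simp
  next
    fix a y assume a: "a \<in> fcarrier A (inv s \<odot> inv (inv s))" and y: "y \<in> fstar A s ` M"
    then obtain m where m: "m \<in> M" "y = fstar A s m" by blast
    have a: "a \<in> fcarrier A ?f" using a S_inv_inv[OF s] by simp
    have a': "fstar A ?f a \<in> fcarrier A ?f" using star_in_fib[OF f(1) a] f by simp
    have "fstar A s (fmult A s ?f m (fstar A ?f a)) = fmult A ?f (inv s) a y"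
      using star_mult[OF s f(1) M'(1)[OF m(1)] a'] star_star[OF f(1) a] f ind m by simp
    then show "fmult A (inv s \<odot> inv (inv s)) (inv s) a y \<in> fstar A s ` M"
      using M'(3)[OF m(1) a'] S_inv_inv[OF s] by (metis imageI)
  next
    fix a y assume a: "a \<in> fcarrier A (inv (inv s) \<odot> inv s)" and y: "y \<in> fstar A s ` M"
    then obtain m where m: "m \<in> M" "y = fstar A s m" by blast
    have a: "a \<in> fcarrier A ?e" using a S_inv_inv[OF s] by simp
    have a': "fstar A ?e a \<in> fcarrier A ?e" using star_in_fib[OF e(1) a] e by simp
    have "fstar A s (fmult A ?e s (fstar A ?e a) m) = fmult A (inv s) ?e y a"
      using star_mult[OF e(1) s a' M'(1)[OF m(1)]] star_star[OF e(1) a] e ind m by simp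
    then show "fmult A (inv s) (inv (inv s) \<odot> inv s) y a \<in> fstar A s ` M"
      using M'(2)[OF a' m(1)] S_inv_inv[OF s] by (metis imageI)
  qed (use s' in simp)
qed

text \<open>Since \<open>s t (s t)\<^sup>* \<le> s s\<^sup>*\<close> and \<open>(s t)\<^sup>* s t \<le> t\<^sup>* t\<close>, the unit fibers of \<open>s t\<close> embed into the
  left unit fiber of \<open>s\<close> and the right unit fiber of \<open>t\<close>, which act on \<open>M\<close> and \<open>N\<close>.\<close>

lemma slice_span_mult:
  assumes M: "slice s M" and N: "slice t N"
  shows "slice (s \<odot> t) (span_mult s t M N)"
proof -
  note s = sliceD(1)[OF M] and t = sliceD(1)[OF N]
  note MA = sliceD(3)[OF M] and NA = sliceD(3)[OF N]
  have st: "s \<odot> t \<in> S" using S_mult s t .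
  note W = span_mult_closed_subspace[OF s t MA NA]
  define g where "g = s \<odot> t \<odot> inv (s \<odot> t)"
  have gE: "g \<in> E" using E_range[OF st] unfolding g_def .
  note g = E_simps[OF gE]
  define k where "k = inv (s \<odot> t) \<odot> (s \<odot> t)"
  have kE: "k \<in> E" using E_source[OF st] unfolding k_def .
  note k = E_simps[OF kE]
  have eS: "s \<odot> inv s \<in> S" and fS: "inv t \<odot> t \<in> S" using s t S_mult S_inv by auto
  show ?thesis
    unfolding slice_def
  proof (intro conjI ballI)
    fix a x assume a: "a \<in> fcarrier A (s \<odot> t \<odot> inv (s \<odot> t))" and x: "x \<in> span_mult s t M N"
    have a: "a \<in> fcarrier A g" using a unfolding g_def .
    have "g \<odot> (s \<odot> inv s) = g" using s t unfolding g_def by (simp add: S_simps)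
    then have ge: "g \<preceq> s \<odot> inv s" using le_idempotent_mult[OF eS gE] by simp
    have h: "g \<odot> s \<preceq> s" using le_idempotent_mult[OF s gE] .
    have hS: "g \<odot> s \<in> S" using S_mult g s by simp
    have gst: "g \<odot> (s \<odot> t) = s \<odot> t" "g \<odot> s \<odot> t = s \<odot> t"
      using S_mult_inv_mult(1)[OF st] S_assoc[OF st S_inv[OF st] st] S_assoc[OF g(1) s t]
      unfolding g_def by simp_all
    have es: "s \<odot> inv s \<odot> s = s" using s by (simp add: S_simps)
    have "fmult A g (s \<odot> t) a (fmult A s t m n) \<in> span_mult s t M N" if m: "m \<in> M" and n: "n \<in> N" for m n
    proof -
      have mA: "m \<in> fcarrier A s" and nA: "n \<in> fcarrier A t" using m n MA NA by auto
      have am: "fmult A g s a m \<in> fcarrier A (g \<odot> s)" using mult_in_fib[OF g(1) s a mA] .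
      define m' where "m' = fincl A s (g \<odot> s) (fmult A g s a m)"
      have "m' = fmult A (s \<odot> inv s) s (fincl A (s \<odot> inv s) g a) m"
        using incl_mult[OF ge le_refl[OF s] a mA] incl_refl[OF s mA] es unfolding m'_def by simp
      then have m': "m' \<in> M"
        using sliceD(5)[OF M _ m] incl_in_fib[OF ge a] by simp
      have "fmult A s t m' n = fmult A (g \<odot> s) t (fmult A g s a m) n"
        using incl_mult[OF h le_refl[OF t] am nA] incl_refl[OF t nA] gst
          incl_refl[OF st] mult_in_fib[OF hS t am nA] unfolding m'_def by simp
      also have "\<dots> = fmult A g (s \<odot> t) a (fmult A s t m n)"
        using mult_assoc[OF g(1) s t a mA nA] .
      finally show ?thesis using span_multI[OF s t MA NA m' n] by simp
    qed
    then show "fmult A (s \<odot> t \<odot> inv (s \<odot> t)) (s \<odot> t) a x \<in> span_mult s t M N"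
      using closed_span_vimage[OF banach[OF st] banach[OF st] _ W products_in_fib[OF s t MA NA] _
          x[unfolded span_mult_def], of "fmult A g (s \<odot> t) a"]
        bounded_mult_right[OF g(1) st a] gst unfolding g_def[symmetric] by auto
  next
    fix x b assume b: "b \<in> fcarrier A (inv (s \<odot> t) \<odot> (s \<odot> t))" and x: "x \<in> span_mult s t M N"
    have b: "b \<in> fcarrier A k" using b unfolding k_def .
    have "inv t \<odot> t \<odot> k = k" using s t unfolding k_def by (simp add: S_simps)
    then have kf: "k \<preceq> inv t \<odot> t" using le_mult_idempotent[OF fS kE] by simp
    have h: "t \<odot> k \<preceq> t" using le_mult_idempotent[OF t kE] .
    have hS: "t \<odot> k \<in> S" using S_mult k t by simp
    have stk: "s \<odot> t \<odot> k = s \<odot> t" "s \<odot> (t \<odot> k) = s \<odot> t"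
      using S_mult_inv_mult(1)[OF st] S_assoc[OF s t k(1)] unfolding k_def by simp_all
    have tf: "t \<odot> (inv t \<odot> t) = t" using t by (simp add: S_simps)
    have "fmult A (s \<odot> t) k (fmult A s t m n) b \<in> span_mult s t M N" if m: "m \<in> M" and n: "n \<in> N" for m n
    proof -
      have mA: "m \<in> fcarrier A s" and nA: "n \<in> fcarrier A t" using m n MA NA by auto
      have nb: "fmult A t k n b \<in> fcarrier A (t \<odot> k)" using mult_in_fib[OF t k(1) nA b] .
      define n' where "n' = fincl A t (t \<odot> k) (fmult A t k n b)"
      have "n' = fmult A t (inv t \<odot> t) n (fincl A (inv t \<odot> t) k b)"
        using incl_mult[OF le_refl[OF t] kf nA b] incl_refl[OF t nA] tf unfolding n'_def by simp
      then have n': "n' \<in> N"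
        using sliceD(6)[OF N n] incl_in_fib[OF kf b] by simp
      have "fmult A s t m n' = fmult A s (t \<odot> k) m (fmult A t k n b)"
        using incl_mult[OF le_refl[OF s] h mA nb] incl_refl[OF s mA] stk
          incl_refl[OF st] mult_in_fib[OF s hS mA nb] unfolding n'_def by simp
      also have "\<dots> = fmult A (s \<odot> t) k (fmult A s t m n) b"
        using mult_assoc[OF s t k(1) mA nA b] by simp
      finally show ?thesis using span_multI[OF s t MA NA m n'] by simp
    qed
    then show "fmult A (s \<odot> t) (inv (s \<odot> t) \<odot> (s \<odot> t)) x b \<in> span_mult s t M N"
      using closed_span_vimage[OF banach[OF st] banach[OF st] _ W products_in_fib[OF s t MA NA] _
          x[unfolded span_mult_def], of "\<lambda>x. fmult A (s \<odot> t) k x b"]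
        bounded_mult_left[OF st k(1) b] stk unfolding k_def[symmetric] by auto
  qed (use st W in auto)
qed

lemma slice_carrier:
  assumes s: "s \<in> S"
  shows "slice s (fcarrier A s)"
proof -
  have "fmult A (s \<odot> inv s) s a m \<in> fcarrier A s"
    if "a \<in> fcarrier A (s \<odot> inv s)" "m \<in> fcarrier A s" for a m
    using mult_in_fib[of "s \<odot> inv s" s a m] that s by (simp add: S_simps)
  moreover have "fmult A s (inv s \<odot> s) m b \<in> fcarrier A s"
    if "b \<in> fcarrier A (inv s \<odot> s)" "m \<in> fcarrier A s" for b m
    using mult_in_fib[of s "inv s \<odot> s" m b] that s by (simp add: S_simps)
  ultimately show ?thesis
    unfolding slice_def using s complex_banach_space.closed_subspace_carrier[OF banach[OF s]] by blast
qed

text \<open>The module property gives \<open>M M\<^sup>* M \<subseteq> M\<close>; conversely each \<open>m \<in> M\<close> is a limit of elements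
  \<open>m (m\<^sup>* y)\<close>.\<close>

lemma slice_triple_product:
  assumes M: "slice s M"
  shows "span_mult s (inv s \<odot> s) M (span_mult (inv s) s (fstar A s ` M) M) = M"
proof
  note s = sliceD(1)[OF M] and MA = sliceD(3)[OF M]
  have s': "inv s \<in> S" using S_inv s .
  have f: "inv s \<odot> s \<in> S" using S_mult s s' by simp
  have sf: "s \<odot> (inv s \<odot> s) = s" using s by (simp add: S_simps)
  note MsA = sliceD(3)[OF slice_star[OF M]]
  note QA = span_mult_subset[OF s' s MsA MA]
  show "span_mult s (inv s \<odot> s) M (span_mult (inv s) s (fstar A s ` M) M) \<subseteq> M"
  proof (rule span_mult_least[OF s f MA QA])
    show "closed_subspace (fib A (s \<odot> (inv s \<odot> s))) M" using sliceD(2)[OF M] sf by simp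
    show "fmult A s (inv s \<odot> s) a b \<in> M" if "a \<in> M" "b \<in> span_mult (inv s) s (fstar A s ` M) M" for a b
      using sliceD(6)[OF M] that QA by blast
  qed
  show "M \<subseteq> span_mult s (inv s \<odot> s) M (span_mult (inv s) s (fstar A s ` M) M)" (is "_ \<subseteq> ?R")
  proof
    fix m assume m: "m \<in> M"
    interpret X: complex_banach_space "fib A s" using banach s .
    have R: "closed_subspace (fib A s) ?R"
      using span_mult_closed_subspace[OF s f MA QA] sf by simp
    let ?Y = "{fmult A s (inv s \<odot> s) m (fmult A (inv s) s (fstar A s m) y) | y. y \<in> M}"
    have "m \<in> vclosure (fib A s) ?Y"
      using in_vclosure_triple_products[OF s sliceD(7)[OF M] sliceD(6)[OF M] m] .
    moreover have "?Y \<subseteq> ?R"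
      using span_multI[OF s f MA QA m span_multI[OF s' s MsA MA]] m by blast
    ultimately show "m \<in> ?R"
      using X.vclosure_mono R unfolding closed_subspace_def by blast
  qed
qed

text \<open>Over an idempotent a slice is an ideal of its fiber, so \<open>M = M M\<^sup>* M \<subseteq> M M \<subseteq> M\<close>.\<close>

lemma slice_idempotent:
  assumes e: "e \<in> E" and M: "slice e M"
  shows "span_mult e e M M = M"
proof
  note e' = E_simps[OF e] and MA = sliceD(3)[OF M]
  have act: "fmult A e e a m \<in> M" "fmult A e e m a \<in> M" if "a \<in> fcarrier A e" "m \<in> M" for a m
    using sliceD(5)[OF M, of a m] sliceD(6)[OF M, of m a] that e' by auto
  show "span_mult e e M M \<subseteq> M"
    by (rule span_mult_least[OF e'(1,1) MA MA]) (use sliceD(2)[OF M] e' act MA in auto)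
  have N: "slice e (fstar A e ` M)" using slice_star[OF M] e' by simp
  note NA = sliceD(3)[OF N]
  have NM: "span_mult e e (fstar A e ` M) M \<subseteq> M"
    by (rule span_mult_least[OF e'(1,1) NA MA]) (use sliceD(2)[OF M] e' act NA in auto)
  have "span_mult e e M (span_mult e e (fstar A e ` M) M) \<subseteq> span_mult e e M M"
    by (rule span_mult_least[OF e'(1,1) MA order_trans[OF NM MA] span_mult_closed_subspace[OF e'(1,1) MA MA]])
      (use span_multI[OF e'(1,1) MA MA] NM in auto)
  then show "M \<subseteq> span_mult e e M M"
    using slice_triple_product[OF M] e' by simp
qed

text \<open>A closed ideal \<open>M\<close> is self-adjoint: \<open>m \<in> M\<close> is a limit of elements \<open>m (m\<^sup>* y)\<close>, which lie in the
  ideal \<open>M\<^sup>*\<close>. Applied to \<open>I J\<close>, \<open>I\<close> and \<open>J\<close> this gives \<open>I J = (I J)\<^sup>* = J\<^sup>* I\<^sup>* = J I\<close>.\<close>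

lemma slice_idempotent_star:
  assumes e: "e \<in> E" and M: "slice e M" and m: "m \<in> M"
  shows "fstar A e m \<in> M"
proof -
  note e' = E_simps[OF e] and MA = sliceD(3)[OF M]
  have N: "slice e (fstar A e ` M)" using slice_star[OF M] e' by simp
  interpret X: complex_banach_space "fib A e" using banach e' by simp
  have "m \<in> vclosure (fib A e) {fmult A e e m (fmult A e e (fstar A e m) y) | y. y \<in> M}"
    using in_vclosure_triple_products[OF e'(1) sliceD(7)[OF M] sliceD(6)[OF M] m] e' by simp
  moreover have "{fmult A e e m (fmult A e e (fstar A e m) y) | y. y \<in> M} \<subseteq> fstar A e ` M"
    using sliceD(5,6)[OF N] m MA e' by (auto simp: subset_iff)
  ultimately have "m \<in> fstar A e ` M"
    using X.vclosure_mono sliceD(2)[OF N] unfolding closed_subspace_def by blast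
  then show ?thesis
    using star_star[OF e'(1)] e' MA by auto
qed

lemma slice_commute_subset:
  assumes e: "e \<in> E" and f: "f \<in> E" and I: "slice e I" and J: "slice f J"
  shows "span_mult e f I J \<subseteq> span_mult f e J I"
proof
  note e' = E_simps[OF e] and f' = E_simps[OF f] and IA = sliceD(3)[OF I] and JA = sliceD(3)[OF J]
  have gE: "e \<odot> f \<in> E" using E_mult e f .
  note g = E_simps[OF gE]
  have comm: "f \<odot> e = e \<odot> f" using E_commute e f by simp
  note M = slice_span_mult[OF I J]
  fix x assume x: "x \<in> span_mult e f I J"
  have W: "closed_subspace (fib A (e \<odot> f)) (span_mult f e J I)"
    using span_mult_closed_subspace[OF f'(1) e'(1) JA IA] comm by simp
  have b: "bounded_semilinear (fib A (e \<odot> f)) (fib A (e \<odot> f)) (fstar A (e \<odot> f))"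
    using bounded_star[OF g(1)] g by simp
  have "fstar A (e \<odot> f) (fstar A (e \<odot> f) x) \<in> span_mult f e J I"
  proof (rule closed_span_vimage[OF banach[OF g(1)] banach[OF g(1)] b W products_in_fib[OF e'(1) f'(1) IA JA]])
    fix y assume "y \<in> {fmult A e f a b | a b. a \<in> I \<and> b \<in> J}"
    then obtain i j where ij: "i \<in> I" "j \<in> J" "y = fmult A e f i j" by blast
    then have "fstar A (e \<odot> f) y = fmult A f e (fstar A f j) (fstar A e i)"
      using star_mult[OF e'(1) f'(1), of i j] IA JA e' f' by auto
    then show "fstar A (e \<odot> f) y \<in> span_mult f e J I"
      using span_multI[OF f'(1) e'(1) JA IA] slice_idempotent_star[OF e I] slice_idempotent_star[OF f J] ij by simp
  qed (use slice_idempotent_star[OF gE M x] in \<open>simp add: span_mult_def\<close>)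
  then show "x \<in> span_mult f e J I"
    using star_star[OF g(1), of x] sliceD(4)[OF M x] g by simp
qed

definition slices :: "('s \<times> 'a set) set" where
  "slices = {p. slice (fst p) (snd p)}"

definition slice_mult :: "'s \<times> 'a set \<Rightarrow> 's \<times> 'a set \<Rightarrow> 's \<times> 'a set" where
  "slice_mult p q = (fst p \<odot> fst q, span_mult (fst p) (fst q) (snd p) (snd q))"

definition slice_inv :: "'s \<times> 'a set \<Rightarrow> 's \<times> 'a set" where
  "slice_inv p = (inv (fst p), fstar A (fst p) ` snd p)"

definition slice_semigroup :: "('s \<times> 'a set) set \<Rightarrow> bool" where
  "slice_semigroup P \<longleftrightarrow> P \<subseteq> slices \<and> (\<forall>p\<in>P. \<forall>q\<in>P. slice_mult p q \<in> P) \<and> (\<forall>p\<in>P. slice_inv p \<in> P)"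

definition slice_sgrp :: "('s \<times> 'a set) set \<Rightarrow> ('s \<times> 'a set) sgrp" where
  "slice_sgrp P = \<lparr>elts = P, smult = slice_mult\<rparr>"

lemma slice_sgrp_simps: "elts (slice_sgrp P) = P" "smult (slice_sgrp P) = slice_mult"
  by (simp_all add: slice_sgrp_def)

lemma slices_closed:
  "p \<in> slices \<Longrightarrow> q \<in> slices \<Longrightarrow> slice_mult p q \<in> slices"
  "p \<in> slices \<Longrightarrow> slice_inv p \<in> slices"
  unfolding slices_def slice_mult_def slice_inv_def using slice_span_mult slice_star by auto

lemma slice_mult_assoc:
  assumes "p \<in> slices" "q \<in> slices" "r \<in> slices"
  shows "slice_mult (slice_mult p q) r = slice_mult p (slice_mult q r)"
  using assms span_mult_assoc[of "fst p" "fst q" "fst r" "snd p" "snd q" "snd r"]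
    S_assoc[of "fst p" "fst q" "fst r"] sliceD(1,3)
  unfolding slices_def slice_mult_def by auto

lemma slice_inv_inv: "p \<in> slices \<Longrightarrow> slice_inv (slice_inv p) = p"
  unfolding slices_def slice_inv_def
  using S_inv_inv[of "fst p"] sliceD(1)[of "fst p" "snd p"] star_star[of "fst p"] sliceD(4)[of "fst p" "snd p"]
  by (auto simp: image_image prod_eq_iff)

lemma slice_mult_inv_mult:
  assumes "p \<in> slices"
  shows "slice_mult p (slice_mult (slice_inv p) p) = p"
  using assms slice_triple_product[of "fst p" "snd p"] S_mult_inv_mult(1)[of "fst p"] sliceD(1)
  unfolding slices_def slice_mult_def slice_inv_def by (auto simp: prod_eq_iff)

lemma slice_idempotent_iff:
  assumes "p \<in> slices"
  shows "slice_mult p p = p \<longleftrightarrow> fst p \<in> E"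
  using assms slice_idempotent[of "fst p" "snd p"] E_simps(2)[of "fst p"] sliceD(1)
  unfolding slices_def slice_mult_def by (auto simp: prod_eq_iff idempotents_def S_def mul_def)

lemma slice_idempotents_commute:
  assumes p: "p \<in> slices" "fst p \<in> E" and q: "q \<in> slices" "fst q \<in> E"
  shows "slice_mult p q = slice_mult q p"
proof -
  have "slice (fst p) (snd p)" "slice (fst q) (snd q)"
    using p q unfolding slices_def by auto
  then have "span_mult (fst p) (fst q) (snd p) (snd q) = span_mult (fst q) (fst p) (snd q) (snd p)"
    using slice_commute_subset p(2) q(2) by (intro equalityI) simp_all
  then show ?thesis
    unfolding slice_mult_def using E_commute[OF p(2) q(2)] by simp
qed

lemma inverse_semigroup_slice_sgrp:
  assumes P: "slice_semigroup P"
  shows "inverse_semigroup (slice_sgrp P)"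
proof (rule inverse_semigroupI, unfold slice_sgrp_simps)
  note P' = P[unfolded slice_semigroup_def]
  show "slice_mult p q \<in> P" if "p \<in> P" "q \<in> P" for p q using that P' by blast
  show "slice_mult (slice_mult p q) r = slice_mult p (slice_mult q r)"
    if "p \<in> P" "q \<in> P" "r \<in> P" for p q r
    by (rule slice_mult_assoc) (use that P' in auto)
  show "\<exists>q\<in>P. slice_mult (slice_mult p q) p = p \<and> slice_mult (slice_mult q p) q = q" if p: "p \<in> P" for p
  proof (intro bexI conjI)
    have pT: "p \<in> slices" "slice_inv p \<in> slices" using p P' by auto
    show "slice_inv p \<in> P" using p P' by blast
    show "slice_mult (slice_mult p (slice_inv p)) p = p"
      using pT slice_mult_assoc slice_mult_inv_mult by simp
    show "slice_mult (slice_mult (slice_inv p) p) (slice_inv p) = slice_inv p"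
      using pT slice_mult_assoc slice_mult_inv_mult[of "slice_inv p"] slice_inv_inv by simp
  qed
  show "slice_mult p q = slice_mult q p"
    if "p \<in> idempotents (slice_sgrp P)" "q \<in> idempotents (slice_sgrp P)" for p q
  proof -
    have "p \<in> slices" "slice_mult p p = p" "q \<in> slices" "slice_mult q q = q"
      using that P' unfolding idempotents_def slice_sgrp_simps by auto
    then show ?thesis
      using slice_idempotents_commute slice_idempotent_iff by simp
  qed
qed

lemma sinv_slice_sgrp:
  assumes P: "slice_semigroup P" and p: "p \<in> P"
  shows "sinv (slice_sgrp P) p = slice_inv p"
proof (rule inverse_semigroup.inv_unique[OF inverse_semigroup_slice_sgrp[OF P]], unfold slice_sgrp_simps)
  have pT: "p \<in> slices" "slice_inv p \<in> slices" and q: "slice_inv p \<in> P"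
    using p P unfolding slice_semigroup_def by auto
  show "slice_inv p \<in> P" by (fact q)
  show "slice_mult (slice_mult p (slice_inv p)) p = p"
    using pT slice_mult_assoc slice_mult_inv_mult by simp
  show "slice_mult (slice_mult (slice_inv p) p) (slice_inv p) = slice_inv p"
    using pT slice_mult_assoc slice_mult_inv_mult[of "slice_inv p"] slice_inv_inv by simp
qed (fact p)

lemma idempotents_slice_sgrp:
  assumes "slice_semigroup P"
  shows "p \<in> idempotents (slice_sgrp P) \<longleftrightarrow> p \<in> P \<and> fst p \<in> E"
  using assms slice_idempotent_iff[of p] unfolding idempotents_def[of "slice_sgrp P"] slice_sgrp_simps slice_semigroup_def
  by blast

text \<open>If \<open>(s, M) \<le> (t, N)\<close> then \<open>M\<close> is the closed span of \<open>N M\<^sup>* M\<close>, and the inclusion into the fiber over \<open>t\<close> turns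
  \<open>n (m\<^sup>* m')\<close> into the product of \<open>n\<close> with an element of the unit fiber over \<open>t\<^sup>* t\<close>, which acts on \<open>N\<close>.\<close>

lemma nat_le_slice_sgrp:
  assumes P: "slice_semigroup P" and le: "nat_le (slice_sgrp P) p q"
  shows "fst p \<preceq> fst q" "x \<in> snd p \<Longrightarrow> fincl A (fst q) (fst p) x \<in> snd q"
proof -
  obtain s M t N where p: "p = (s, M)" and q: "q = (t, N)" by force
  have pP: "p \<in> P" "q \<in> P" using le unfolding nat_le_def slice_sgrp_simps by auto
  then have M: "slice s M" and N: "slice t N"
    using P p q unfolding slice_semigroup_def slices_def by auto
  note s = sliceD(1)[OF M] and t = sliceD(1)[OF N]
  have s': "inv s \<in> S" and f: "inv s \<odot> s \<in> S" using s S_inv S_mult by auto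
  let ?Q = "span_mult (inv s) s (fstar A s ` M) M"
  have eq: "s = t \<odot> (inv s \<odot> s)" "M = span_mult t (inv s \<odot> s) N ?Q"
    using le sinv_slice_sgrp[OF P pP(1)] unfolding nat_le_def slice_sgrp_simps p q slice_mult_def slice_inv_def
    by auto
  have st: "s \<preceq> t"
    using eq(1) s t unfolding le_def nat_le_def S_def mul_def inv_def by simp
  show "fst p \<preceq> fst q" using st p q by simp
  note ff = le_source[OF st]
  have QA: "?Q \<subseteq> fcarrier A (inv s \<odot> s)"
    using span_mult_subset[OF s' s sliceD(3)[OF slice_star[OF M]] sliceD(3)[OF M]] .
  have tf: "t \<odot> (inv t \<odot> t) = t" using t by (simp add: S_simps)
  have "span_mult t (inv s \<odot> s) N ?Q \<subseteq> {x \<in> fcarrier A s. fincl A t s x \<in> N}"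
  proof (rule span_mult_least[OF t f sliceD(3)[OF N] QA])
    show "closed_subspace (fib A (t \<odot> (inv s \<odot> s))) {x \<in> fcarrier A s. fincl A t s x \<in> N}"
      using closed_subspace_vimage[OF banach[OF s] banach[OF t] bounded_incl[OF st] sliceD(2)[OF N]] eq(1) by simp
    fix n c assume n: "n \<in> N" and c: "c \<in> ?Q"
    have cA: "c \<in> fcarrier A (inv s \<odot> s)" and nA: "n \<in> fcarrier A t" using c QA sliceD(4)[OF N n] by auto
    have "fincl A t s (fmult A t (inv s \<odot> s) n c) = fmult A t (inv t \<odot> t) n (fincl A (inv t \<odot> t) (inv s \<odot> s) c)"
      using incl_mult[OF le_refl[OF t] ff nA cA] incl_refl[OF t nA] tf eq(1) by simp
    then show "fmult A t (inv s \<odot> s) n c \<in> {x \<in> fcarrier A s. fincl A t s x \<in> N}"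
      using sliceD(6)[OF N n incl_in_fib[OF ff cA]] mult_in_fib[OF t f nA cA] eq(1) by simp
  qed
  then show "fincl A (fst q) (fst p) x \<in> snd q" if "x \<in> snd p"
    using that eq(2) unfolding p q by auto
qed

end

context fell_bundle
begin

section \<open>The Fell bundle of a semigroup of slices\<close>

definition slice_bundle :: "('s \<times> 'a set) set \<Rightarrow> ('s \<times> 'a set, 'a) fell" where
  "slice_bundle P = \<lparr>base = slice_sgrp P, fib = (\<lambda>p. (fib A (fst p))\<lparr>vcarrier := snd p\<rparr>),
     fmult = (\<lambda>p q. fmult A (fst p) (fst q)), fstar = (\<lambda>p. fstar A (fst p)),
     fincl = (\<lambda>p q. fincl A (fst p) (fst q))\<rparr>"

lemma slice_bundle_simps:
  "base (slice_bundle P) = slice_sgrp P"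
  "fib (slice_bundle P) p = (fib A (fst p))\<lparr>vcarrier := snd p\<rparr>"
  "fmult (slice_bundle P) p q = fmult A (fst p) (fst q)"
  "fstar (slice_bundle P) p = fstar A (fst p)"
  "fincl (slice_bundle P) p q = fincl A (fst p) (fst q)"
  by (simp_all add: slice_bundle_def)

lemma fst_slice_ops: "fst (slice_mult p q) = fst p \<odot> fst q" "fst (slice_inv p) = inv (fst p)"
  by (simp_all add: slice_mult_def slice_inv_def)

lemma fib_alg_slice_bundle:
  "fib_alg (slice_bundle P) p = (fib_alg A (fst p))\<lparr>vcarrier := snd p\<rparr>"
  by (simp add: fib_alg_def slice_bundle_simps cspace.defs)

text \<open>Inverses of \<open>z - x\<close> for \<open>x\<close> in an ideal and \<open>z \<noteq> 0\<close> stay in the unitization of that ideal.\<close>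

lemma positive_elem_ideal:
  assumes e: "e \<in> E" and I: "slice e I" and x: "x \<in> I" and pos: "positive_elem (fib_alg A e) x"
  shows "positive_elem ((fib_alg A e)\<lparr>vcarrier := I\<rparr>) x"
  unfolding positive_elem_def
proof (intro conjI subsetI)
  show "x \<in> vcarrier ((fib_alg A e)\<lparr>vcarrier := I\<rparr>)" using x by simp
  show "astar ((fib_alg A e)\<lparr>vcarrier := I\<rparr>) x = x"
    using pos unfolding positive_elem_def by simp
  fix z assume z: "z \<in> spectrum ((fib_alg A e)\<lparr>vcarrier := I\<rparr>) x"
  show "z \<in> \<real>\<^sub>\<ge>\<^sub>0"
  proof (rule ccontr)
    assume nn: "z \<notin> \<real>\<^sub>\<ge>\<^sub>0"
    then have z0: "z \<noteq> 0" by auto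
    have "z \<notin> spectrum (fib_alg A e) x" using pos nn unfolding positive_elem_def by blast
    then obtain y where y: "snd y \<in> fcarrier A e"
      "unitization_mult (fib_alg A e) (z, vscale (fib A e) (-1) x) y = (1, vzero (fib A e))"
      "unitization_mult (fib_alg A e) y (z, vscale (fib A e) (-1) x) = (1, vzero (fib A e))"
      unfolding spectrum_def by (auto simp: fib_alg_simps)
    note e' = E_simps[OF e]
    interpret V: complex_banach_space "fib A e" using banach e' by simp
    let ?u = "vadd (fib A e) (vscale (fib A e) (fst y) (vscale (fib A e) (-1) x))
       (fmult A e e (vscale (fib A e) (-1) x) (snd y))"
    have xI: "vscale (fib A e) (-1) x \<in> I" using closed_subspace_scale[OF sliceD(2)[OF I] x] .
    have xy: "fmult A e e (vscale (fib A e) (-1) x) (snd y) \<in> I"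
      using sliceD(6)[OF I xI, of "snd y"] y(1) e' by simp
    then have u: "?u \<in> I"
      by (intro closed_subspace_add[OF sliceD(2)[OF I]] closed_subspace_scale[OF sliceD(2)[OF I]] xI xy)
    then have uA: "?u \<in> fcarrier A e" using sliceD(4)[OF I] by blast
    have *: "fmult A e e (vscale (fib A e) (-1) x) (snd y) \<in> fcarrier A e"
      "vscale (fib A e) (fst y) (vscale (fib A e) (-1) x) \<in> fcarrier A e"
      using xy xI V.scale_closed sliceD(4)[OF I] by auto
    have "vadd (fib A e) (vscale (fib A e) z (snd y)) ?u = vzero (fib A e)"
      using y(2) * y(1) V.scale_closed unfolding unitization_mult_def
      by (simp add: fib_alg_simps V.add_assoc)
    moreover have "vadd (fib A e) (vscale (fib A e) (-1) ?u) ?u = vzero (fib A e)"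
      using V.add_uminus[OF uA] V.add_commute[OF uA V.scale_closed[OF uA]] by simp
    ultimately have "vscale (fib A e) z (snd y) = vscale (fib A e) (-1) ?u"
      using V.add_right_imp_eq[OF V.scale_closed[OF y(1)] V.scale_closed[OF uA] uA] by simp
    then have "vscale (fib A e) (inverse z) (vscale (fib A e) z (snd y)) \<in> I"
      using closed_subspace_scale[OF sliceD(2)[OF I] closed_subspace_scale[OF sliceD(2)[OF I] u]] by simp
    then have "snd y \<in> I"
      using y(1) z0 by (simp add: V.scale_scale V.scale_one)
    moreover have "unitization_mult ((fib_alg A e)\<lparr>vcarrier := I\<rparr>) = unitization_mult (fib_alg A e)"
      by (simp add: unitization_mult_def fun_eq_iff)
    ultimately show False
      using z y(2,3) unfolding spectrum_def by (cases y) (auto simp: fib_alg_simps)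
  qed
qed

context
  fixes P
  assumes P: "slice_semigroup P"
begin

lemma slice_semigroupD:
  assumes "p \<in> P"
  shows "slice (fst p) (snd p)" "fst p \<in> S" "x \<in> snd p \<Longrightarrow> x \<in> fcarrier A (fst p)"
    "q \<in> P \<Longrightarrow> slice_mult p q \<in> P" "slice_inv p \<in> P" "p \<in> slices" "snd p \<subseteq> fcarrier A (fst p)"
    "closed_subspace (fib A (fst p)) (snd p)"
proof -
  show 1: "slice (fst p) (snd p)" "q \<in> P \<Longrightarrow> slice_mult p q \<in> P" "slice_inv p \<in> P" "p \<in> slices"
    using P assms unfolding slice_semigroup_def slices_def by auto
  show "fst p \<in> S" "x \<in> snd p \<Longrightarrow> x \<in> fcarrier A (fst p)" "snd p \<subseteq> fcarrier A (fst p)"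
    "closed_subspace (fib A (fst p)) (snd p)"
    using sliceD[OF 1(1)] by auto
qed

lemma mult_in_slice: "p \<in> P \<Longrightarrow> q \<in> P \<Longrightarrow> a \<in> snd p \<Longrightarrow> b \<in> snd q \<Longrightarrow>
    fmult A (fst p) (fst q) a b \<in> snd (slice_mult p q)"
  unfolding slice_mult_def using span_multI slice_semigroupD(2,7) by simp

lemma star_in_slice: "p \<in> P \<Longrightarrow> a \<in> snd p \<Longrightarrow> fstar A (fst p) a \<in> snd (slice_inv p)"
  unfolding slice_inv_def by simp

lemma fell_bundle_slice_bundle: "fell_bundle (slice_bundle P)"
proof (rule fell_bundle.intro, unfold slice_bundle_simps slice_sgrp_simps, goal_cases)
  case 1
  show ?case using inverse_semigroup_slice_sgrp[OF P] .
next
  case (2 p)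
  show ?case using closed_subspace_banach[OF banach[OF slice_semigroupD(2)[OF 2]] slice_semigroupD(8)[OF 2]] .
next
  case (3 p q)
  have "p \<in> P" using 3 unfolding nat_le_def slice_sgrp_simps by simp
  then show ?case
    using nat_le_slice_sgrp[OF P 3] incl_linear[of "fst p" "fst q"] slice_semigroupD(3)[of p]
    unfolding lin_map_def by simp
next
  case (4 p q a)
  have "p \<in> P" using 4 unfolding nat_le_def slice_sgrp_simps by simp
  then show ?case
    using nat_le_slice_sgrp(1)[OF P 4(1)] incl_isometric[of "fst p" "fst q" a] slice_semigroupD(3)[of p] 4(2)
    by simp
next
  case (5 p q a)
  then show ?case
    using mult_in_slice[of p q a] mult_linear_right[of "fst p" "fst q" a] slice_semigroupD(2,3)[of p]
      slice_semigroupD(2,3)[of q]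
    unfolding lin_map_def by (simp add: fst_slice_ops)
next
  case (6 p q b)
  then show ?case
    using mult_in_slice[of p q _ b] mult_linear_left[of "fst p" "fst q" b] slice_semigroupD(2,3)[of p]
      slice_semigroupD(2,3)[of q]
    unfolding lin_map_def by (simp add: fst_slice_ops)
next
  case (7 p q r a b c)
  then show ?case
    using mult_assoc[of "fst p" "fst q" "fst r" a b c] slice_semigroupD(2,3) by (simp add: fst_slice_ops)
next
  case (8 p q a b)
  then show ?case
    using norm_mult[of "fst p" "fst q" a b] slice_semigroupD(2,3) by (simp add: fst_slice_ops)
next
  case (9 p)
  then show ?case
    using star_in_slice[of p] star_conj_linear[of "fst p"] slice_semigroupD(2,3)[of p] sinv_slice_sgrp[OF P, of p]
    unfolding conj_lin_map_def by (simp add: fst_slice_ops)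
next
  case (10 p a)
  then show ?case
    using star_star[of "fst p" a] slice_semigroupD(2,3) sinv_slice_sgrp[OF P, of p] by (simp add: fst_slice_ops)
next
  case (11 p a)
  then show ?case
    using norm_star[of "fst p" a] slice_semigroupD(2,3) sinv_slice_sgrp[OF P, of p] by (simp add: fst_slice_ops)
next
  case (12 p q a b)
  then show ?case
    using star_mult[of "fst p" "fst q" a b] slice_semigroupD(2,3) sinv_slice_sgrp[OF P, of p]
      sinv_slice_sgrp[OF P, of q] by (simp add: fst_slice_ops)
next
  case (13 p a)
  then show ?case
    using cstar_identity[of "fst p" a] slice_semigroupD(2,3) sinv_slice_sgrp[OF P, of p] by (simp add: fst_slice_ops)
next
  case (14 p a)
  let ?q = "slice_mult (slice_inv p) p"
  have q: "?q \<in> P" using 14 slice_semigroupD by simp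
  have fq: "fst ?q = inv (fst p) \<odot> fst p" by (simp add: fst_slice_ops)
  have a: "a \<in> snd p" and aA: "a \<in> fcarrier A (fst p)" and pS: "fst p \<in> S"
    using 14 slice_semigroupD(2,3)[of p] by auto
  have "fmult A (inv (fst p)) (fst p) (fstar A (fst p) a) a \<in> snd ?q"
    using mult_in_slice[of "slice_inv p" p "fstar A (fst p) a" a] star_in_slice[of p a] a 14 slice_semigroupD(5)
    by (simp add: fst_slice_ops)
  then show ?case
    using positive_elem_ideal[OF _ _ _ star_mult_positive[OF pS aA], of "snd ?q"] slice_semigroupD(1)[OF q]
      E_source[OF pS] sinv_slice_sgrp[OF P, of p] 14
    by (simp add: fib_alg_slice_bundle fq fst_slice_ops)
next
  case (15 p q r a)
  have "p \<in> P" using 15 unfolding nat_le_def slice_sgrp_simps by simp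
  then show ?case
    using 15 incl_incl[of "fst p" "fst q" "fst r" a] nat_le_slice_sgrp(1)[OF P] slice_semigroupD(3)[of p] by simp
next
  case (16 p q u v a b)
  have "p \<in> P" "u \<in> P" using 16 unfolding nat_le_def slice_sgrp_simps by simp_all
  then show ?case
    using 16 incl_mult[of "fst p" "fst q" "fst u" "fst v" a b] nat_le_slice_sgrp(1)[OF P]
      slice_semigroupD(3)[of p] slice_semigroupD(3)[of u] by (simp add: fst_slice_ops)
next
  case (17 p q a)
  have "p \<in> P" "q \<in> P" using 17 unfolding nat_le_def slice_sgrp_simps by simp_all
  then show ?case
    using 17 incl_star[of "fst p" "fst q" a] nat_le_slice_sgrp(1)[OF P]
      slice_semigroupD(3)[of p] sinv_slice_sgrp[OF P, of p] sinv_slice_sgrp[OF P, of q]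
    by (simp add: fst_slice_ops)
qed

lemma saturated_slice_bundle: "saturated (slice_bundle P)"
  unfolding saturated_def slice_bundle_simps slice_sgrp_simps
proof (intro ballI)
  fix p q assume p: "p \<in> P" and q: "q \<in> P"
  note D = slice_semigroupD[OF p] and D' = slice_semigroupD[OF q]
  let ?X = "{fmult A (fst p) (fst q) a b | a b. a \<in> snd p \<and> b \<in> snd q}"
  have W: "closed_subspace (fib A (fst p \<odot> fst q)) (span_mult (fst p) (fst q) (snd p) (snd q))"
    using span_mult_closed_subspace[OF D(2) D'(2) D(7) D'(7)] .
  have "?X \<subseteq> span_mult (fst p) (fst q) (snd p) (snd q)"
    using span_multI[OF D(2) D'(2) D(7) D'(7)] by blast
  from closed_span_carrier_update[OF banach[OF S_mult[OF D(2) D'(2)]] W this]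
  show "closed_span ((fib A (fst (slice_mult p q)))\<lparr>vcarrier := snd (slice_mult p q)\<rparr>)
      {fmult A (fst p) (fst q) a b |a b.
        a \<in> vcarrier ((fib A (fst p))\<lparr>vcarrier := snd p\<rparr>) \<and> b \<in> vcarrier ((fib A (fst q))\<lparr>vcarrier := snd q\<rparr>)} =
    vcarrier ((fib A (fst (slice_mult p q)))\<lparr>vcarrier := snd (slice_mult p q)\<rparr>)"
    by (simp add: slice_mult_def span_mult_def)
qed

lemma refinement_slice_bundle:
  assumes surj: "\<And>s. s \<in> S \<Longrightarrow> \<exists>M. (s, M) \<in> P"
    and total: "\<And>s. s \<in> S \<Longrightarrow> fcarrier A s \<subseteq> closed_span (fib A s) (\<Union>{M. (s, M) \<in> P})"
  shows "refinement_of (slice_bundle P) A"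
  unfolding refinement_of_def
proof (intro conjI exI)
  show "fell_bundle (slice_bundle P)" by (rule fell_bundle_slice_bundle)
  show "fell_bundle A" by (rule fell_bundle_axioms)
  show "fell_morphism (slice_bundle P) A fst (\<lambda>p x. x)"
    unfolding fell_morphism_def slice_bundle_simps slice_sgrp_simps
    using slice_semigroupD(2,3) sinv_slice_sgrp[OF P]
    by (auto simp: fst_slice_ops lin_map_def S_def mul_def)
  show "fst ` elts (base (slice_bundle P)) = elts (base A)"
    unfolding slice_bundle_simps slice_sgrp_simps using slice_semigroupD(2) surj unfolding S_def by force
  show "\<forall>p\<in>elts (base (slice_bundle P)). fst p \<in> idempotents (base A) \<longrightarrow> p \<in> idempotents (base (slice_bundle P))"
    unfolding slice_bundle_simps slice_sgrp_simps using idempotents_slice_sgrp[OF P] by blast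
  show "\<forall>t\<in>elts (base (slice_bundle P)). inj_on (\<lambda>x. x) (fcarrier (slice_bundle P) t)" by simp
  show "\<forall>s\<in>elts (base A). fcarrier A s = closed_span (fib A s)
      (\<Union>t\<in>{t \<in> elts (base (slice_bundle P)). fst t = s}. (\<lambda>x. x) ` fcarrier (slice_bundle P) t)"
  proof
    fix s assume "s \<in> elts (base A)"
    then have s: "s \<in> S" unfolding S_def .
    have "(\<Union>t\<in>{t \<in> elts (base (slice_bundle P)). fst t = s}. (\<lambda>x. x) ` fcarrier (slice_bundle P) t)
        = \<Union>{M. (s, M) \<in> P}" (is "?L = ?R")
    proof (intro equalityI subsetI)
      show "x \<in> ?R" if "x \<in> ?L" for x
        using that by (auto simp: slice_bundle_simps slice_sgrp_simps)
      fix x assume "x \<in> ?R"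
      then obtain M where "(s, M) \<in> P" "x \<in> M" by auto
      then show "x \<in> ?L"
        by (auto simp: slice_bundle_simps slice_sgrp_simps intro!: exI[of _ "(s, M)"])
    qed
    then show "fcarrier A s = closed_span (fib A s)
      (\<Union>t\<in>{t \<in> elts (base (slice_bundle P)). fst t = s}. (\<lambda>x. x) ` fcarrier (slice_bundle P) t)"
      using total[OF s] complex_banach_space.closed_span_subset_carrier[OF banach[OF s]]
      by (metis subset_antisym)
  qed
qed

end

lemma slice_semigroup_slices: "slice_semigroup slices"
  unfolding slice_semigroup_def using slices_closed by blast

lemma saturated_refinement_slices:
  "refinement_of (slice_bundle slices) A" "saturated (slice_bundle slices)"
proof -
  have "(s, fcarrier A s) \<in> slices" if "s \<in> S" for s
    using slice_carrier[OF that] unfolding slices_def by simp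
  moreover have "fcarrier A s \<subseteq> closed_span (fib A s) (\<Union>{M. (s, M) \<in> slices})" if "s \<in> S" for s
  proof -
    have "\<Union>{M. (s, M) \<in> slices} = fcarrier A s"
      using slice_carrier[OF that] sliceD(3)[of s] unfolding slices_def by auto
    then show ?thesis
      using complex_banach_space.subset_closed_span[OF banach[OF that]] by simp
  qed
  ultimately show "refinement_of (slice_bundle slices) A"
    using refinement_slice_bundle[OF slice_semigroup_slices] by blast
qed (rule saturated_slice_bundle[OF slice_semigroup_slices])

end

section \<open>Regular slices\<close>

lemma regular_bimod_iff_bij:
  "regular_bimod F \<longleftrightarrow> (\<exists>u. bij_betw u (vcarrier (ralg F)) (vcarrier (bspace F)) \<and>
    (\<forall>b\<in>vcarrier (ralg F). \<forall>c\<in>vcarrier (ralg F).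
      rinner F (u b) (u c) = atimes (ralg F) (astar (ralg F) b) c))"
    (is "_ \<longleftrightarrow> (\<exists>u. ?unitary u)")
proof
  assume "regular_bimod F"
  then obtain u v where uv: "is_adjoint (vcarrier (ralg F)) (\<lambda>b c. atimes (ralg F) (astar (ralg F) b) c)
       (vcarrier (bspace F)) (rinner F) u v"
    and inverse: "\<forall>b\<in>vcarrier (ralg F). v (u b) = b" "\<forall>x\<in>vcarrier (bspace F). u (v x) = x"
    unfolding regular_bimod_def by (elim exE conjE)
  from uv have adj: "\<forall>x\<in>vcarrier (ralg F). u x \<in> vcarrier (bspace F)"
    "\<forall>y\<in>vcarrier (bspace F). v y \<in> vcarrier (ralg F)"
    "\<forall>x\<in>vcarrier (ralg F). \<forall>y\<in>vcarrier (bspace F).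
      rinner F (u x) y = atimes (ralg F) (astar (ralg F) x) (v y)"
    unfolding is_adjoint_def by blast+
  have "bij_betw u (vcarrier (ralg F)) (vcarrier (bspace F))"
    using adj(1,2) inverse by (intro bij_betw_byWitness[of _ v]) auto
  then have "?unitary u" using adj inverse by simp
  then show "\<exists>u. ?unitary u" by blast
next
  assume "\<exists>u. ?unitary u"
  then obtain u where bij: "bij_betw u (vcarrier (ralg F)) (vcarrier (bspace F))"
    and u: "\<And>b c. b \<in> vcarrier (ralg F) \<Longrightarrow> c \<in> vcarrier (ralg F) \<Longrightarrow>
      rinner F (u b) (u c) = atimes (ralg F) (astar (ralg F) b) c" by blast
  let ?v = "inv_into (vcarrier (ralg F)) u"
  have v: "?v y \<in> vcarrier (ralg F)" "u (?v y) = y" if "y \<in> vcarrier (bspace F)" for y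
    using bij that by (auto simp: bij_betw_def inv_into_into f_inv_into_f)
  have "is_adjoint (vcarrier (ralg F)) (\<lambda>b c. atimes (ralg F) (astar (ralg F) b) c)
       (vcarrier (bspace F)) (rinner F) u ?v"
    unfolding is_adjoint_def using v u bij by (auto simp: bij_betw_def) metis
  then show "regular_bimod F"
    unfolding regular_bimod_def using v(2) bij_betw_inv_into_left[OF bij] by blast
qed

context fell_bundle
begin

definition fib_inner :: "'s \<Rightarrow> 'a \<Rightarrow> 'a \<Rightarrow> 'a" where
  "fib_inner s x y = fmult A (inv s) s (fstar A s x) y"

abbreviation inner_products :: "'s \<Rightarrow> 'a set \<Rightarrow> 'a set" where
  "inner_products s M \<equiv> {fib_inner s x y | x y. x \<in> M \<and> y \<in> M}"

abbreviation left_inner_products :: "'s \<Rightarrow> 'a set \<Rightarrow> 'a set" where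
  "left_inner_products s M \<equiv> {fmult A s (inv s) x (fstar A s y) | x y. x \<in> M \<and> y \<in> M}"

lemma inner_in_fib: "s \<in> S \<Longrightarrow> x \<in> fcarrier A s \<Longrightarrow> y \<in> fcarrier A s \<Longrightarrow> fib_inner s x y \<in> fcarrier A (inv s \<odot> s)"
  unfolding fib_inner_def using mult_in_fib[OF S_inv _ star_in_fib] by blast

lemma norm_inner: "s \<in> S \<Longrightarrow> x \<in> fcarrier A s \<Longrightarrow> vnorm (fib A (inv s \<odot> s)) (fib_inner s x x) = (vnorm (fib A s) x)\<^sup>2"
  unfolding fib_inner_def using cstar_identity .

lemma star_inner:
  assumes s: "s \<in> S" and x: "x \<in> fcarrier A s" and y: "y \<in> fcarrier A s"
  shows "fstar A (inv s \<odot> s) (fib_inner s x y) = fib_inner s y x"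
  using star_mult[OF S_inv[OF s] s star_in_fib[OF s x] y] star_star[OF s x] S_inv_inv[OF s]
  unfolding fib_inner_def by simp

lemma inner_linear: "s \<in> S \<Longrightarrow> x \<in> fcarrier A s \<Longrightarrow> lin_map (fib A s) (fib A (inv s \<odot> s)) (fib_inner s x)"
  "s \<in> S \<Longrightarrow> x \<in> fcarrier A s \<Longrightarrow> bounded_semilinear (fib A s) (fib A (inv s \<odot> s)) (fib_inner s x)"
  unfolding fib_inner_def
  using mult_linear_right[OF S_inv _ star_in_fib] bounded_mult_right[OF S_inv _ star_in_fib] by auto

lemma inner_mult:
  assumes r: "r \<in> S" and t: "t \<in> S" and k: "k \<in> fcarrier A r" "k' \<in> fcarrier A r"
    and n: "n \<in> fcarrier A t" "n' \<in> fcarrier A t"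
  shows "fib_inner (r \<odot> t) (fmult A r t k n) (fmult A r t k' n') =
    fmult A (inv t) (inv r \<odot> r \<odot> t) (fstar A t n) (fmult A (inv r \<odot> r) t (fib_inner r k k') n')"
proof -
  have r': "inv r \<in> S" and t': "inv t \<in> S" and rt: "r \<odot> t \<in> S" using r t S_inv S_mult by auto
  note ks = star_in_fib[OF r k(1)] and ns = star_in_fib[OF t n(1)] and kn = mult_in_fib[OF r t k(2) n(2)]
  show ?thesis
    using star_mult[OF r t k(1) n(1)] mult_assoc[OF t' r' rt ns ks kn] mult_assoc[OF r' r t ks k(2) n(2)]
      S_inv_mult[OF r t] S_assoc[OF r' r t]
    unfolding fib_inner_def by simp
qed

text \<open>Unitary equivalence of slices as right Hilbert modules; linearity over scalars and over the
  coefficient algebra follows from the preservation of inner products.\<close>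

definition unitarily_equivalent :: "'s \<times> 'a set \<Rightarrow> 's \<times> 'a set \<Rightarrow> bool" where
  "unitarily_equivalent p q \<longleftrightarrow> inv (fst p) \<odot> fst p = inv (fst q) \<odot> fst q \<and>
    (\<exists>u. bij_betw u (snd p) (snd q) \<and>
      (\<forall>x\<in>snd p. \<forall>y\<in>snd p. fib_inner (fst q) (u x) (u y) = fib_inner (fst p) x y))"

lemma unitarily_equivalent_sym:
  assumes "unitarily_equivalent p q"
  shows "unitarily_equivalent q p"
proof -
  obtain u where u: "bij_betw u (snd p) (snd q)"
    "\<And>x y. x \<in> snd p \<Longrightarrow> y \<in> snd p \<Longrightarrow> fib_inner (fst q) (u x) (u y) = fib_inner (fst p) x y"
    using assms unfolding unitarily_equivalent_def by blast
  let ?v = "inv_into (snd p) u"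
  have "fib_inner (fst p) (?v x) (?v y) = fib_inner (fst q) x y" if "x \<in> snd q" "y \<in> snd q" for x y
    using u(2)[of "?v x" "?v y"] bij_betw_inv_into_right[OF u(1)] that
      bij_betwE[OF bij_betw_inv_into[OF u(1)]] by simp
  then show ?thesis
    using assms bij_betw_inv_into[OF u(1)] unfolding unitarily_equivalent_def by auto
qed

lemma unitarily_equivalent_trans:
  assumes "unitarily_equivalent p q" "unitarily_equivalent q r"
  shows "unitarily_equivalent p r"
proof -
  obtain u where u: "bij_betw u (snd p) (snd q)"
    "\<And>x y. x \<in> snd p \<Longrightarrow> y \<in> snd p \<Longrightarrow> fib_inner (fst q) (u x) (u y) = fib_inner (fst p) x y"
    using assms(1) unfolding unitarily_equivalent_def by blast
  obtain v where v: "bij_betw v (snd q) (snd r)"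
    "\<And>x y. x \<in> snd q \<Longrightarrow> y \<in> snd q \<Longrightarrow> fib_inner (fst r) (v x) (v y) = fib_inner (fst q) x y"
    using assms(2) unfolding unitarily_equivalent_def by blast
  have "fib_inner (fst r) ((v \<circ> u) x) ((v \<circ> u) y) = fib_inner (fst p) x y" if "x \<in> snd p" "y \<in> snd p" for x y
    using u(2)[OF that] v(2) bij_betwE[OF u(1)] that by simp
  then show ?thesis
    using assms bij_betw_trans[OF u(1) v(1)] unfolding unitarily_equivalent_def by auto
qed

text \<open>The graph of the unitary is the closed span of the relation \<open>R\<close> in the product space: both
  projections are isometric on it, hence injective with closed image.\<close>

lemma unitary_extension:
  assumes r: "r \<in> S" and s: "s \<in> S" and rs: "inv r \<odot> r = inv s \<odot> s"
    and R: "R \<subseteq> fcarrier A r \<times> fcarrier A s"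
    and inner: "\<And>x y x' y'. (x, y) \<in> R \<Longrightarrow> (x', y') \<in> R \<Longrightarrow> fib_inner r x x' = fib_inner s y y'"
  shows "unitarily_equivalent (r, closed_span (fib A r) (fst ` R)) (s, closed_span (fib A s) (snd ` R))"
proof -
  define f where "f = inv s \<odot> s"
  have f: "f \<in> S" "inv r \<odot> r = f" "inv s \<odot> s = f" using s S_inv S_mult rs unfolding f_def by auto
  let ?V = "prod_space (fib A r) (fib A s)"
  interpret X: complex_banach_space "fib A r" using banach[OF r] .
  interpret Y: complex_banach_space "fib A s" using banach[OF s] .
  interpret F: complex_banach_space "fib A f" using banach[OF f(1)] .
  have V: "complex_banach_space ?V" using prod_space_banach banach r s by blast
  interpret V: complex_banach_space ?V using V .
  have Vc: "vcarrier ?V = fcarrier A r \<times> fcarrier A s" by (simp add: prod_space_def)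
  have lin: "lin_map ?V (fib A r) fst" "lin_map ?V (fib A s) snd"
    by (auto simp: lin_map_def prod_space_def)
  have bnd: "bounded_semilinear ?V (fib A r) fst" "bounded_semilinear ?V (fib A s) snd"
    unfolding bounded_semilinear_def using lin
    by (auto simp: prod_space_def intro!: exI[of _ 1])
  define G where "G = closed_span ?V R"
  have G: "closed_subspace ?V G" and RG: "R \<subseteq> G"
    unfolding G_def using V.closed_subspace_closed_span V.subset_closed_span R Vc by auto
  have GA: "fst p \<in> fcarrier A r" "snd p \<in> fcarrier A s" if "p \<in> G" for p
    using closed_subspace_imp_carrier[OF G that] unfolding Vc by (simp_all add: mem_Times_iff)
  \<comment> \<open>the closed condition that carries the assumption from \<open>R\<close> to \<open>G\<close>, one argument at a time\<close>
  have eq: "closed_subspace ?V {p \<in> vcarrier ?V. fib_inner r (fst q) (fst p) = fib_inner s (snd q) (snd p)}"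
    if q: "fst q \<in> fcarrier A r" "snd q \<in> fcarrier A s" for q
  proof (rule closed_subspace_equalizer[OF V banach[OF f(1)]])
    show l1: "lin_map ?V (fib A f) (\<lambda>p. fib_inner r (fst q) (fst p))"
      using inner_linear(1)[OF r q(1)] f lin(1) unfolding lin_map_def by auto
    show l2: "lin_map ?V (fib A f) (\<lambda>p. fib_inner s (snd q) (snd p))"
      using inner_linear(1)[OF s q(2)] f lin(2) unfolding lin_map_def by auto
    show "bounded_semilinear ?V (fib A f) (\<lambda>p. fib_inner r (fst q) (fst p))"
      using bounded_semilinear_compose[OF V bnd(1) inner_linear(2)[OF r q(1)] banach[OF r]] f by simp
    show "bounded_semilinear ?V (fib A f) (\<lambda>p. fib_inner s (snd q) (snd p))"
      using bounded_semilinear_compose[OF V bnd(2) inner_linear(2)[OF s q(2)] banach[OF s]] f by simp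
  qed
  have GR: "fib_inner r (fst q) (fst p) = fib_inner s (snd q) (snd p)" if q: "q \<in> R" and p: "p \<in> G" for p q
  proof -
    have "G \<subseteq> {p \<in> vcarrier ?V. fib_inner r (fst q) (fst p) = fib_inner s (snd q) (snd p)}"
      unfolding G_def
    proof (rule V.closed_span_least[OF eq])
      show "R \<subseteq> {p \<in> vcarrier ?V. fib_inner r (fst q) (fst p) = fib_inner s (snd q) (snd p)}"
      proof
        fix x assume x: "x \<in> R"
        then show "x \<in> {p \<in> vcarrier ?V. fib_inner r (fst q) (fst p) = fib_inner s (snd q) (snd p)}"
          using R Vc inner[of "fst q" "snd q" "fst x" "snd x"] q by auto
      qed
    qed (use q R in auto)
    then show ?thesis using p by blast
  qed
  have GG: "fib_inner r (fst q) (fst p) = fib_inner s (snd q) (snd p)" if q: "q \<in> G" and p: "p \<in> G" for p q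
  proof -
    have "fib_inner r (fst q) (fst x) = fib_inner s (snd q) (snd x)" if x: "x \<in> R" for x
    proof -
      have "x \<in> G" using x RG by blast
      then show ?thesis
        using GR[OF x q] star_inner[OF r, of "fst x" "fst q"] star_inner[OF s, of "snd x" "snd q"]
          GA[of x] GA[OF q] f by metis
    qed
    then have "R \<subseteq> {p \<in> vcarrier ?V. fib_inner r (fst q) (fst p) = fib_inner s (snd q) (snd p)}"
      using R Vc by auto
    then have "G \<subseteq> {p \<in> vcarrier ?V. fib_inner r (fst q) (fst p) = fib_inner s (snd q) (snd p)}"
      unfolding G_def using V.closed_span_least[OF eq] GA[OF q] by blast
    then show ?thesis using p by blast
  qed
  have norm_eq: "vnorm (fib A r) (fst p) = vnorm (fib A s) (snd p)" if p: "p \<in> G" for p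
  proof -
    have "(vnorm (fib A r) (fst p))\<^sup>2 = (vnorm (fib A s) (snd p))\<^sup>2"
      using GG[OF p p] norm_inner[OF r GA(1)[OF p]] norm_inner[OF s GA(2)[OF p]] f by simp
    then show ?thesis
      using X.norm_nonneg[OF GA(1)[OF p]] Y.norm_nonneg[OF GA(2)[OF p]] by (metis power2_eq_imp_eq)
  qed
  have iso: "vnorm (fib A r) (fst p) = vnorm ?V p" "vnorm (fib A s) (snd p) = vnorm ?V p" if "p \<in> G" for p
    using norm_eq[OF that] by (simp_all add: prod_space_def)
  have img: "fst ` G = closed_span (fib A r) (fst ` R)" "snd ` G = closed_span (fib A s) (snd ` R)"
  proof -
    have RA: "fst ` R \<subseteq> fcarrier A r" "snd ` R \<subseteq> fcarrier A s" using R by auto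
    have "fst x \<in> closed_span (fib A r) (fst ` R)" "snd x \<in> closed_span (fib A s) (snd ` R)" if "x \<in> G" for x
      using closed_span_vimage[OF V banach[OF r] bnd(1) X.closed_subspace_closed_span[OF RA(1)], of R x]
        closed_span_vimage[OF V banach[OF s] bnd(2) Y.closed_subspace_closed_span[OF RA(2)], of R x]
        X.subset_closed_span[OF RA(1)] Y.subset_closed_span[OF RA(2)] R Vc that unfolding G_def by auto
    moreover have "closed_span (fib A r) (fst ` R) \<subseteq> fst ` G"
      using isometric_image_closed_subspace[OF V banach[OF r] G lin(1) iso(1)] RG
      by (intro X.closed_span_least) auto
    moreover have "closed_span (fib A s) (snd ` R) \<subseteq> snd ` G"
      using isometric_image_closed_subspace[OF V banach[OF s] G lin(2) iso(2)] RG
      by (intro Y.closed_span_least) auto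
    ultimately show "fst ` G = closed_span (fib A r) (fst ` R)" "snd ` G = closed_span (fib A s) (snd ` R)"
      by auto
  qed
  have diff: "vdist (fib A r) (fst p) (fst q) = vdist ?V p q" "vdist (fib A s) (snd p) (snd q) = vdist ?V p q"
    if p: "p \<in> G" and q: "q \<in> G" for p q
  proof -
    have d: "vadd ?V p (vscale ?V (-1) q) \<in> G"
      using closed_subspace_add[OF G p closed_subspace_scale[OF G q]] .
    show "vdist (fib A r) (fst p) (fst q) = vdist ?V p q" "vdist (fib A s) (snd p) (snd q) = vdist ?V p q"
      using iso[OF d] closed_subspace_imp_carrier[OF G p] closed_subspace_imp_carrier[OF G q]
      by (auto simp: vdist_def prod_space_def)
  qed
  have inj: "inj_on fst G" "inj_on snd G"
  proof -
    have "p = q" if "p \<in> G" "q \<in> G" "vdist ?V p q = 0" for p q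
      using that closed_subspace_imp_carrier[OF G] by simp
    then show "inj_on fst G" "inj_on snd G"
      using diff GA by (auto intro!: inj_onI) (metis X.metric.mdist_zero Y.metric.mdist_zero prod.inject)+
  qed
  define u where "u = snd \<circ> inv_into G fst"
  have bij: "bij_betw fst G (closed_span (fib A r) (fst ` R))" "bij_betw snd G (closed_span (fib A s) (snd ` R))"
    using inj img by (simp_all add: bij_betw_def)
  have "bij_betw u (closed_span (fib A r) (fst ` R)) (closed_span (fib A s) (snd ` R))"
    unfolding u_def using bij_betw_trans[OF bij_betw_inv_into[OF bij(1)] bij(2)] .
  moreover have "fib_inner s (u x) (u y) = fib_inner r x y"
    if "x \<in> closed_span (fib A r) (fst ` R)" "y \<in> closed_span (fib A r) (fst ` R)" for x y
    using GG[of "inv_into G fst x" "inv_into G fst y"] that bij_betwE[OF bij_betw_inv_into[OF bij(1)]]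
      bij_betw_inv_into_right[OF bij(1)] unfolding u_def by simp
  ultimately show ?thesis
    unfolding unitarily_equivalent_def using rs by auto
qed

lemma unitarily_equivalent_mult:
  assumes p: "p \<in> slices" and q: "q \<in> slices" and x: "x \<in> slices" and eq: "unitarily_equivalent p q"
  shows "unitarily_equivalent (slice_mult p x) (slice_mult q x)"
proof -
  obtain r K s L t N where pqx: "p = (r, K)" "q = (s, L)" "x = (t, N)" by (metis surj_pair)
  have K: "slice r K" and L: "slice s L" and N: "slice t N"
    using p q x unfolding slices_def pqx by auto
  note r = sliceD(1)[OF K] and s = sliceD(1)[OF L] and t = sliceD(1)[OF N]
  obtain u where rs: "inv r \<odot> r = inv s \<odot> s" and u: "bij_betw u K L"
    "\<And>x y. x \<in> K \<Longrightarrow> y \<in> K \<Longrightarrow> fib_inner s (u x) (u y) = fib_inner r x y"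
    using eq unfolding unitarily_equivalent_def pqx by auto
  define R where "R = {(fmult A r t k n, fmult A s t (u k) n) | k n. k \<in> K \<and> n \<in> N}"
  have uL: "u k \<in> L" if "k \<in> K" for k using u(1) that bij_betwE by blast
  have "unitarily_equivalent (r \<odot> t, closed_span (fib A (r \<odot> t)) (fst ` R))
      (s \<odot> t, closed_span (fib A (s \<odot> t)) (snd ` R))"
  proof (rule unitary_extension)
    show "r \<odot> t \<in> S" "s \<odot> t \<in> S" using S_mult r s t by auto
    have "inv r \<odot> (r \<odot> t) = inv s \<odot> (s \<odot> t)"
      using rs S_assoc[of "inv r" r t] S_assoc[of "inv s" s t] S_inv r s t by simp
    then show "inv (r \<odot> t) \<odot> (r \<odot> t) = inv (s \<odot> t) \<odot> (s \<odot> t)"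
      using r s t by (simp add: S_inv_mult S_assoc S_inv S_mult)
    show "R \<subseteq> fcarrier A (r \<odot> t) \<times> fcarrier A (s \<odot> t)"
      unfolding R_def using mult_in_fib[OF r t] mult_in_fib[OF s t] sliceD(4)[OF K] sliceD(4)[OF L] sliceD(4)[OF N] uL
      by auto
    fix x y x' y' assume "(x, y) \<in> R" "(x', y') \<in> R"
    then obtain k n k' n' where "x = fmult A r t k n" "y = fmult A s t (u k) n" "k \<in> K" "n \<in> N"
      "x' = fmult A r t k' n'" "y' = fmult A s t (u k') n'" "k' \<in> K" "n' \<in> N"
      unfolding R_def by auto
    then show "fib_inner (r \<odot> t) x x' = fib_inner (s \<odot> t) y y'"
      using inner_mult[OF r t, of k k' n n'] inner_mult[OF s t, of "u k" "u k'" n n'] u(2)[of k k'] rs uL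
        sliceD(4)[OF K] sliceD(4)[OF L] sliceD(4)[OF N] by simp
  qed
  moreover have "fst ` R = {fmult A r t k n | k n. k \<in> K \<and> n \<in> N}"
    unfolding R_def by (auto simp: image_iff) blast+
  moreover have "snd ` R = {fmult A s t l n | l n. l \<in> L \<and> n \<in> N}"
  proof -
    have "L = u ` K" using u(1) by (simp add: bij_betw_def)
    then show ?thesis unfolding R_def by (auto simp: image_iff) metis+
  qed
  ultimately show ?thesis
    unfolding pqx slice_mult_def span_mult_def by simp
qed

definition regular_slice :: "'s \<times> 'a set \<Rightarrow> bool" where
  "regular_slice p \<longleftrightarrow> unitarily_equivalent (slice_mult (slice_inv p) p) p"

text \<open>Write \<open>\<sim>\<close> for unitary equivalence. For \<open>q = (m n)\<^sup>* (m n)\<close> one has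
  \<open>q = n\<^sup>* n q \<sim> n q = m\<^sup>* m n \<sim> m n\<close>, and \<open>m m\<^sup>* \<sim> m\<^sup>* m m\<^sup>* = m\<^sup>*\<close>.\<close>

lemma regular_slice_mult:
  assumes m: "m \<in> slices" "regular_slice m" and n: "n \<in> slices" "regular_slice n"
  shows "regular_slice (slice_mult m n)"
proof -
  interpret T: inverse_semigroup "slice_sgrp slices"
    using inverse_semigroup_slice_sgrp[OF slice_semigroup_slices] .
  note inv = sinv_slice_sgrp[OF slice_semigroup_slices] and c = slices_closed
  let ?m = "slice_inv m" and ?n = "slice_inv n"
  have inv_mult: "slice_inv (slice_mult m n) = slice_mult ?n ?m"
    using T.inv_mult[of m n] m n c inv by (simp add: slice_sgrp_simps)
  have comm: "slice_mult (slice_mult n ?n) (slice_mult ?m m) = slice_mult (slice_mult ?m m) (slice_mult n ?n)"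
    using T.idempotents_commute[OF T.mult_inv_idempotent T.inv_mult_idempotent, of n m] m n inv
    by (simp add: slice_sgrp_simps)
  define q where "q = slice_mult ?n (slice_mult ?m (slice_mult m n))"
  have q: "q \<in> slices" unfolding q_def using m n c by simp
  have source: "slice_mult (slice_inv (slice_mult m n)) (slice_mult m n) = q"
    unfolding q_def inv_mult using m n c by (simp add: slice_mult_assoc)
  have nnq: "slice_mult (slice_mult ?n n) q = q"
  proof -
    have "slice_mult (slice_mult ?n n) q = slice_mult (slice_mult ?n (slice_mult n ?n)) (slice_mult ?m (slice_mult m n))"
      unfolding q_def using m n c by (simp add: slice_mult_assoc)
    also have "slice_mult ?n (slice_mult n ?n) = ?n"
      using slice_mult_inv_mult[of ?n] slice_inv_inv n c by simp
    finally show ?thesis unfolding q_def .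
  qed
  have nq: "slice_mult n q = slice_mult (slice_mult ?m m) n"
  proof -
    have "slice_mult n q = slice_mult (slice_mult (slice_mult n ?n) (slice_mult ?m m)) n"
      unfolding q_def using m n c by (simp add: slice_mult_assoc)
    also have "\<dots> = slice_mult (slice_mult ?m m) (slice_mult n (slice_mult ?n n))"
      unfolding comm using m n c by (simp add: slice_mult_assoc)
    finally show ?thesis using slice_mult_inv_mult n by simp
  qed
  have "unitarily_equivalent q (slice_mult n q)"
    using unitarily_equivalent_mult[of "slice_mult ?n n" n q] n q c nnq unfolding regular_slice_def by simp
  moreover have "unitarily_equivalent (slice_mult n q) (slice_mult m n)"
    unfolding nq using unitarily_equivalent_mult[of "slice_mult ?m m" m n] m n c unfolding regular_slice_def by simp
  ultimately show ?thesis
    unfolding regular_slice_def source by (rule unitarily_equivalent_trans)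
qed

lemma regular_slice_inv:
  assumes m: "m \<in> slices" "regular_slice m"
  shows "regular_slice (slice_inv m)"
proof -
  let ?m = "slice_inv m"
  have m': "?m \<in> slices" using slices_closed m by simp
  have "unitarily_equivalent (slice_mult m ?m) (slice_mult (slice_mult ?m m) ?m)"
    using unitarily_equivalent_mult[OF m(1) _ m' unitarily_equivalent_sym] m m' slices_closed
    unfolding regular_slice_def by simp
  moreover have "slice_mult (slice_mult ?m m) ?m = ?m"
    using slice_mult_inv_mult[OF m'] slice_inv_inv[OF m(1)] slice_mult_assoc[OF m' m(1) m'] by simp
  ultimately show ?thesis
    unfolding regular_slice_def using slice_inv_inv[OF m(1)] by simp
qed

text \<open>Fibers may be zero; the zero slices ensure that regular slices exist over every element of the
  base.\<close>

lemma slice_zero: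
  assumes s: "s \<in> S"
  shows "slice s {vzero (fib A s)}" "regular_slice (s, {vzero (fib A s)})"
proof -
  interpret X: complex_banach_space "fib A s" using banach[OF s] .
  define f where "f = inv s \<odot> s"
  have s': "inv s \<in> S" and f: "f \<in> S" "inv f = f" "f \<odot> f = f" "inv s \<odot> s = f" "s \<odot> f = s"
    and e: "s \<odot> inv s \<in> S" "s \<odot> inv s \<odot> s = s"
    using s unfolding f_def by (simp_all add: S_simps)
  interpret F: complex_banach_space "fib A f" using banach[OF f(1)] .
  have z: "vzero (fib A s) \<in> fcarrier A s" using X.zero_closed .
  show "slice s {vzero (fib A s)}"
    unfolding slice_def f_def[symmetric] using s X.closed_subspace_zero
      semilinear_zero[OF banach[OF s] banach[OF s] disjI1[OF mult_linear_right[OF e(1) s, unfolded e(2)]]]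
      semilinear_zero[OF banach[OF s] banach[OF s] disjI1[OF mult_linear_left[OF s f(1), unfolded f(5)]]]
    by blast
  have a': "fstar A s (vzero (fib A s)) \<in> fcarrier A (inv s)" using star_in_fib[OF s z] .
  have prod: "fmult A (inv s) s (fstar A s (vzero (fib A s))) (vzero (fib A s)) = vzero (fib A f)"
    using semilinear_zero[OF banach[OF s] banach[OF f(1)]] mult_linear_right[OF s' s a'] f by simp
  then have "slice_mult (slice_inv (s, {vzero (fib A s)})) (s, {vzero (fib A s)}) = (f, {vzero (fib A f)})"
    unfolding slice_mult_def slice_inv_def span_mult_def
    using F.closed_span_closed_subspace[OF F.closed_subspace_zero] f by simp
  moreover have "fib_inner f (vzero (fib A f)) (vzero (fib A f)) = vzero (fib A f)"
    "fib_inner s (vzero (fib A s)) (vzero (fib A s)) = vzero (fib A f)"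
    using semilinear_zero[OF banach[OF f(1)] banach[OF f(1)], of "fib_inner f (vzero (fib A f))"]
      semilinear_zero[OF banach[OF s] banach[OF f(1)], of "fib_inner s (vzero (fib A s))"]
      inner_linear(1)[OF f(1) F.zero_closed] inner_linear(1)[OF s z] f by auto
  ultimately show "regular_slice (s, {vzero (fib A s)})"
    unfolding regular_slice_def unitarily_equivalent_def using f
    by (auto intro!: exI[of _ "\<lambda>_. vzero (fib A s)"] simp: bij_betw_def)
qed

lemma slice_source:
  assumes M: "slice s M"
  shows "slice_mult (slice_inv (s, M)) (s, M) =
    (inv s \<odot> s, closed_span (fib A (inv s \<odot> s)) (inner_products s M))"
proof -
  have "{fmult A (inv s) s a b | a b. a \<in> fstar A s ` M \<and> b \<in> M} = inner_products s M"
    unfolding fib_inner_def by auto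
  then show ?thesis
    unfolding slice_mult_def slice_inv_def span_mult_def by simp
qed

lemma inner_idempotent: "s \<in> S \<Longrightarrow> fib_inner (inv s \<odot> s) b c = fmult A (inv s \<odot> s) (inv s \<odot> s) (fstar A (inv s \<odot> s) b) c"
  unfolding fib_inner_def using E_simps(3)[OF E_source] by simp

lemma regular_slice_iff:
  assumes M: "slice s M"
  shows "regular_slice (s, M) \<longleftrightarrow>
    (\<exists>u. bij_betw u (closed_span (fib A (inv s \<odot> s)) (inner_products s M)) M \<and>
    (\<forall>b\<in>closed_span (fib A (inv s \<odot> s)) (inner_products s M).
     \<forall>c\<in>closed_span (fib A (inv s \<odot> s)) (inner_products s M).
      fib_inner s (u b) (u c) = fmult A (inv s \<odot> s) (inv s \<odot> s) (fstar A (inv s \<odot> s) b) c))"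
  unfolding regular_slice_def slice_source[OF M] unitarily_equivalent_def
  using inner_idempotent[OF sliceD(1)[OF M]] E_simps(2,3)[OF E_source[OF sliceD(1)[OF M]]] by simp

lemma fib_bimod_simps:
  "bspace (fib_bimod A s) = fib A s"
  "lact (fib_bimod A s) = fmult A (s \<odot> inv s) s"
  "ract (fib_bimod A s) = fmult A s (inv s \<odot> s)"
  "rinner (fib_bimod A s) = fib_inner s"
  "ralg (fib_bimod A s) = (fib_alg A (inv s \<odot> s))\<lparr>vcarrier :=
    closed_span (fib A (inv s \<odot> s)) (inner_products s (fcarrier A s))\<rparr>"
  "lalg (fib_bimod A s) = (fib_alg A (s \<odot> inv s))\<lparr>vcarrier :=
    closed_span (fib A (s \<odot> inv s)) (left_inner_products s (fcarrier A s))\<rparr>"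
  by (simp_all add: fib_bimod_def Let_def fib_inner_def fun_eq_iff mul_def inv_def)

lemma inner_products_in_fib: "s \<in> S \<Longrightarrow> inner_products s (fcarrier A s) \<subseteq> fcarrier A (inv s \<odot> s)"
  using inner_in_fib by auto

lemma regular_sub_bimod_iff:
  assumes M: "slice s M"
  shows "regular_bimod (sub_bimod (fib_bimod A s) M) \<longleftrightarrow> regular_slice (s, M)"
proof -
  note s = sliceD(1)[OF M]
  let ?f = "inv s \<odot> s"
  have f: "?f \<in> S" using s S_inv S_mult by simp
  let ?J = "closed_span (fib A ?f) (inner_products s (fcarrier A s))"
  let ?X = "inner_products s M"
  interpret F: complex_banach_space "fib A ?f" using banach[OF f] .
  have J: "closed_subspace (fib A ?f) ?J"
    using F.closed_subspace_closed_span[OF inner_products_in_fib[OF s]] .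
  have XJ: "?X \<subseteq> ?J"
    using F.subset_closed_span[OF inner_products_in_fib[OF s]] sliceD(4)[OF M] by blast
  have "closed_span ((fib_alg A ?f)\<lparr>vcarrier := ?J\<rparr>) ?X = closed_span ((fib A ?f)\<lparr>vcarrier := ?J\<rparr>) ?X"
    by (rule closed_span_cong) (simp_all add: fib_alg_simps)
  also have "\<dots> = closed_span (fib A ?f) ?X"
    using closed_span_carrier_update[OF banach[OF f] J XJ] .
  finally show ?thesis
    unfolding regular_bimod_iff_bij regular_slice_iff[OF M]
    by (simp add: sub_bimod_def fib_bimod_simps fib_alg_simps)
qed

text \<open>The actions of the ideals spanned by inner products extend to the full unit fibers, because
  each \<open>x\<close> is a limit of elements \<open>x (x\<^sup>* y)\<close>.\<close>

lemma sliceI_inner: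
  assumes s: "s \<in> S" and X: "closed_subspace (fib A s) X"
    and left_inner: "\<And>x y z. x \<in> fcarrier A s \<Longrightarrow> y \<in> fcarrier A s \<Longrightarrow> z \<in> X \<Longrightarrow>
      fmult A s (inv s \<odot> s) x (fib_inner s y z) \<in> X"
    and right_inner: "\<And>x y z. x \<in> X \<Longrightarrow> y \<in> fcarrier A s \<Longrightarrow> z \<in> fcarrier A s \<Longrightarrow>
      fmult A s (inv s \<odot> s) x (fib_inner s y z) \<in> X"
  shows "slice s X"
proof -
  let ?e = "s \<odot> inv s" and ?f = "inv s \<odot> s"
  have s': "inv s \<in> S" and e: "?e \<in> S" and f: "?f \<in> S" using s S_inv S_mult by auto
  have ind: "?e \<odot> s = s" "s \<odot> ?f = s" "?f \<odot> ?f = ?f" using s by (simp_all add: S_simps)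
  interpret X: complex_banach_space "fib A s" using banach[OF s] .
  have Xl: "lin_subspace (fib A s) X" and XA: "X \<subseteq> fcarrier A s"
    using X unfolding closed_subspace_def lin_subspace_def by auto
  have right: "fmult A s ?f x c \<in> X" if x: "x \<in> X" and c: "c \<in> fcarrier A ?f" for x c
  proof -
    have xA: "x \<in> fcarrier A s" using x XA by blast
    have "x \<in> vclosure (fib A s) {fmult A s ?f x (fmult A (inv s) s (fstar A s x) y) | y. y \<in> fcarrier A s}"
      using in_vclosure_triple_products[OF s X.lin_subspace_carrier _ xA] sliceD(6)[OF slice_carrier[OF s]] by blast
    moreover have "closed_subspace (fib A s) {x \<in> fcarrier A s. fmult A s ?f x c \<in> X}"
      using closed_subspace_vimage[OF banach[OF s] banach[OF s] _ X] bounded_mult_left[OF s f c] ind by simp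
    moreover have "{fmult A s ?f x (fmult A (inv s) s (fstar A s x) y) | y. y \<in> fcarrier A s}
        \<subseteq> {x \<in> fcarrier A s. fmult A s ?f x c \<in> X}"
    proof clarify
      fix y assume y: "y \<in> fcarrier A s"
      have xy: "fib_inner s x y \<in> fcarrier A ?f" using inner_in_fib[OF s xA y] .
      have yc: "fmult A s ?f y c \<in> fcarrier A s" using mult_in_fib[OF s f y c] ind by simp
      have "fmult A s ?f (fmult A s ?f x (fib_inner s x y)) c = fmult A s ?f x (fmult A ?f ?f (fib_inner s x y) c)"
        using mult_assoc[OF s f f xA xy c] ind by simp
      also have "fmult A ?f ?f (fib_inner s x y) c = fib_inner s x (fmult A s ?f y c)"
        unfolding fib_inner_def using mult_assoc[OF s' s f star_in_fib[OF s xA] y c] ind by simp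
      finally show "fmult A s ?f x (fmult A (inv s) s (fstar A s x) y) \<in> fcarrier A s \<and>
          fmult A s ?f (fmult A s ?f x (fmult A (inv s) s (fstar A s x) y)) c \<in> X"
        using right_inner[OF x xA yc] mult_in_fib[OF s f xA xy] ind unfolding fib_inner_def by simp
    qed
    ultimately show ?thesis
      using X.vclosure_mono unfolding closed_subspace_def by blast
  qed
  have left: "fmult A ?e s a x \<in> X" if x: "x \<in> X" and a: "a \<in> fcarrier A ?e" for x a
  proof -
    have xA: "x \<in> fcarrier A s" using x XA by blast
    have "x \<in> vclosure (fib A s) {fmult A s ?f x (fmult A (inv s) s (fstar A s x) y) | y. y \<in> X}"
      using in_vclosure_triple_products[OF s Xl right x] by blast
    moreover have "closed_subspace (fib A s) {x \<in> fcarrier A s. fmult A ?e s a x \<in> X}"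
      using closed_subspace_vimage[OF banach[OF s] banach[OF s] _ X] bounded_mult_right[OF e s a] ind by simp
    moreover have "{fmult A s ?f x (fmult A (inv s) s (fstar A s x) y) | y. y \<in> X}
        \<subseteq> {x \<in> fcarrier A s. fmult A ?e s a x \<in> X}"
    proof clarify
      fix y assume y: "y \<in> X"
      then have xy: "fib_inner s x y \<in> fcarrier A ?f" using inner_in_fib[OF s xA] XA by blast
      have ax: "fmult A ?e s a x \<in> fcarrier A s" using mult_in_fib[OF e s a xA] ind by simp
      have "fmult A ?e s a (fmult A s ?f x (fib_inner s x y)) = fmult A s ?f (fmult A ?e s a x) (fib_inner s x y)"
        using mult_assoc[OF e s f a xA xy] ind by simp
      then show "fmult A s ?f x (fmult A (inv s) s (fstar A s x) y) \<in> fcarrier A s \<and>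
          fmult A ?e s a (fmult A s ?f x (fmult A (inv s) s (fstar A s x) y)) \<in> X"
        using left_inner[OF ax xA y] mult_in_fib[OF s f xA xy] ind unfolding fib_inner_def by simp
    qed
    ultimately show ?thesis
      using X.vclosure_mono unfolding closed_subspace_def by blast
  qed
  show ?thesis
    unfolding slice_def using s X left right by blast
qed

lemma closed_sub_bimod_iff_slice:
  assumes s: "s \<in> S"
  shows "closed_sub_bimod (fib_bimod A s) X \<longleftrightarrow> slice s X"
proof
  let ?e = "s \<odot> inv s" and ?f = "inv s \<odot> s"
  have s': "inv s \<in> S" and e: "?e \<in> S" and f: "?f \<in> S" using s S_inv S_mult by auto
  interpret F: complex_banach_space "fib A ?f" using banach[OF f] .
  interpret L: complex_banach_space "fib A ?e" using banach[OF e] .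
  have LX: "left_inner_products s (fcarrier A s) \<subseteq> fcarrier A ?e"
    using mult_in_fib[OF s s' _ star_in_fib[OF s]] by blast
  {
    assume "slice s X"
    note X = sliceD[OF this]
    show "closed_sub_bimod (fib_bimod A s) X"
      unfolding closed_sub_bimod_def fib_bimod_simps
      using X(2,5,6) L.closed_span_subset_carrier F.closed_span_subset_carrier
      by (auto simp: closed_subspace_def subset_iff)
  }
  assume cs: "closed_sub_bimod (fib_bimod A s) X"
  have X: "closed_subspace (fib A s) X"
    using cs unfolding closed_sub_bimod_def fib_bimod_simps closed_subspace_def by auto
  show "slice s X"
  proof (rule sliceI_inner[OF s X])
    fix x y z assume x: "x \<in> fcarrier A s" and y: "y \<in> fcarrier A s" and z: "z \<in> X"
    have "fmult A s (inv s) x (fstar A s y) \<in> closed_span (fib A ?e) (left_inner_products s (fcarrier A s))"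
      using L.subset_closed_span[OF LX] x y by blast
    then have "fmult A ?e s (fmult A s (inv s) x (fstar A s y)) z \<in> X"
      using cs z unfolding closed_sub_bimod_def fib_bimod_simps by simp
    then show "fmult A s ?f x (fib_inner s y z) \<in> X"
      using mult_assoc[OF s s' s x star_in_fib[OF s y] closed_subspace_imp_carrier[OF X z]]
      unfolding fib_inner_def by simp
  next
    fix x y z assume "x \<in> X" and y: "y \<in> fcarrier A s" and z: "z \<in> fcarrier A s"
    moreover have "fib_inner s y z \<in> closed_span (fib A ?f) (inner_products s (fcarrier A s))"
      using F.subset_closed_span[OF inner_products_in_fib[OF s]] y z by blast
    ultimately show "fmult A s ?f x (fib_inner s y z) \<in> X"
      using cs unfolding closed_sub_bimod_def fib_bimod_simps by simp
  qed
qed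

lemma regular_slice_bundle:
  assumes P: "slice_semigroup P" and reg: "\<And>p. p \<in> P \<Longrightarrow> regular_slice p"
  shows "regular (slice_bundle P)"
  unfolding regular_def
proof
  fix p assume "p \<in> elts (base (slice_bundle P))"
  then have p: "p \<in> P" by (simp add: slice_bundle_simps slice_sgrp_simps)
  obtain s M where sM: "p = (s, M)" by force
  have M: "slice s M" using P p unfolding slice_semigroup_def slices_def sM by auto
  note s = sliceD(1)[OF M]
  have f: "inv s \<odot> s \<in> S" using s S_inv S_mult by simp
  let ?X = "inner_products s M"
  interpret F: complex_banach_space "fib A (inv s \<odot> s)" using banach[OF f] .
  have XA: "?X \<subseteq> fcarrier A (inv s \<odot> s)" using inner_in_fib[OF s] sliceD(4)[OF M] by auto
  have "closed_span ((fib A (inv s \<odot> s))\<lparr>vcarrier := closed_span (fib A (inv s \<odot> s)) ?X\<rparr>) ?X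
      = closed_span (fib A (inv s \<odot> s)) ?X"
    using closed_span_carrier_update[OF banach[OF f] F.closed_subspace_closed_span[OF XA] F.subset_closed_span[OF XA]] .
  then show "regular_bimod (fib_bimod (slice_bundle P) p)"
    using reg[OF p] sinv_slice_sgrp[OF P p]
    unfolding regular_bimod_iff_bij sM regular_slice_iff[OF M]
    by (simp add: fib_bimod_def Let_def slice_bundle_simps slice_sgrp_simps fib_alg_slice_bundle fst_slice_ops
        slice_source[OF M] fib_alg_simps fib_inner_def[symmetric])
qed

lemma regular_saturated_refinement:
  assumes "locally_regular A"
  shows "\<exists>B :: ('s \<times> 'a set, 'a) fell. refinement_of B A \<and> regular B \<and> saturated B"
proof -
  define P where "P = {p \<in> slices. regular_slice p}"
  have P: "slice_semigroup P"
    unfolding slice_semigroup_def P_def using slices_closed regular_slice_mult regular_slice_inv by auto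
  have "refinement_of (slice_bundle P) A"
  proof (rule refinement_slice_bundle[OF P])
    fix s assume s: "s \<in> S"
    show "\<exists>M. (s, M) \<in> P"
      using slice_zero[OF s] unfolding P_def slices_def by auto
    have "locally_regular_bimod (fib_bimod A s)"
      using assms s unfolding locally_regular_def S_def by simp
    then obtain \<F> where
      \<F>: "\<forall>X\<in>\<F>. closed_sub_bimod (fib_bimod A s) X \<and> regular_bimod (sub_bimod (fib_bimod A s) X)"
      "fcarrier A s = closed_span (fib A s) (\<Union>\<F>)"
      unfolding locally_regular_bimod_def fib_bimod_simps by (elim exE conjE)
    have "\<F> \<subseteq> {M. (s, M) \<in> P}"
      using \<F>(1) closed_sub_bimod_iff_slice[OF s] regular_sub_bimod_iff[of s]
      unfolding P_def slices_def by auto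
    moreover have "\<Union>{M. (s, M) \<in> P} \<subseteq> fcarrier A s"
      unfolding P_def slices_def using sliceD(3)[of s] by auto
    ultimately show "fcarrier A s \<subseteq> closed_span (fib A s) (\<Union>{M. (s, M) \<in> P})"
      using \<F>(2) complex_banach_space.closed_span_mono[OF banach[OF s]] by (metis Union_mono)
  qed
  moreover have "regular (slice_bundle P)"
    by (rule regular_slice_bundle[OF P]) (simp add: P_def)
  ultimately show ?thesis
    using saturated_slice_bundle[OF P] by blast
qed

end

section \<open>Images of regular fibers\<close>

context fell_bundle
begin

lemma inner_eqI:
  assumes s: "s \<in> S" and x: "x \<in> fcarrier A s" and y: "y \<in> fcarrier A s"
    and eq: "\<And>z. z \<in> fcarrier A s \<Longrightarrow> fib_inner s z x = fib_inner s z y"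
  shows "x = y"
proof -
  interpret X: complex_banach_space "fib A s" using banach[OF s] .
  have f: "inv s \<odot> s \<in> S" using s S_inv S_mult by simp
  interpret F: complex_banach_space "fib A (inv s \<odot> s)" using banach[OF f] .
  define d where "d = vadd (fib A s) x (vscale (fib A s) (-1) y)"
  have d: "d \<in> fcarrier A s" unfolding d_def using x y X.add_closed X.scale_closed by simp
  have "fib_inner s d d = vadd (fib A (inv s \<odot> s)) (fib_inner s d x) (vscale (fib A (inv s \<odot> s)) (-1) (fib_inner s d y))"
    using inner_linear(1)[OF s d] x y X.scale_closed unfolding d_def lin_map_def by simp
  then have "fib_inner s d d = vzero (fib A (inv s \<odot> s))"
    using eq[OF d] F.add_uminus inner_in_fib[OF s d y] by simp
  then have "d = vzero (fib A s)"
    using norm_inner[OF s d] F.norm_zero X.norm_eq_zero[OF d] by simp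
  then show ?thesis
    using X.diff_add_cancel[OF x y] X.zero_add[OF y] unfolding d_def by simp
qed

lemma bounded_inner_left:
  assumes s: "s \<in> S" and y: "y \<in> fcarrier A s"
  shows "bounded_semilinear (fib A s) (fib A (inv s \<odot> s)) (\<lambda>x. fib_inner s x y)"
  unfolding fib_inner_def
  using bounded_semilinear_compose[OF banach[OF s] bounded_star[OF s] bounded_mult_left[OF S_inv[OF s] s y]
      banach[OF S_inv[OF s]]] .

text \<open>Passage from spanning sets to closed spans in both variables of an inner product. The map \<open>h\<close>
  allows for products \<open>m (x\<^sup>* y)\<close>.\<close>

lemma closed_span_inner:
  assumes s: "s \<in> S" and h: "bounded_semilinear (fib A (inv s \<odot> s)) V h"
    and V: "complex_banach_space V" and W: "closed_subspace V W"
    and X: "X \<subseteq> fcarrier A s" and Y: "Y \<subseteq> fcarrier A s"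
    and prod: "\<And>x y. x \<in> X \<Longrightarrow> y \<in> Y \<Longrightarrow> h (fib_inner s x y) \<in> W"
    and x: "x \<in> closed_span (fib A s) X" and y: "y \<in> closed_span (fib A s) Y"
  shows "h (fib_inner s x y) \<in> W"
proof -
  have f: "inv s \<odot> s \<in> S" using s S_inv S_mult by simp
  note Vs = banach[OF s] and Vf = banach[OF f]
  have xy: "x \<in> fcarrier A s" "y \<in> fcarrier A s"
    using complex_banach_space.closed_span_subset_carrier[OF Vs] x y by auto
  have "h (fib_inner s x' y) \<in> W" if x': "x' \<in> X" for x'
  proof (rule closed_span_vimage[OF Vs V bounded_semilinear_compose[OF Vs inner_linear(2)[OF s] h Vf] W Y _ y])
    show "x' \<in> fcarrier A s" using x' X by auto
    show "h (fib_inner s x' z) \<in> W" if "z \<in> Y" for z using prod[OF x' that] .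
  qed
  then show ?thesis
    by (rule closed_span_vimage[OF Vs V bounded_semilinear_compose[OF Vs bounded_inner_left[OF s xy(2)] h Vf] W X _ x])
qed

lemma closed_span_triple_product:
  assumes s: "s \<in> S" and W: "closed_subspace (fib A s) W"
    and X: "X \<subseteq> fcarrier A s" and Y: "Y \<subseteq> fcarrier A s" and Z: "Z \<subseteq> fcarrier A s"
    and prod: "\<And>x y z. x \<in> X \<Longrightarrow> y \<in> Y \<Longrightarrow> z \<in> Z \<Longrightarrow> fmult A s (inv s \<odot> s) x (fib_inner s y z) \<in> W"
    and x: "x \<in> closed_span (fib A s) X" and y: "y \<in> closed_span (fib A s) Y"
    and z: "z \<in> closed_span (fib A s) Z"
  shows "fmult A s (inv s \<odot> s) x (fib_inner s y z) \<in> W"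
proof -
  have f: "inv s \<odot> s \<in> S" "s \<odot> (inv s \<odot> s) = s" using s by (simp_all add: S_simps)
  note Vs = banach[OF s]
  have yz: "fib_inner s y z \<in> fcarrier A (inv s \<odot> s)"
    using inner_in_fib[OF s] complex_banach_space.closed_span_subset_carrier[OF Vs] y z by blast
  have left: "bounded_semilinear (fib A s) (fib A s) (\<lambda>x. fmult A s (inv s \<odot> s) x (fib_inner s y z))"
    using bounded_mult_left[OF s f(1) yz] f by simp
  show ?thesis
  proof (rule closed_span_vimage[OF Vs Vs left W X _ x])
    fix x' assume x': "x' \<in> X"
    then have right: "bounded_semilinear (fib A (inv s \<odot> s)) (fib A s) (fmult A s (inv s \<odot> s) x')"
      using bounded_mult_right[OF s f(1), of x'] X f by auto
    show "fmult A s (inv s \<odot> s) x' (fib_inner s y z) \<in> W"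
      by (rule closed_span_inner[OF s right Vs W Y Z _ y z]) (rule prod[OF x'])
  qed
qed

end

locale fell_bundle_morphism = fell_bundle A S mul inv le
  for A :: "('s, 'a) fell" and S :: "'s set" and mul :: "'s \<Rightarrow> 's \<Rightarrow> 's" (infixl "\<odot>" 70)
    and inv :: "'s \<Rightarrow> 's" and le :: "'s \<Rightarrow> 's \<Rightarrow> bool" (infix "\<preceq>" 50) +
  fixes B :: "('t, 'b) fell" and \<phi> :: "'t \<Rightarrow> 's" and \<psi> :: "'t \<Rightarrow> 'b \<Rightarrow> 'a"
  assumes fell_bundle_B: "fell_bundle B"
    and morphism: "fell_morphism B A \<phi> \<psi>"
begin

sublocale B: fell_bundle B "elts (base B)" "smult (base B)" "sinv (base B)" "nat_le (base B)"
  by (rule fell_bundle_B)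

abbreviation "T \<equiv> elts (base B)"

lemma morphism_closed: "t \<in> T \<Longrightarrow> \<phi> t \<in> S"
  and morphism_mult: "t \<in> T \<Longrightarrow> u \<in> T \<Longrightarrow> \<phi> (smult (base B) t u) = \<phi> t \<odot> \<phi> u"
  and fiber_map_linear: "t \<in> T \<Longrightarrow> lin_map (fib B t) (fib A (\<phi> t)) (\<psi> t)"
  and fiber_map_mult: "t \<in> T \<Longrightarrow> u \<in> T \<Longrightarrow> a \<in> fcarrier B t \<Longrightarrow> b \<in> fcarrier B u \<Longrightarrow>
    \<psi> (smult (base B) t u) (fmult B t u a b) = fmult A (\<phi> t) (\<phi> u) (\<psi> t a) (\<psi> u b)"
  and fiber_map_star: "t \<in> T \<Longrightarrow> a \<in> fcarrier B t \<Longrightarrow>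
    \<psi> (sinv (base B) t) (fstar B t a) = fstar A (\<phi> t) (\<psi> t a)"
  and fiber_map_incl: "nat_le (base B) t u \<Longrightarrow> a \<in> fcarrier B t \<Longrightarrow>
    \<psi> u (fincl B u t a) = fincl A (\<phi> u) (\<phi> t) (\<psi> t a)"
  using morphism unfolding fell_morphism_def S_def mul_def by auto

lemma fiber_map_closed: "t \<in> T \<Longrightarrow> a \<in> fcarrier B t \<Longrightarrow> \<psi> t a \<in> fcarrier A (\<phi> t)"
  using fiber_map_linear unfolding lin_map_def by auto

lemma fiber_map_image: "t \<in> T \<Longrightarrow> \<psi> t ` fcarrier B t \<subseteq> fcarrier A (\<phi> t)"
  using fiber_map_closed by auto

lemma morphism_inv:
  assumes t: "t \<in> T"
  shows "\<phi> (sinv (base B) t) = inv (\<phi> t)"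
proof -
  note t' = B.S_inv[OF t]
  have "sinv (base A) (\<phi> t) = \<phi> (sinv (base B) t)"
  proof (rule sg.inv_unique[folded mul_def S_def])
    show "\<phi> t \<odot> \<phi> (sinv (base B) t) \<odot> \<phi> t = \<phi> t"
      using B.S_mult_inv_mult(1)[OF t] B.S_assoc[OF t t' t] morphism_mult[OF B.S_mult[OF t t'] t] morphism_mult[OF t t']
      by simp
    show "\<phi> (sinv (base B) t) \<odot> \<phi> t \<odot> \<phi> (sinv (base B) t) = \<phi> (sinv (base B) t)"
      using B.S_mult_inv_mult(2)[OF t] B.S_assoc[OF t' t t'] morphism_mult[OF B.S_mult[OF t' t] t'] morphism_mult[OF t' t]
      by simp
  qed (use morphism_closed t t' in auto)
  then show ?thesis unfolding inv_def by simp
qed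

lemma morphism_source: "t \<in> T \<Longrightarrow> \<phi> (smult (base B) (sinv (base B) t) t) = inv (\<phi> t) \<odot> \<phi> t"
  using morphism_mult B.S_inv morphism_inv by simp

lemma fiber_map_inner:
  assumes t: "t \<in> T" and a: "a \<in> fcarrier B t" and b: "b \<in> fcarrier B t"
  shows "\<psi> (smult (base B) (sinv (base B) t) t) (B.fib_inner t a b) = fib_inner (\<phi> t) (\<psi> t a) (\<psi> t b)"
  unfolding fib_inner_def B.fib_inner_def
  using fiber_map_mult[OF B.S_inv[OF t] t B.star_in_fib[OF t a] b] fiber_map_star[OF t a] morphism_inv[OF t] by simp

text \<open>The inclusion map of \<open>A\<close> from \<open>\<phi> v = \<phi> t\<close> to itself is the identity.\<close>

lemma fiber_map_below:
  assumes le: "nat_le (base B) v t" and eq: "\<phi> v = \<phi> t" and c: "c \<in> fcarrier B v"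
  shows "\<psi> v c \<in> \<psi> t ` fcarrier B t"
proof -
  have vt: "v \<in> T" "t \<in> T" using le unfolding nat_le_def by auto
  have "\<psi> t (fincl B t v c) = \<psi> v c"
    using fiber_map_incl[OF le c] eq incl_refl[OF morphism_closed[OF vt(2)]] fiber_map_closed[OF vt(1) c] by simp
  then show ?thesis
    using B.incl_in_fib[OF le c] by (metis imageI)
qed

text \<open>The pieces of the fibers of \<open>A\<close> that inherit regularity from \<open>B\<close>; the closure refers to the norm
  of \<open>A\<close>.\<close>

definition fiber_closure :: "'t \<Rightarrow> 'a set" where
  "fiber_closure t = closed_span (fib A (\<phi> t)) (\<psi> t ` fcarrier B t)"

lemma fiber_closure_subspace:
  assumes "t \<in> T"
  shows "closed_subspace (fib A (\<phi> t)) (fiber_closure t)" "\<psi> t ` fcarrier B t \<subseteq> fiber_closure t"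
  unfolding fiber_closure_def
  using complex_banach_space.closed_subspace_closed_span[OF banach[OF morphism_closed] fiber_map_image]
    complex_banach_space.subset_closed_span[OF banach[OF morphism_closed] fiber_map_image] assms by auto

lemma fiber_map_triple_product:
  assumes u: "u \<in> T" "\<phi> u = s" "x \<in> \<psi> u ` fcarrier B u"
    and v: "v \<in> T" "\<phi> v = s" "y \<in> \<psi> v ` fcarrier B v"
    and w: "w \<in> T" "\<phi> w = s" "z \<in> \<psi> w ` fcarrier B w"
  shows "\<phi> (smult (base B) u (smult (base B) (sinv (base B) v) w)) = s"
    "fmult A s (inv s \<odot> s) x (fib_inner s y z) \<in>
      \<psi> (smult (base B) u (smult (base B) (sinv (base B) v) w)) `
        fcarrier B (smult (base B) u (smult (base B) (sinv (base B) v) w))"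
proof -
  obtain a b c where abc: "a \<in> fcarrier B u" "x = \<psi> u a" "b \<in> fcarrier B v" "y = \<psi> v b"
    "c \<in> fcarrier B w" "z = \<psi> w c"
    using u v w by blast
  have s: "s \<in> S" using morphism_closed[OF u(1)] u(2) by simp
  note v' = B.S_inv[OF v(1)]
  note vw = B.S_mult[OF v' w(1)] and b' = B.star_in_fib[OF v(1) abc(3)]
  note bc = B.mult_in_fib[OF v' w(1) b' abc(5)]
  have \<phi>vw: "\<phi> (smult (base B) (sinv (base B) v) w) = inv s \<odot> s"
    using morphism_mult[OF v' w(1)] morphism_inv[OF v(1)] v w by simp
  then show "\<phi> (smult (base B) u (smult (base B) (sinv (base B) v) w)) = s"
    using morphism_mult[OF u(1) vw] u(2) s by (simp add: S_simps)
  show "fmult A s (inv s \<odot> s) x (fib_inner s y z) \<in>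
      \<psi> (smult (base B) u (smult (base B) (sinv (base B) v) w)) `
        fcarrier B (smult (base B) u (smult (base B) (sinv (base B) v) w))"
    using fiber_map_mult[OF u(1) vw abc(1) bc] fiber_map_mult[OF v' w(1) b' abc(5)] fiber_map_star[OF v(1) abc(3)]
      morphism_inv[OF v(1)] \<phi>vw u v w abc B.mult_in_fib[OF u(1) vw abc(1) bc]
    unfolding fib_inner_def by (metis imageI)
qed

text \<open>If \<open>t\<^sub>1\<close>, \<open>t\<^sub>2\<close> and \<open>t\<close> have the same image then \<open>t\<^sub>1 t\<^sub>2\<^sup>*\<close> is an idempotent by essential
  injectivity, so \<open>t\<^sub>1 t\<^sub>2\<^sup>* t \<le> t\<close>. Hence the image of the fiber at \<open>t\<close> absorbs products.\<close>

lemma slice_fiber_closure: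
  assumes ess: "\<And>u. u \<in> T \<Longrightarrow> \<phi> u \<in> E \<Longrightarrow> u \<in> idempotents (base B)"
    and total: "fcarrier A (\<phi> t) = closed_span (fib A (\<phi> t)) (\<Union>u\<in>{u \<in> T. \<phi> u = \<phi> t}. \<psi> u ` fcarrier B u)"
    and t: "t \<in> T"
  shows "slice (\<phi> t) (fiber_closure t)"
proof -
  define s where "s = \<phi> t"
  have s: "s \<in> S" unfolding s_def using morphism_closed[OF t] .
  let ?e = "s \<odot> inv s" and ?f = "inv s \<odot> s"
  define X where "X = fiber_closure t"
  have X: "closed_subspace (fib A s) X" "\<psi> t ` fcarrier B t \<subseteq> X"
    using fiber_closure_subspace[OF t] unfolding X_def s_def by auto
  define U where "U = (\<Union>u\<in>{u \<in> T. \<phi> u = s}. \<psi> u ` fcarrier B u)"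
  have U: "closed_span (fib A s) U = fcarrier A s" using total unfolding U_def s_def by simp
  have UA: "U \<subseteq> fcarrier A s" unfolding U_def using fiber_map_image by auto
  let ?tm = "smult (base B)" and ?ti = "sinv (base B)"
  have pieceU: "\<exists>u. u \<in> T \<and> \<phi> u = s \<and> x \<in> \<psi> u ` fcarrier B u" if "x \<in> U" for x
    using that unfolding U_def by blast
  have below: "x \<in> X" if "nat_le (base B) v t" "\<phi> v = s" "x \<in> \<psi> v ` fcarrier B v" for v x
    using fiber_map_below[OF that(1)] that(2,3) X(2) unfolding s_def by blast
  have left_gen: "fmult A s ?f x (fib_inner s y m) \<in> X"
    if x: "x \<in> U" and y: "y \<in> U" and m: "m \<in> \<psi> t ` fcarrier B t" for x y m
  proof -
    obtain u where u: "u \<in> T" "\<phi> u = s" "x \<in> \<psi> u ` fcarrier B u" using pieceU[OF x] by blast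
    obtain v where v: "v \<in> T" "\<phi> v = s" "y \<in> \<psi> v ` fcarrier B v" using pieceU[OF y] by blast
    note v' = B.S_inv[OF v(1)]
    have "\<phi> (?tm u (?ti v)) = ?e"
      using morphism_mult[OF u(1) v'] morphism_inv[OF v(1)] u v by simp
    then have "?tm u (?ti v) \<in> idempotents (base B)"
      using ess[OF B.S_mult[OF u(1) v']] E_range[OF s] by simp
    from B.le_idempotent_mult[OF t this] show ?thesis
      using below fiber_map_triple_product[OF u v t _ m, unfolded s_def] B.S_assoc[OF u(1) v' t] s_def by simp
  qed
  have right_gen: "fmult A s ?f m (fib_inner s x y) \<in> X"
    if m: "m \<in> \<psi> t ` fcarrier B t" and x: "x \<in> U" and y: "y \<in> U" for x y m
  proof -
    obtain u where u: "u \<in> T" "\<phi> u = s" "x \<in> \<psi> u ` fcarrier B u" using pieceU[OF x] by blast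
    obtain v where v: "v \<in> T" "\<phi> v = s" "y \<in> \<psi> v ` fcarrier B v" using pieceU[OF y] by blast
    note u' = B.S_inv[OF u(1)]
    have "\<phi> (?tm (?ti u) v) = ?f"
      using morphism_mult[OF u' v(1)] morphism_inv[OF u(1)] u v by simp
    then have "?tm (?ti u) v \<in> idempotents (base B)"
      using ess[OF B.S_mult[OF u' v(1)]] E_source[OF s] by simp
    from B.le_mult_idempotent[OF t this] show ?thesis
      using below fiber_map_triple_product[OF t _ m u v] s_def by simp
  qed
  have BtA: "\<psi> t ` fcarrier B t \<subseteq> fcarrier A s" unfolding s_def using fiber_map_image[OF t] .
  have Xspan: "X = closed_span (fib A s) (\<psi> t ` fcarrier B t)" unfolding X_def fiber_closure_def s_def ..
  have "slice s X"
  proof (rule sliceI_inner[OF s X(1)])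
    show "fmult A s ?f x (fib_inner s y m) \<in> X"
      if "x \<in> fcarrier A s" "y \<in> fcarrier A s" "m \<in> X" for x y m
      by (rule closed_span_triple_product[OF s X(1) UA UA BtA]) (use left_gen that U Xspan in auto)
    show "fmult A s ?f m (fib_inner s x y) \<in> X"
      if "m \<in> X" "x \<in> fcarrier A s" "y \<in> fcarrier A s" for x y m
      by (rule closed_span_triple_product[OF s X(1) BtA UA UA]) (use right_gen that U Xspan in auto)
  qed
  then show ?thesis unfolding X_def s_def .
qed

text \<open>The unitary of the fiber at \<open>t\<close>, restricted to inner products and transported to \<open>A\<close>, preserves
  inner products and so extends to the closures. That its image is dense is seen from
  \<open>\<psi>(x) \<approx> - \<psi>(x w)\<close> with \<open>w\<close> as in the Cayley estimate, since \<open>x w = x (x\<^sup>* y) = u (a\<^sup>* y)\<close> for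
  \<open>a = x v(x)\<^sup>*\<close>, where \<open>v\<close> is the inverse of \<open>u\<close>. The map \<open>\<psi>\<close> carries the relation between
  \<open>w\<close> and \<open>x\<^sup>* x\<close> to \<open>A\<close>, and the estimate is applied there.\<close>

lemma regular_fiber_closure:
  assumes t: "t \<in> T" and reg: "regular_bimod (fib_bimod B t)" and X: "slice (\<phi> t) (fiber_closure t)"
  shows "regular_slice (\<phi> t, fiber_closure t)"
proof -
  define s where "s = \<phi> t"
  have s: "s \<in> S" unfolding s_def using morphism_closed[OF t] .
  define f where "f = smult (base B) (sinv (base B) t) t"
  have f: "f \<in> T" "sinv (base B) f = f" "smult (base B) f f = f" "smult (base B) t f = t"
    "smult (base B) (sinv (base B) t) t = f" "smult (base B) f (sinv (base B) t) = sinv (base B) t"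
    using t unfolding f_def by (simp_all add: B.S_simps)
  note t' = B.S_inv[OF t]
  define F where "F = inv s \<odot> s"
  have F: "F \<in> S" "inv F = F" "F \<odot> F = F" "inv F \<odot> F = F" "s \<odot> F = s" "inv s \<odot> s = F"
    using s unfolding F_def by (simp_all add: S_simps)
  have \<phi>f: "\<phi> f = F" unfolding f_def F_def s_def using morphism_source[OF t] .
  let ?I = "B.inner_products t (fcarrier B t)"
  define J where "J = closed_span (fib B f) ?I"
  have J_slice: "B.slice f J"
    using B.slice_source[OF B.slice_carrier[OF t]] B.slices_closed(1)[OF B.slices_closed(2)]
      B.slice_carrier[OF t] unfolding B.slices_def J_def f_def by (metis (mono_tags, lifting) fst_conv mem_Collect_eq snd_conv)
  have JA: "c \<in> J \<Longrightarrow> c \<in> fcarrier B f" for c using B.sliceD(4)[OF J_slice] .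
  have J_act: "fmult B f f c d \<in> J" if "c \<in> J" "d \<in> fcarrier B f" for c d
    using B.sliceD(6)[OF J_slice that(1), of d] that f by simp
  have IJ: "B.fib_inner t x y \<in> J" if "x \<in> fcarrier B t" "y \<in> fcarrier B t" for x y
    unfolding J_def using complex_banach_space.subset_closed_span[OF B.banach[OF f(1)], of ?I]
      B.inner_products_in_fib[OF t] that f by auto
  obtain u where bij: "bij_betw u J (fcarrier B t)"
    and u: "\<And>b c. b \<in> J \<Longrightarrow> c \<in> J \<Longrightarrow> B.fib_inner t (u b) (u c) = B.fib_inner f b c"
    using reg unfolding regular_bimod_iff_bij B.fib_bimod_simps J_def B.fib_inner_def[of f] f(2,3) f_def[symmetric]
    by (auto simp: B.fib_alg_simps)
  have uB: "u c \<in> fcarrier B t" if "c \<in> J" for c using bij that bij_betwE by blast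
  \<comment> \<open>\<open>u\<close> is a module map: inner products with the vectors \<open>u y\<close> decide this, as they exhaust the fiber\<close>
  have u_mult: "u (fmult B f f c d) = fmult B t f (u c) d" if c: "c \<in> J" and d: "d \<in> fcarrier B f" for c d
  proof (rule B.inner_eqI[OF t])
    show "u (fmult B f f c d) \<in> fcarrier B t" using uB J_act c d by simp
    show ucd: "fmult B t f (u c) d \<in> fcarrier B t" using B.mult_in_fib[OF t f(1) uB[OF c] d] f by simp
    fix z assume z: "z \<in> fcarrier B t"
    then obtain y where y: "y \<in> J" "z = u y" using bij unfolding bij_betw_def by blast
    have y': "fstar B f y \<in> fcarrier B f" using B.star_in_fib[OF f(1) JA[OF y(1)]] f by simp
    have "B.fib_inner t z (u (fmult B f f c d)) = fmult B f f (fstar B f y) (fmult B f f c d)"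
      using u[OF y(1) J_act[OF c d]] y unfolding B.fib_inner_def[of f] f(2) by simp
    also have "\<dots> = fmult B f f (B.fib_inner t z (u c)) d"
      using u[OF y(1) c] y(2) B.mult_assoc[OF f(1,1,1) y' JA[OF c] d] f unfolding B.fib_inner_def[of f] by simp
    also have "\<dots> = B.fib_inner t z (fmult B t f (u c) d)"
      unfolding B.fib_inner_def using B.mult_assoc[OF t' t f(1) B.star_in_fib[OF t z] uB[OF c] d] f by simp
    finally show "B.fib_inner t z (u (fmult B f f c d)) = B.fib_inner t z (fmult B t f (u c) d)" .
  qed
  define R where "R = {(\<psi> f (B.fib_inner t a b), \<psi> t (u (B.fib_inner t a b))) | a b. a \<in> fcarrier B t \<and> b \<in> fcarrier B t}"
  have fstR: "fst ` R = {fib_inner s (\<psi> t a) (\<psi> t b) | a b. a \<in> fcarrier B t \<and> b \<in> fcarrier B t}"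
    unfolding R_def using fiber_map_inner[OF t] unfolding f_def[symmetric] s_def[symmetric]
    by (auto simp: image_iff) metis+
  have "unitarily_equivalent (F, closed_span (fib A F) (fst ` R)) (s, closed_span (fib A s) (snd ` R))"
  proof (rule unitary_extension)
    show "inv F \<odot> F = inv s \<odot> s" using F by simp
    show "R \<subseteq> fcarrier A F \<times> fcarrier A s"
      unfolding R_def using fiber_map_closed[OF f(1)] fiber_map_closed[OF t] IJ JA uB \<phi>f s_def by auto
    fix x y x' y' assume "(x, y) \<in> R" "(x', y') \<in> R"
    then obtain c c' where c: "c \<in> J" "x = \<psi> f c" "y = \<psi> t (u c)" and c': "c' \<in> J" "x' = \<psi> f c'" "y' = \<psi> t (u c')"
      unfolding R_def using IJ by auto
    have "fib_inner F x x' = \<psi> f (B.fib_inner f c c')"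
      using fiber_map_inner[OF f(1) JA[OF c(1)] JA[OF c'(1)]] f \<phi>f c c' by simp
    also have "\<dots> = fib_inner s y y'"
      using u[OF c(1) c'(1)] fiber_map_inner[OF t uB[OF c(1)] uB[OF c'(1)]] c c' unfolding f_def[symmetric] s_def[symmetric] by simp
    finally show "fib_inner F x x' = fib_inner s y y'" .
  qed (use F s in auto)
  moreover have "closed_span (fib A F) (fst ` R) =
    closed_span (fib A F) (inner_products s (fiber_closure t))" (is "_ = closed_span _ ?Y")
  proof
    interpret VF: complex_banach_space "fib A F" using banach[OF F(1)] .
    have XA: "x \<in> fcarrier A s" if "x \<in> fiber_closure t" for x using sliceD(4)[OF X that] unfolding s_def .
    have YA: "?Y \<subseteq> fcarrier A F" using inner_in_fib[OF s] XA F by auto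
    have "fst ` R \<subseteq> ?Y" unfolding fstR using fiber_closure_subspace(2)[OF t] by auto
    then show "closed_span (fib A F) (fst ` R) \<subseteq> closed_span (fib A F) ?Y"
      using VF.closed_span_mono YA by blast
    have fA: "fst ` R \<subseteq> fcarrier A F" using \<open>fst ` R \<subseteq> ?Y\<close> YA by blast
    have id: "bounded_semilinear (fib A (inv s \<odot> s)) (fib A F) (\<lambda>x. x)"
      unfolding F(6) bounded_semilinear_def lin_map_def by (auto intro!: exI[of _ 1])
    have BtA: "\<psi> t ` fcarrier B t \<subseteq> fcarrier A s" unfolding s_def using fiber_map_image[OF t] .
    have "fib_inner s x y \<in> closed_span (fib A F) (fst ` R)" if "x \<in> fiber_closure t" "y \<in> fiber_closure t" for x y
    proof (rule closed_span_inner[OF s id VF.complex_banach_space_axioms VF.closed_subspace_closed_span[OF fA] BtA BtA])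
      show "fib_inner s x' y' \<in> closed_span (fib A F) (fst ` R)"
        if "x' \<in> \<psi> t ` fcarrier B t" "y' \<in> \<psi> t ` fcarrier B t" for x' y'
        using VF.subset_closed_span[OF fA] that unfolding fstR by blast
    qed (use that in \<open>auto simp: fiber_closure_def s_def\<close>)
    then show "closed_span (fib A F) ?Y \<subseteq> closed_span (fib A F) (fst ` R)"
      by (intro VF.closed_span_least[OF VF.closed_subspace_closed_span[OF fA]]) auto
  qed
  moreover have "closed_span (fib A s) (snd ` R) = fiber_closure t"
  proof
    interpret Vs: complex_banach_space "fib A s" using banach[OF s] .
    have Xc: "closed_subspace (fib A s) (fiber_closure t)" "\<psi> t ` fcarrier B t \<subseteq> fiber_closure t"
      using fiber_closure_subspace[OF t] unfolding s_def by auto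
    have sub: "snd ` R \<subseteq> \<psi> t ` fcarrier B t" unfolding R_def using uB IJ by auto
    then show "closed_span (fib A s) (snd ` R) \<subseteq> fiber_closure t"
      by (intro Vs.closed_span_least[OF Xc(1)]) (use Xc(2) in auto)
    have sA: "snd ` R \<subseteq> fcarrier A s" using sub fiber_map_image[OF t] unfolding s_def by auto
    define Z where "Z = closed_span (fib A s) (snd ` R)"
    have Z: "closed_subspace (fib A s) Z" "snd ` R \<subseteq> Z"
      unfolding Z_def using Vs.closed_subspace_closed_span[OF sA] Vs.subset_closed_span[OF sA] by auto
    have "\<psi> t x \<in> Z" if x: "x \<in> fcarrier B t" for x
    proof -
      have xA: "\<psi> t x \<in> fcarrier A s" using fiber_map_closed[OF t x] unfolding s_def .
      have "\<psi> t x \<in> vclosure (fib A s) Z"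
        unfolding Vs.in_vclosure_iff
      proof (intro conjI allI impI xA)
        fix \<delta> :: real assume \<delta>: "\<delta> > 0"
        define \<epsilon> where "\<epsilon> = \<delta>\<^sup>2 / 4"
        have \<epsilon>: "\<epsilon> > 0" using \<delta> unfolding \<epsilon>_def by simp
        let ?z = "\<i> * complex_of_real \<epsilon>"
        let ?b = "fmult B (sinv (base B) t) t (fstar B t x) x"
        interpret Vt: complex_banach_space "fib B t" using B.banach[OF t] .
        obtain w where w: "w \<in> fcarrier B f" "vscale (fib B f) ?z w = vadd (fib B f) ?b (fmult B f f ?b w)"
          and wy: "w = fmult B (sinv (base B) t) t (fstar B t x)
            (vscale (fib B t) (inverse ?z) (vadd (fib B t) x (fmult B t f x w)))"
          using B.Cayley_exists[OF t x \<epsilon>] unfolding f(5) by blast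
        define y where "y = vscale (fib B t) (inverse ?z) (vadd (fib B t) x (fmult B t f x w))"
        have xw: "fmult B t f x w \<in> fcarrier B t" using B.mult_in_fib[OF t f(1) x w(1)] f by simp
        have y: "y \<in> fcarrier B t" unfolding y_def using x xw Vt.add_closed Vt.scale_closed by simp
        have w_inner: "w = B.fib_inner t x y" using wy unfolding y_def B.fib_inner_def .
        obtain c where c: "c \<in> J" "x = u c" using bij x unfolding bij_betw_def by blast
        note x' = B.star_in_fib[OF t x]
        have c': "fstar B f c \<in> fcarrier B f" using B.star_in_fib[OF f(1) JA[OF c(1)]] f by simp
        define a where "a = fmult B t f x (fstar B f c)"
        have a: "a \<in> fcarrier B t" unfolding a_def using B.mult_in_fib[OF t f(1) x c'] f by simp
        have "fmult B f f c w = fmult B (sinv (base B) t) t (fmult B f (sinv (base B) t) c (fstar B t x)) y"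
          unfolding w_inner B.fib_inner_def using B.mult_assoc[OF f(1) t' t JA[OF c(1)] x' y] f by simp
        also have "fmult B f (sinv (base B) t) c (fstar B t x) = fstar B t a"
          unfolding a_def using B.star_mult[OF t f(1) x c'] B.star_star[OF f(1) JA[OF c(1)]] f by simp
        finally have "fmult B t f x w = u (B.fib_inner t a y)"
          using u_mult[OF c(1) w(1)] c(2) unfolding B.fib_inner_def by simp
        then have xwZ: "\<psi> t (fmult B t f x w) \<in> Z"
          using Z(2) a y unfolding R_def by force
        have \<psi>xw: "\<psi> t (fmult B t f x w) = fmult A s F (\<psi> t x) (\<psi> f w)"
          using fiber_map_mult[OF t f(1) x w(1)] f \<phi>f unfolding s_def by simp
        have wA: "\<psi> f w \<in> fcarrier A F" using fiber_map_closed[OF f(1) w(1)] \<phi>f by simp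
        have \<psi>b: "\<psi> f ?b = fmult A (inv s) s (fstar A s (\<psi> t x)) (\<psi> t x)"
          using fiber_map_inner[OF t x x] unfolding fib_inner_def B.fib_inner_def f(5) s_def .
        have bB: "?b \<in> fcarrier B f" using B.inner_in_fib[OF t x x] f unfolding B.fib_inner_def by simp
        have bw: "fmult B f f ?b w \<in> fcarrier B f" using B.mult_in_fib[OF f(1,1) bB w(1)] f by simp
        have "vscale (fib A F) ?z (\<psi> f w) = \<psi> f (vscale (fib B f) ?z w)"
          using fiber_map_linear[OF f(1)] w(1) \<phi>f unfolding lin_map_def by simp
        also have "\<dots> = vadd (fib A F) (\<psi> f ?b) (\<psi> f (fmult B f f ?b w))"
          unfolding w(2) using fiber_map_linear[OF f(1)] bB bw \<phi>f unfolding lin_map_def by simp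
        also have "\<psi> f (fmult B f f ?b w) = fmult A F F (\<psi> f ?b) (\<psi> f w)"
          using fiber_map_mult[OF f(1,1) bB w(1)] f \<phi>f by simp
        finally have "(vnorm (fib A s) (vadd (fib A s) (\<psi> t x) (fmult A s F (\<psi> t x) (\<psi> f w))))\<^sup>2 \<le> 2 * \<epsilon>"
          using Cayley_estimate[OF s xA \<epsilon>, of "\<psi> f w"] wA F \<psi>b by simp
        also have "\<dots> < \<delta>\<^sup>2" using \<delta> unfolding \<epsilon>_def by simp
        finally have "vnorm (fib A s) (vadd (fib A s) (\<psi> t x) (\<psi> t (fmult B t f x w))) < \<delta>"
          using \<delta> power_less_imp_less_base unfolding \<psi>xw by (metis less_eq_real_def)
        moreover have "\<psi> t (fmult B t f x w) \<in> fcarrier A s" using closed_subspace_imp_carrier[OF Z(1) xwZ] .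
        ultimately have "vdist (fib A s) (\<psi> t x) (vscale (fib A s) (-1) (\<psi> t (fmult B t f x w))) < \<delta>"
          using xA by (simp add: Vs.dist_eq Vs.scale_closed Vs.scale_scale Vs.scale_one)
        then show "\<exists>z\<in>Z. z \<in> fcarrier A s \<and> vdist (fib A s) (\<psi> t x) z < \<delta>"
          using closed_subspace_scale[OF Z(1) xwZ] closed_subspace_imp_carrier[OF Z(1)] by blast
      qed
      then show ?thesis using Z(1) unfolding closed_subspace_def by simp
    qed
    then show "fiber_closure t \<subseteq> closed_span (fib A s) (snd ` R)"
      using Vs.closed_span_least[OF Z(1), of "\<psi> t ` fcarrier B t"] unfolding fiber_closure_def s_def[symmetric] Z_def by auto
  qed
  ultimately show ?thesis
    unfolding regular_slice_def s_def[symmetric] slice_source[OF X[folded s_def]] using F(6) by simp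
qed

end

lemma locally_regular_if_regular_refinement:
  assumes ref: "refinement_of B A" and reg: "regular B"
  shows "locally_regular A"
proof -
  obtain \<phi> \<psi> where mor: "fell_bundle B" "fell_bundle A" "fell_morphism B A \<phi> \<psi>"
    and ess: "\<forall>t\<in>elts (base B). \<phi> t \<in> idempotents (base A) \<longrightarrow> t \<in> idempotents (base B)"
    and total: "\<forall>s\<in>elts (base A). fcarrier A s =
        closed_span (fib A s) (\<Union>t\<in>{t \<in> elts (base B). \<phi> t = s}. \<psi> t ` fcarrier B t)"
    using ref unfolding refinement_of_def by (elim exE conjE)
  interpret fell_bundle_morphism A "elts (base A)" "smult (base A)" "sinv (base A)" "nat_le (base A)" B \<phi> \<psi>
    using mor by (intro fell_bundle_morphism.intro fell_bundle_morphism_axioms.intro)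
  show ?thesis
    unfolding locally_regular_def locally_regular_bimod_def
  proof (intro ballI exI conjI)
    fix s assume s: "s \<in> elts (base A)"
    let ?\<F> = "fiber_closure ` {t \<in> elts (base B). \<phi> t = s}"
    have slice: "slice s (fiber_closure t)" if t: "t \<in> elts (base B)" "\<phi> t = s" for t
      using slice_fiber_closure[of t] ess total s t by auto
    show "closed_sub_bimod (fib_bimod A s) X" "regular_bimod (sub_bimod (fib_bimod A s) X)" if X: "X \<in> ?\<F>" for X
    proof -
      obtain t where t: "t \<in> elts (base B)" "\<phi> t = s" "X = fiber_closure t" using X by blast
      show "closed_sub_bimod (fib_bimod A s) X"
        using closed_sub_bimod_iff_slice[OF s] slice[OF t(1,2)] t(3) by simp
      have "regular_slice (s, X)"
        using regular_fiber_closure[OF t(1)] reg slice[OF t(1,2)] t unfolding regular_def by simp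
      then show "regular_bimod (sub_bimod (fib_bimod A s) X)"
        using regular_sub_bimod_iff slice[OF t(1,2)] t(3) by simp
    qed
    interpret V: complex_banach_space "fib A s" using banach[OF s] .
    have "(\<Union>t\<in>{t \<in> elts (base B). \<phi> t = s}. \<psi> t ` fcarrier B t) \<subseteq> \<Union>?\<F>"
      using fiber_closure_subspace(2) by auto
    moreover have "\<Union>?\<F> \<subseteq> fcarrier A s" using slice sliceD(3) by blast
    ultimately have "fcarrier A s \<subseteq> closed_span (fib A s) (\<Union>?\<F>)"
      using V.closed_span_mono total s by simp
    then show "vcarrier (bspace (fib_bimod A s)) = closed_span (bspace (fib_bimod A s)) (\<Union>?\<F>)"
      unfolding fib_bimod_simps using V.closed_span_subset_carrier by blast
  qed
qed

theorem proposition8p6: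
  fixes A :: "('s, 'a) fell"
  assumes "fell_bundle A"
  shows "(\<exists>B :: ('s \<times> 'a set, 'a) fell. refinement_of B A \<and> saturated B) \<and>
    (locally_regular A \<longrightarrow>
      (\<exists>B :: ('s \<times> 'a set, 'a) fell. refinement_of B A \<and> regular B \<and> saturated B)) \<and>
    ((\<exists>B :: ('t, 'b) fell. refinement_of B A \<and> regular B) \<longrightarrow> locally_regular A)"
  using fell_bundle.saturated_refinement_slices[OF assms] fell_bundle.regular_saturated_refinement[OF assms]
    locally_regular_if_regular_refinement by blast

end
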